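(* Let $k>2$ be an odd integer and let $\mathcal{S}_k$ be a sun with $k$ beams (defined in the context). In the convex grabbing game on $\mathcal{S}_k$, if Bob follows the Careful greedy tactic in every one of his moves, then, no matter how Alice plays, Bob obtains at least $\frac{3k-1}{2}=\frac{3}{4}R(\mathcal{S}_k)-\frac12$ red cherries. Consequently $M(\mathcal{S}_k)\ge \frac34 R(\mathcal{S}_k)-\frac12$.
   Context: Convex grabbing game: a cake is a finite set of points (cherries) in general position in the plane, each with a weight; here weights are in $\{0,1\}$: weight-1 cherries are red, weight-0 cherries are green. For a set $C$ of remaining cherries, $\mathrm{Ex}(C)=\{c\in C: c\notin \mathrm{Conv}(C\setminus\{c\})\}$. Alice and Bob alternate, Alice first; each move removes one cherry of $\mathrm{Ex}(C)$ from the remaining set $C$ and gives it to the mover, until no cherries remain. Each player's score is the number of red cherries they took; Alice wants to minimize Bob's score, Bob to maximize it. $M(\mathcal{C})$ is Bob's total score under optimal play of both players (the minimax value). $R(C)$ denotes the number of red cherries in $C$. A beam is a set of four cherries lying on an arc, coloured green, red, green, red in order along the arc (starting from the outermost one, i.e. the one farthest from the centre). For odd $k>2$, a sun $\mathcal{S}_k$ is a cake consisting of $k$ beams and one additional green cherry $\zeta$ (the centre) such that: (i) the configuration is rotationally symmetric with the $k$ beams evenly spaced around $\zeta$; (ii) each beam is far enough from the centre that after removal of any proper subset $Y$ of the cherries of a beam, the outermost remaining cherry of that beam is in $\mathrm{Ex}(\mathcal{S}_k\setminus Y)$; (iii) for each beam $\mathcal{Y}_i$, a line through any two cherries of $\mathcal{Y}_i$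 does not cut through any other beam and has $\frac{k-1}{2}$ of the other beams on each side, and $\mathcal{Y}_i\cup\{\zeta\}$ is in convex position. Thus $R(\mathcal{S}_k)=2k$ and $\mathcal{S}_k$ has $2k+1$ green cherries. Careful greedy tactic (for the player to move, with $C$ the remaining set): If there is an extremal red cherry: if some beam contains an extremal red cherry and also a remaining red cherry that is not extremal, take the extremal red cherry from such a beam; otherwise, if there is a beam with a single extremal red cherry, take that cherry; otherwise take any extremal red cherry. If there is no extremal red cherry: if some beam has at least one remaining green cherry and no remaining red cherry, take an extremal green cherry from such a beam; otherwise the tactic fails.
   Formalization: "Lying on an arc" is read as a convex arc running in towards the centre: the four cherries in order, then the centre, are consecutive vertices of a convex polygon. If the centre lies between the third and fourth cherry in convex position, the tactic can fail. *)

theory Defs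
  imports "HOL-Analysis.Analysis"
begin

text \<open>The plane is the type of complex numbers. A cake is a finite set \<open>C\<close> of points in general
  position together with the subset \<open>red\<close> of its cherries of weight 1; the others are green.\<close>

definition general_position :: "complex set \<Rightarrow> bool" where
  "general_position S \<longleftrightarrow> (\<forall>T. T \<subseteq> S \<and> card T = 3 \<longrightarrow> \<not> collinear T)"

definition cake :: "complex set \<Rightarrow> complex set \<Rightarrow> bool" where
  "cake C red \<longleftrightarrow> finite C \<and> red \<subseteq> C \<and> general_position C"

definition extremal :: "complex set \<Rightarrow> complex set" where
  "extremal C = {c \<in> C. c \<notin> convex hull (C - {c})}"

definition num_red :: "complex set \<Rightarrow> complex set \<Rightarrow> nat" where
  "num_red red C = card (C \<inter> red)"


section \<open>The game\<close>

datatype player = Alice | Bob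

text \<open>\<open>game_value red p C\<close> is the number of red cherries Bob still collects under optimal play
  when the cherries in \<open>C\<close> remain and player \<open>p\<close> is to move.\<close>

function game_value :: "complex set \<Rightarrow> player \<Rightarrow> complex set \<Rightarrow> nat" where
  "game_value red p C =
     (if finite C \<and> C \<noteq> {} then
        (case p of
           Alice \<Rightarrow> (MIN c\<in>extremal C. game_value red Bob (C - {c}))
         | Bob \<Rightarrow> (MAX c\<in>extremal C. of_bool (c \<in> red) + game_value red Alice (C - {c})))
      else 0)"
  by auto
termination
  by (relation "Wellfounded.measure (\<lambda>(red, p, C). card C)")
     (auto simp: extremal_def card_gt_0_iff)

declare game_value.simps [simp del]

definition minimax :: "complex set \<Rightarrow> complex set \<Rightarrow> nat" where
  "minimax C red = game_value red Alice C"

text \<open>A (possibly unfinished) play on \<open>C\<close> is the list of the cherries in the order in which they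
  are taken. Positions are counted from 0, so Alice makes the moves at even positions and Bob
  those at odd positions. The play is finished when \<open>set xs = C\<close>.\<close>

definition legal_play :: "complex set \<Rightarrow> complex list \<Rightarrow> bool" where
  "legal_play C xs \<longleftrightarrow> (\<forall>n<length xs. xs ! n \<in> extremal (C - set (take n xs)))"

text \<open>A strategy maps the set of remaining cherries to the set of moves it permits; it fails where
  this set is empty.\<close>

definition bob_follows :: "(complex set \<Rightarrow> complex set) \<Rightarrow> complex set \<Rightarrow> complex list \<Rightarrow> bool" where
  "bob_follows strat C xs \<longleftrightarrow> (\<forall>n<length xs. odd n \<longrightarrow> xs ! n \<in> strat (C - set (take n xs)))"

definition bob_score :: "complex set \<Rightarrow> complex list \<Rightarrow> nat" where
  "bob_score red xs = card {n. n < length xs \<and> odd n \<and> xs ! n \<in> red}"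


section \<open>Suns\<close>

text \<open>\<open>orient a b c\<close> is positive iff \<open>a, b, c\<close> make a left turn.\<close>

definition orient :: "complex \<Rightarrow> complex \<Rightarrow> complex \<Rightarrow> real" where
  "orient a b c = Im (cnj (b - a) * (c - a))"

definition left_side :: "complex \<Rightarrow> complex \<Rightarrow> complex set" where
  "left_side p q = {x. orient p q x > 0}"

definition convex_position :: "complex set \<Rightarrow> bool" where
  "convex_position S \<longleftrightarrow> extremal S = S"

text \<open>The list enumerates the vertices of a convex polygon in clockwise or anticlockwise order.\<close>

definition convex_polygon :: "complex list \<Rightarrow> bool" where
  "convex_polygon xs \<longleftrightarrow>
     (\<forall>a b c. a < b \<and> b < c \<and> c < length xs \<longrightarrow> orient (xs ! a) (xs ! b) (xs ! c) > 0) \<or>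
     (\<forall>a b c. a < b \<and> b < c \<and> c < length xs \<longrightarrow> orient (xs ! a) (xs ! b) (xs ! c) < 0)"

text \<open>The cherries of beam \<open>i\<close> are \<open>Y i 0, Y i 1, Y i 2, Y i 3\<close>, in order along the arc from the
  outermost one inwards, coloured green, red, green, red.\<close>

definition beam :: "(nat \<Rightarrow> nat \<Rightarrow> complex) \<Rightarrow> nat \<Rightarrow> complex set" where
  "beam Y i = Y i ` {..<4}"

definition sun_cherries :: "nat \<Rightarrow> complex \<Rightarrow> (nat \<Rightarrow> nat \<Rightarrow> complex) \<Rightarrow> complex set" where
  "sun_cherries k \<zeta> Y = insert \<zeta> (\<Union>i<k. beam Y i)"

definition sun_red :: "nat \<Rightarrow> (nat \<Rightarrow> nat \<Rightarrow> complex) \<Rightarrow> complex set" where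
  "sun_red k Y = (\<Union>i<k. {Y i 1, Y i 3})"

text \<open>"Lying on an arc" is read as lying on a convex arc (for instance, but not necessarily, a
  circular one) that runs from the outermost cherry in towards the centre: the four cherries in
  their order along the arc, followed by the centre, are the consecutive vertices of a convex
  polygon. Bare convex position of the five points would allow the centre to lie between two
  consecutive cherries of the beam in the cyclic order; that is not intended (for such point sets
  the strategy below can fail).

  In the condition on lines, \<open>p\<close> and \<open>q\<close> may be interchanged, so it speaks about both sides of
  the line.\<close>

definition sun :: "nat \<Rightarrow> complex \<Rightarrow> (nat \<Rightarrow> nat \<Rightarrow> complex) \<Rightarrow> bool" where
  "sun k \<zeta> Y \<longleftrightarrow>
     cake (sun_cherries k \<zeta> Y) (sun_red k Y) \<and>
     inj_on (\<lambda>(i, j). Y i j) ({..<k} \<times> {..<4}) \<and>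
     (\<forall>i<k. \<zeta> \<notin> beam Y i) \<and>
     (\<forall>i<k. \<forall>j<4. Y i j = \<zeta> + cis (2 * pi * real i / real k) * (Y 0 j - \<zeta>)) \<and>
     (\<forall>i<k. \<forall>j\<in>{1, 2, 3}. dist \<zeta> (Y i j) < dist \<zeta> (Y i 0)) \<and>
     (\<forall>i<k. convex_polygon [Y i 0, Y i 1, Y i 2, Y i 3, \<zeta>]) \<and>
     (\<forall>i<k. convex_position (insert \<zeta> (beam Y i))) \<and>
     (\<forall>i<k. \<forall>A c. A \<subset> beam Y i \<and> c \<in> beam Y i - A \<and>
        (\<forall>d\<in>beam Y i - A. dist \<zeta> d \<le> dist \<zeta> c) \<longrightarrow>
        c \<in> extremal (sun_cherries k \<zeta> Y - A)) \<and>
     (\<forall>i<k. \<forall>p\<in>beam Y i. \<forall>q\<in>beam Y i. p \<noteq> q \<longrightarrow>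
        (\<forall>j<k. j \<noteq> i \<longrightarrow> affine hull {p, q} \<inter> convex hull (beam Y j) = {}) \<and>
        card {j. j < k \<and> j \<noteq> i \<and> beam Y j \<subseteq> left_side p q} = (k - 1) div 2)"


section \<open>The Careful greedy strategy\<close>

definition careful_greedy ::
  "nat \<Rightarrow> (nat \<Rightarrow> nat \<Rightarrow> complex) \<Rightarrow> complex set \<Rightarrow> complex set" where
  "careful_greedy k Y C =
     (let red = sun_red k Y;
          E = extremal C;
          hiding = {i. i < k \<and> beam Y i \<inter> E \<inter> red \<noteq> {} \<and> beam Y i \<inter> C \<inter> red - E \<noteq> {}};
          single = {i. i < k \<and> card (beam Y i \<inter> E \<inter> red) = 1};
          redless = {i. i < k \<and> beam Y i \<inter> C - red \<noteq> {} \<and> beam Y i \<inter> C \<inter> red = {}}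
      in if E \<inter> red \<noteq> {} then
           (if hiding \<noteq> {} then \<Union>i\<in>hiding. beam Y i \<inter> E \<inter> red
            else if single \<noteq> {} then \<Union>i\<in>single. beam Y i \<inter> E \<inter> red
            else E \<inter> red)
         else \<Union>i\<in>redless. beam Y i \<inter> E - red)"

end

theory Submission
  imports Defs
begin

text \<open>Write \<open>k = 2 h + 1\<close>. The beams of a sun form a cyclic tournament: \<open>h\<close> of the other beams lie on
  the outer (convex) side of every line through two cherries of a given beam, and \<open>h\<close> on the inner
  side. An inner cherry of a beam is extremal only if one of these two sides has been cleared, so
  until some \<open>h\<close> beams are exhausted only the outermost cherries are extremal, Alice has to take
  green ones, and Bob answers each time with the red cherry behind it. From then on the remaining
  beams lie in a half turn and are linearly ordered; the first of them is completely exposed, the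
  last one at both ends once the centre is gone, and the others only at their outermost cherry.

  Count the second reds of a beam taken by Bob minus the first reds of a beam taken by Alice. This
  number is at least \<open>h\<close> when \<open>h\<close> beams are exhausted. Later Alice can decrease it without immediate
  compensation only by using a red cherry that is hidden in a beam with another, exposed red one.
  Careful greedy play destroys such pairs, and the slack recorded in the invariants below pays for
  the remaining ones. At the end the number is at least \<open>h\<close>, and Bob has \<open>k + h\<close> red cherries.\<close>

text \<open>The definition of a sun only counts the beams on either side of a line; which beams they
  are has to be derived. It suffices to place the outermost cherries of the beams beyond a half turn
  on the inner side: the counts then force the outer side to consist of exactly the h beams
  following in the cyclic order. A second obstacle is that the extremality condition of a sun names
  the outermost remaining cherry by its distance from the centre, whereas the game is played along
  the arc. Distances are assumed to be compared with the outermost cherry only, so their decrease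
  along the whole arc needs an argument of its own. After that, every question of extremality is
  settled by a triangle around the cherry or by a half plane that avoids it, and a position shrinks
  to the remaining indices of each beam and one bit for the centre. On this level the moves of both
  players are over-approximated, so the invariants have to survive more plays than the real ones.
  Parity enters once: the centre alone cannot be left for Bob, because the number of beam cherries,
  4 k, is even.\<close>

section \<open>Orientation under similarities, permutations and reflection\<close>

lemma orient_coords:
  "orient a b c = (Re b - Re a) * (Im c - Im a) - (Im b - Im a) * (Re c - Re a)"
  by (simp add: orient_def algebra_simps)

lemma orient_affine_image:
  "orient (z + w * a) (z + w * b) (z + w * c) = (norm w)\<^sup>2 * orient a b c"
  unfolding orient_coords cmod_power2 by simp algebra

lemma orient_rotate: "orient b c a = orient a b c"
  unfolding orient_coords by algebra

lemma orient_swap: "orient b a c = - orient a b c"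
  unfolding orient_coords by algebra

lemma orient_cnj: "orient (cnj a) (cnj b) (cnj c) = - orient a b c"
  unfolding orient_coords by (simp add: algebra_simps)

lemma Im_polar: "z = complex_of_real r * cis t \<Longrightarrow> Im z = r * sin t"
  by simp

section \<open>A beam in normal position\<close>

text \<open>The centre is \<open>0\<close>, the outermost cherry is \<open>1\<close>, and the beam bends anticlockwise.\<close>

locale normalized_beam =
  fixes k h :: nat and y :: "nat \<Rightarrow> complex"
  assumes k: "k = 2 * h + 1" and h: "h \<ge> 1"
    and y0: "y 0 = 1"
    and norm_less: "\<And>a. a \<in> {1,2,3} \<Longrightarrow> norm (y a) < 1"
    and convex: "\<And>a b c. a < b \<Longrightarrow> b < c \<Longrightarrow> c < 4 \<Longrightarrow> orient (y a) (y b) (y c) > 0"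
    and convex_centre: "\<And>a b. a < b \<Longrightarrow> b < 4 \<Longrightarrow> orient (y a) (y b) 0 > 0"
    and card_right: "\<And>a b. a < b \<Longrightarrow> b < 4 \<Longrightarrow>
      card {j \<in> {1..<k}. \<forall>c<4. orient (y a) (y b) (cis (2 * pi * real j / real k) * y c) < 0} = h"
    and card_left: "\<And>a b. a < b \<Longrightarrow> b < 4 \<Longrightarrow>
      card {j \<in> {1..<k}. \<forall>c<4. orient (y a) (y b) (cis (2 * pi * real j / real k) * y c) > 0} = h"
begin

abbreviation rot :: "nat \<Rightarrow> complex" where "rot j \<equiv> cis (2 * pi * real j / real k)"

section \<open>Angles of the rotated beams, with a margin around the half turn\<close>

lemma angle_small: "j \<le> h \<Longrightarrow> 2 * pi * real j / real k \<le> pi - pi / real k"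
proof -
  assume "j \<le> h"
  then have "2 * real j \<le> real k - 1" using k by simp
  then have "pi * (2 * real j) \<le> pi * (real k - 1)" by (intro mult_left_mono) auto
  moreover have "real k > 0" using k by simp
  ultimately show ?thesis by (simp add: field_simps)
qed

lemma angle_large: "h < j \<Longrightarrow> 2 * pi * real j / real k \<ge> pi + pi / real k"
proof -
  assume "h < j"
  then have "2 * real j \<ge> real k + 1" using k by simp
  then have "pi * (2 * real j) \<ge> pi * (real k + 1)" by (intro mult_left_mono) auto
  then have "pi * (2 * real j) / real k \<ge> pi * (real k + 1) / real k"
    by (rule divide_right_mono) simp
  moreover have "pi * (real k + 1) / real k = pi + pi / real k"
    using k by (simp add: field_simps)
  ultimately show ?thesis by (simp add: mult_ac)
qed

lemma angle_less: "j < k \<Longrightarrow> 2 * pi * real j / real k \<le> 2 * pi - 2 * pi / real k"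
proof -
  assume "j < k"
  then have "real j \<le> real k - 1" by simp
  then have "(2 * pi) * (real j) \<le> (2 * pi) * (real k - 1)" by (intro mult_left_mono) auto
  moreover have "real k > 0" using k by simp
  ultimately show ?thesis by (simp add: field_simps)
qed

lemma angle_pos: "0 < j \<Longrightarrow> 2 * pi * real j / real k \<ge> 2 * pi / real k"
  by (auto intro!: divide_right_mono)

lemma pi_div_k: "0 < pi / real k" "3 * (pi / real k) \<le> pi"
  using k h by (auto simp: field_simps)

lemma Im_pos:
  assumes "b \<in> {1,2,3}"
  shows "Im (y b) > 0"
  using convex_centre[of 0 b] assms y0 by (auto simp: orient_coords)

lemma Re_less:
  assumes "b \<in> {1,2,3}"
  shows "Re (y b) < 1"
  using norm_less[OF assms] complex_Re_le_cmod[of "y b"] by linarith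

lemma Im_rot_neg:
  assumes "h < j" "j < k"
  shows "Im (rot j) < 0"
proof -
  let ?t = "2 * pi * real j / real k"
  have "sin (?t - pi) > 0"
    using angle_large[OF assms(1)] angle_less[OF assms(2)] pi_div_k by (intro sin_gt_zero) auto
  then show ?thesis by (simp add: sin_diff)
qed

section \<open>Which beams lie on either side of a line through a beam\<close>

text \<open>Counting turns a test of single cherries into full knowledge. If no beam beyond the half
  turn has its outermost cherry on the right, then the beams on the right are among
  \<open>1..h\<close>; there are \<open>h\<close> of them, so they are exactly these. The beams on
  the left avoid them, and again their number decides.\<close>

lemma right_left_sets:
  assumes "a < b" "b < 4"
    and right: "\<And>j. h < j \<Longrightarrow> j < k \<Longrightarrow> orient (y a) (y b) (rot j) \<ge> 0"
  shows "\<And>j c. 1 \<le> j \<Longrightarrow> j \<le> h \<Longrightarrow> c < 4 \<Longrightarrow> orient (y a) (y b) (rot j * y c) < 0"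
    and "\<And>j c. h < j \<Longrightarrow> j < k \<Longrightarrow> c < 4 \<Longrightarrow> orient (y a) (y b) (rot j * y c) > 0"
proof -
  let ?I = "{j \<in> {1..<k}. \<forall>c<4. orient (y a) (y b) (rot j * y c) < 0}"
  let ?L = "{j \<in> {1..<k}. \<forall>c<4. orient (y a) (y b) (rot j * y c) > 0}"
  have sub: "?I \<subseteq> {1..h}"
  proof
    fix j assume j: "j \<in> ?I"
    then have "orient (y a) (y b) (rot j * y 0) < 0" by simp
    then show "j \<in> {1..h}" using right[of j] j y0 by force
  qed
  have I: "?I = {1..h}"
    using card_subset_eq[OF _ sub] card_right[OF assms(1,2)] by simp
  have subL: "?L \<subseteq> {h+1..<k}"
  proof
    fix j assume j: "j \<in> ?L"
    then have "orient (y a) (y b) (rot j * y 0) > 0" by simp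
    then have "j \<notin> ?I" by force
    then show "j \<in> {h+1..<k}" using I j by auto
  qed
  have L: "?L = {h+1..<k}"
    using card_subset_eq[OF _ subL] card_left[OF assms(1,2)] k by simp
  show "\<And>j c. 1 \<le> j \<Longrightarrow> j \<le> h \<Longrightarrow> c < 4 \<Longrightarrow> orient (y a) (y b) (rot j * y c) < 0"
  proof -
    fix j c assume "1 \<le> j" "j \<le> h" "c < (4::nat)"
    then have "j \<in> ?I" unfolding I by simp
    then show "orient (y a) (y b) (rot j * y c) < 0" using \<open>c < 4\<close> by blast
  qed
  show "\<And>j c. h < j \<Longrightarrow> j < k \<Longrightarrow> c < 4 \<Longrightarrow> orient (y a) (y b) (rot j * y c) > 0"
  proof -
    fix j c assume "h < j" "j < k" "c < (4::nat)"
    then have "j \<in> ?L" unfolding L by simp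
    then show "orient (y a) (y b) (rot j * y c) > 0" using \<open>c < 4\<close> by blast
  qed
qed

text \<open>The point \<open>y b\<close> lies above the real axis with real part below 1, so beyond
  1 the line descends to the right. The closed lower half of the unit disc meets it only in
  1.\<close>

lemma left_of_first_line:
  assumes "b \<in> {1,2,3}" "Im v \<le> 0" "norm v \<le> 1" "v \<noteq> 1"
  shows "orient (y 0) (y b) v > 0"
proof -
  have "Re v \<noteq> 1"
  proof
    assume "Re v = 1"
    then have "(Im v)\<^sup>2 \<le> 0" using assms(3) cmod_power2[of v]
      by (metis add_le_same_cancel1 norm_ge_zero one_power2 power_mono)
    then show False using \<open>Re v = 1\<close> assms(4) by (simp add: complex_eq_iff)
  qed
  then have "Re v < 1" using complex_Re_le_cmod[of v] assms(3) by linarith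
  then have "(Re (y b) - 1) * Im v \<ge> 0" "Im (y b) * (1 - Re v) > 0"
    using Im_pos[OF assms(1)] Re_less[OF assms(1)] assms(2)
    by (auto intro: mult_nonpos_nonpos)
  then show ?thesis unfolding orient_coords y0 by (simp add: algebra_simps)
qed

lemma first_line:
  assumes "b \<in> {1,2,3}"
  shows "\<And>j c. 1 \<le> j \<Longrightarrow> j \<le> h \<Longrightarrow> c < 4 \<Longrightarrow> orient (y 0) (y b) (rot j * y c) < 0"
    and "\<And>j c. h < j \<Longrightarrow> j < k \<Longrightarrow> c < 4 \<Longrightarrow> orient (y 0) (y b) (rot j * y c) > 0"
proof -
  have r: "orient (y 0) (y b) (rot j) \<ge> 0" if "h < j" "j < k" for j
    using left_of_first_line[OF assms, of "rot j"] Im_rot_neg[OF that] by fastforce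
  show "\<And>j c. 1 \<le> j \<Longrightarrow> j \<le> h \<Longrightarrow> c < 4 \<Longrightarrow> orient (y 0) (y b) (rot j * y c) < 0"
    and "\<And>j c. h < j \<Longrightarrow> j < k \<Longrightarrow> c < 4 \<Longrightarrow> orient (y 0) (y b) (rot j * y c) > 0"
    using right_left_sets[of 0 b] r assms by auto
qed

text \<open>After 1 to \<open>h\<close> rotation steps, \<open>y a\<close> is to the right of the
  line through 1 and \<open>y a\<close>, by \<open>first_line\<close>, whereas points of the lower
  half disc are to its left. Hence it stays in the upper half plane up to step \<open>h\<close>,
  which bounds its argument by pi - 2 pi h / k = pi / k.\<close>

lemma sector:
  assumes "a < 4"
  obtains r t where "y a = of_real r * cis t" "0 < r" "0 \<le> t" "t < pi / real k"
proof (cases "a = 0")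
  case True
  then show ?thesis using that[of 1 0] y0 pi_div_k by simp
next
  case False
  then have a: "a \<in> {1,2,3}" using assms by auto
  define t where "t = Arg (y a)"
  have ya: "y a = of_real (norm (y a)) * cis t"
    by (simp add: t_def rcis_cmod_Arg flip: rcis_def)
  have nz: "norm (y a) > 0" using Im_pos[OF a] by auto
  have t: "0 < t" "t < pi" using Im_pos[OF a] Arg_lt_pi unfolding t_def by blast+
  have "t + 2 * pi * real j / real k < pi" if "j \<le> h" for j
    using that
  proof (induction j)
    case 0
    then show ?case using t by simp
  next
    case (Suc j)
    let ?s = "t + 2 * pi * real (Suc j) / real k"
    have "Im (rot (Suc j) * y a) > 0"
    proof (rule ccontr)
      assume "\<not> Im (rot (Suc j) * y a) > 0"
      moreover have "norm (rot (Suc j) * y a) < 1" using norm_less[OF a] by (simp add: norm_mult)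
      ultimately have "orient (y 0) (y a) (rot (Suc j) * y a) > 0"
        using left_of_first_line[OF a, of "rot (Suc j) * y a"] by force
      then show False using first_line(1)[OF a, of "Suc j" a] Suc.prems assms by force
    qed
    moreover have "rot (Suc j) * y a = of_real (norm (y a)) * cis ?s"
      by (subst ya) (simp add: cis_mult add.commute)
    ultimately have "norm (y a) * sin ?s > 0" by (metis Im_polar)
    then have "sin ?s > 0" using nz by (simp add: zero_less_mult_iff)
    moreover have "?s < 2 * pi"
      using angle_small[OF Suc.prems] t pi_div_k by linarith
    moreover have "?s \<ge> 0" using t by simp
    ultimately show ?case using sin_le_zero[of ?s] by force
  qed
  from this[of h] have "t < pi / real k"
    using k by (simp add: field_simps)
  then show ?thesis using that[OF ya nz] t by simp
qed

text \<open>A beam fills an angle smaller than pi / k while successive beams are 2 pi / k apart, so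
  the angle between two cherries at most \<open>h\<close> steps apart is strictly between 0 and
  pi.\<close>

lemma cross_beams:
  assumes "1 \<le> j" "j \<le> h" "a < 4" "b < 4"
  shows "orient 0 (y a) (rot j * y b) > 0"
proof -
  obtain r t where a: "y a = of_real r * cis t" "0 < r" "0 \<le> t" "t < pi / real k"
    using sector[OF assms(3)] .
  obtain q s where b: "y b = of_real q * cis s" "0 < q" "0 \<le> s" "s < pi / real k"
    using sector[OF assms(4)] .
  have "orient 0 (y a) (rot j * y b) = r * q * sin (2 * pi * real j / real k + s - t)"
    unfolding a(1) b(1) orient_coords
    by (simp add: sin_diff sin_add cos_add cos_diff algebra_simps)
  moreover have "sin (2 * pi * real j / real k + s - t) > 0"
    using a b angle_small[OF assms(2)] angle_pos[of j] assms(1) by (intro sin_gt_zero) auto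
  ultimately show ?thesis using a b by simp
qed

text \<open>The point 1 lies in the cone spanned by \<open>y a\<close> and \<open>rot j\<close>, and
  beyond the segment joining them, since neither has norm above 1 and \<open>y a\<close> has norm
  below 1. The centre is to the left of the line; if \<open>rot j\<close> were to the right, 1 would
  be to the right as well, against the convexity of the beam.\<close>

lemma other_line:
  assumes "1 \<le> a" "a < b" "b < 4" "h < j" "j < k"
  shows "orient (y a) (y b) (rot j) \<ge> 0"
proof (rule ccontr)
  assume neg: "\<not> orient (y a) (y b) (rot j) \<ge> 0"
  have a: "a \<in> {1,2,3}" using assms by auto
  obtain r t where rt: "y a = of_real r * cis t" "0 < r" "0 \<le> t" "t < pi / real k"
    using sector[of a] assms by auto
  let ?u = "2 * pi * real j / real k"
  let ?D = "orient 0 (rot j) (y a)" and ?A = "orient 0 (rot j) 1" and ?B = "orient 0 1 (y a)"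
  have "?D = r * sin (t - (?u - 2 * pi))"
    unfolding rt(1) orient_coords by (simp add: sin_diff cos_diff right_diff_distrib mult_ac)
  moreover have "sin (t - (?u - 2 * pi)) > 0"
    using rt angle_large[OF assms(4)] angle_less[OF assms(5)] pi_div_k by (intro sin_gt_zero) auto
  ultimately have D: "?D > 0" using rt by simp
  have A: "?A > 0" using Im_rot_neg[OF assms(4,5)] by (simp add: orient_coords)
  have B: "?B > 0" using Im_pos[OF a] by (simp add: orient_coords)
  \<comment> \<open>By Cramer's rule, these are the coefficients of 1 with respect to
    \<open>y a\<close> and \<open>rot j\<close>.\<close>
  define \<alpha> \<beta> where "\<alpha> = ?A / ?D" and "\<beta> = ?B / ?D"
  have pos: "\<alpha> > 0" "\<beta> > 0" using A B D by (auto simp: \<alpha>_def \<beta>_def)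
  have eq: "of_real ?D = of_real ?A * y a + of_real ?B * rot j"
    by (simp add: complex_eq_iff orient_coords algebra_simps)
  have "1 = (of_real ?A * y a + of_real ?B * rot j) / of_real ?D"
    unfolding eq[symmetric] using D by simp
  then have one: "1 = of_real \<alpha> * y a + of_real \<beta> * rot j"
    by (simp add: \<alpha>_def \<beta>_def add_divide_distrib)
  then have "1 \<le> norm (of_real \<alpha> * y a) + norm (of_real \<beta> * rot j)"
    by (metis norm_one norm_triangle_ineq)
  also have "\<dots> = \<alpha> * norm (y a) + \<beta>" using pos by (simp add: norm_mult)
  also have "\<dots> < \<alpha> + \<beta>" using norm_less[OF a] pos by simp
  finally have sum: "1 < \<alpha> + \<beta>" .
  let ?c = "orient (y a) (y b) 0"
  have c: "?c > 0" using convex_centre assms by simp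
  have eq1: "Re 1 = \<alpha> * Re (y a) + \<beta> * Re (rot j)" "Im 1 = \<alpha> * Im (y a) + \<beta> * Im (rot j)"
    using arg_cong[OF one, of Re] arg_cong[OF one, of Im] by auto
  have "orient (y a) (y b) 1 = ?c * (1 - \<alpha> - \<beta>) + \<beta> * orient (y a) (y b) (rot j)"
    unfolding orient_coords eq1 by (simp add: algebra_simps)
  moreover have "?c * (1 - \<alpha> - \<beta>) < 0" using c sum by (simp add: mult_pos_neg)
  moreover have "\<beta> * orient (y a) (y b) (rot j) < 0" using pos neg by (simp add: mult_pos_neg)
  moreover have "orient (y a) (y b) 1 > 0"
    using convex[of 0 a b] assms y0 orient_rotate[of "y a" "y b" "y 0"] by simp
  ultimately show False by linarith
qed

lemma sides:
  assumes "a < b" "b < 4"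
  shows "\<And>j c. 1 \<le> j \<Longrightarrow> j \<le> h \<Longrightarrow> c < 4 \<Longrightarrow> orient (y a) (y b) (rot j * y c) < 0"
    and "\<And>j c. h < j \<Longrightarrow> j < k \<Longrightarrow> c < 4 \<Longrightarrow> orient (y a) (y b) (rot j * y c) > 0"
proof -
  have r: "orient (y a) (y b) (rot j) \<ge> 0" if "h < j" "j < k" for j
  proof (cases "a = 0")
    case True
    then show ?thesis using first_line(2)[of b j 0] assms that y0 by force
  next
    case False
    then show ?thesis using other_line[of a b j] assms that by simp
  qed
  show "\<And>j c. 1 \<le> j \<Longrightarrow> j \<le> h \<Longrightarrow> c < 4 \<Longrightarrow> orient (y a) (y b) (rot j * y c) < 0"
    and "\<And>j c. h < j \<Longrightarrow> j < k \<Longrightarrow> c < 4 \<Longrightarrow> orient (y a) (y b) (rot j * y c) > 0"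
    using right_left_sets[OF assms r] by auto
qed

section \<open>Distances from the centre along a beam\<close>

text \<open>Otherwise the step from \<open>y a\<close> to \<open>y b\<close> would turn
  anticlockwise about the centre without approaching it. Within the narrow sector of the beam, this
  is incompatible with 1 being to the left and \<open>rot h\<close> to the right of the
  line.\<close>

lemma norm_decreasing:
  assumes "a < b" "b < 4"
  shows "norm (y b) < norm (y a)"
proof (cases "a = 0")
  case True
  then show ?thesis using norm_less[of b] assms y0 by force
next
  case False
  show ?thesis
  proof (rule ccontr)
    assume "\<not> norm (y b) < norm (y a)"
    then have "(norm (y a))\<^sup>2 \<le> (norm (y b))\<^sup>2" by (intro power_mono) auto
    then have s: "(Re (y b))\<^sup>2 + (Im (y b))\<^sup>2 - (Re (y a))\<^sup>2 - (Im (y a))\<^sup>2 \<ge> 0"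
      by (simp add: cmod_power2)
    \<comment> \<open>Half the width of the sector: the chord from 1 to \<open>rot h\<close> has the
      direction - cis (- \<tau>).\<close>
    define \<tau> where "\<tau> = pi / (2 * real k)"
    have tau: "pi / real k = 2 * \<tau>" by (simp add: \<tau>_def)
    have tau': "0 < \<tau>" "6 * \<tau> \<le> pi" using pi_div_k tau by auto
    have st: "sin \<tau> > 0" "cos \<tau> > 0"
      using tau' by (auto intro!: sin_gt_zero cos_gt_zero)
    have quad: "Re (y c) > 0 \<and> Im (y c) > 0 \<and> Re (y c) * cos \<tau> - Im (y c) * sin \<tau> > 0"
      if "c \<in> {1,2,3}" for c
    proof -
      have c4: "c < 4" using that by auto
      obtain r t where rt: "y c = of_real r * cis t" "0 < r" "0 \<le> t" "t < pi / real k"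
        using sector[of c] c4 by blast
      have "cos t > 0" "cos (t + \<tau>) > 0"
        using rt tau tau' by (auto intro!: cos_gt_zero_pi)
      moreover have "Re (y c) * cos \<tau> - Im (y c) * sin \<tau> = r * cos (t + \<tau>)"
        by (simp add: rt(1) cos_add algebra_simps)
      ultimately show ?thesis using rt Im_pos[OF that] by simp
    qed
    have ab: "a \<in> {1,2,3}" "b \<in> {1,2,3}" using assms False by auto
    \<comment> \<open>The vector (\<open>?p\<close>, \<open>?q\<close>) is \<open>y a + y b\<close>.
      Its scalar product with the step (\<open>?U\<close>, \<open>?V\<close>) is the difference of
      the squared norms, and its cross product with it is twice that of \<open>y a\<close> and
      \<open>y b\<close>. The identity used at the end decomposes the step along (\<open>?p\<close>,
      \<open>?q\<close>) and its perpendicular.\<close>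
    let ?p = "Re (y a) + Re (y b)" and ?q = "Im (y a) + Im (y b)"
    let ?U = "Re (y b) - Re (y a)" and ?V = "Im (y b) - Im (y a)"
    have pos: "?p > 0" "?q > 0" "?p * cos \<tau> - ?q * sin \<tau> > 0"
      using quad[OF ab(1)] quad[OF ab(2)] by (auto simp: algebra_simps)
    have "2 * pi * real h / real k = pi - 2 * \<tau>"
      using k by (simp add: \<tau>_def field_simps)
    then have "rot h = cis (pi - 2 * \<tau>)" by simp
    then have roth: "Re (rot h) - 1 = - 2 * cos \<tau> * cos \<tau>" "Im (rot h) = 2 * cos \<tau> * sin \<tau>"
      by (simp_all add: cos_double_cos sin_double power2_eq_square cos_diff sin_diff)
    have "orient (y a) (y b) (rot h) < 0"
      using sides(1)[OF assms, of h 0] h y0 by simp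
    moreover have "orient (y a) (y b) 1 > 0"
      using convex[of 0 a b] assms False y0 orient_rotate[of "y a" "y b" "y 0"] by simp
    moreover have "orient (y a) (y b) (rot h) - orient (y a) (y b) 1 =
        ?U * Im (rot h) - ?V * (Re (rot h) - 1)"
      by (simp add: orient_coords algebra_simps)
    ultimately have "2 * cos \<tau> * (?U * sin \<tau> + ?V * cos \<tau>) < 0"
      unfolding roth by (simp add: algebra_simps)
    then have neg: "?U * sin \<tau> + ?V * cos \<tau> < 0"
      using st by (simp add: mult_less_0_iff)
    have t: "Re (y a) * Im (y b) - Im (y a) * Re (y b) > 0"
      using convex_centre[OF assms] by (simp add: orient_coords algebra_simps)
    have "(?p\<^sup>2 + ?q\<^sup>2) * (?U * sin \<tau> + ?V * cos \<tau>) =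
      ((Re (y b))\<^sup>2 + (Im (y b))\<^sup>2 - (Re (y a))\<^sup>2 - (Im (y a))\<^sup>2) * (?p * sin \<tau> + ?q * cos \<tau>) +
      2 * (Re (y a) * Im (y b) - Im (y a) * Re (y b)) * (?p * cos \<tau> - ?q * sin \<tau>)"
      by (simp add: algebra_simps power2_eq_square)
    moreover have "((Re (y b))\<^sup>2 + (Im (y b))\<^sup>2 - (Re (y a))\<^sup>2 - (Im (y a))\<^sup>2) *
        (?p * sin \<tau> + ?q * cos \<tau>) \<ge> 0"
      by (rule mult_nonneg_nonneg[OF s]) (use pos st in simp)
    moreover have "2 * (Re (y a) * Im (y b) - Im (y a) * Re (y b)) * (?p * cos \<tau> - ?q * sin \<tau>) > 0"
      by (rule mult_pos_pos[OF _ pos(3)]) (use t in simp)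
    moreover have "(?p\<^sup>2 + ?q\<^sup>2) * (?U * sin \<tau> + ?V * cos \<tau>) \<le> 0"
      by (rule mult_nonneg_nonpos) (use neg in simp_all)
    ultimately show False by linarith
  qed
qed

end

section \<open>The game on abstract beams\<close>

text \<open>\<open>B i j\<close> says that beam \<open>j\<close> lies on the outer side of the lines through beam \<open>i\<close>.\<close>

locale beam_tournament =
  fixes k h :: nat and B :: "nat \<Rightarrow> nat \<Rightarrow> bool"
  assumes k: "k = 2 * h + 1" and h: "h \<ge> 1"
    and tournament: "\<And>i j. i < k \<Longrightarrow> j < k \<Longrightarrow> i \<noteq> j \<Longrightarrow> B i j \<longleftrightarrow> \<not> B j i"
    and irrefl: "\<And>i. \<not> B i i"
    and card_B: "\<And>i. i < k \<Longrightarrow> card {j. j < k \<and> B i j} = h"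
    and half_turn: "\<And>l J. l < k \<Longrightarrow> J \<subseteq> {..<k} \<Longrightarrow> J \<noteq> {} \<Longrightarrow> \<forall>j\<in>J. \<not> B l j \<Longrightarrow>
      (\<exists>l\<in>J. \<forall>j\<in>J. \<not> B l j) \<and> (\<exists>r\<in>J. \<forall>j\<in>J. \<not> B j r)"
begin

text \<open>In a position \<open>N, z\<close>, the set \<open>N i\<close> contains the indices of the remaining cherries of beam \<open>i\<close>,
  and \<open>z\<close> tells whether the centre remains.\<close>

definition active :: "(nat \<Rightarrow> nat set) \<Rightarrow> nat set" where
  "active N = {i. i < k \<and> N i \<noteq> {}}"

definition first :: "(nat \<Rightarrow> nat set) \<Rightarrow> nat \<Rightarrow> bool" where
  "first N i \<longleftrightarrow> i \<in> active N \<and> (\<forall>j\<in>active N. \<not> B i j)"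

definition last :: "(nat \<Rightarrow> nat set) \<Rightarrow> nat \<Rightarrow> bool" where
  "last N i \<longleftrightarrow> i \<in> active N \<and> (\<forall>j\<in>active N. \<not> B j i)"

definition exposed :: "(nat \<Rightarrow> nat set) \<Rightarrow> bool \<Rightarrow> nat \<Rightarrow> nat \<Rightarrow> bool" where
  "exposed N z i a \<longleftrightarrow> i < k \<and> a \<in> N i \<and>
     ((\<forall>b\<in>N i. a \<le> b) \<or> first N i \<or> last N i \<and> \<not> z \<and> (\<forall>b\<in>N i. b \<le> a))"

abbreviation reds :: "nat set" where "reds \<equiv> {1, 3}"

definition doubles :: "(nat \<Rightarrow> nat set) \<Rightarrow> nat" where
  "doubles N = card {i. i < k \<and> reds \<subseteq> N i}"

definition remove :: "(nat \<Rightarrow> nat set) \<Rightarrow> nat \<Rightarrow> nat \<Rightarrow> nat \<Rightarrow> nat set" where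
  "remove N i a = N(i := N i - {a})"

definition hides :: "(nat \<Rightarrow> nat set) \<Rightarrow> bool \<Rightarrow> nat \<Rightarrow> bool" where
  "hides N z i \<longleftrightarrow> (\<exists>a\<in>reds. exposed N z i a) \<and> (\<exists>a\<in>reds. a \<in> N i \<and> \<not> exposed N z i a)"

definition lone_red :: "(nat \<Rightarrow> nat set) \<Rightarrow> bool \<Rightarrow> nat \<Rightarrow> nat \<Rightarrow> bool" where
  "lone_red N z i a \<longleftrightarrow> exposed N z i a \<and> N i \<inter> reds = {a}"

text \<open>An upper bound for Alice's options. Of the extremality of the centre it retains only one
  consequence: if any beam is left, then one of them has nothing on its outer side.\<close>

definition alice_move :: "(nat \<Rightarrow> nat set) \<Rightarrow> bool \<Rightarrow> (nat \<Rightarrow> nat set) \<Rightarrow> bool \<Rightarrow> bool" where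
  "alice_move N z N' z' \<longleftrightarrow>
     (\<exists>i a. exposed N z i a \<and> N' = remove N i a \<and> z' = z) \<or>
     z \<and> \<not> z' \<and> N' = N \<and> (active N = {} \<or> (\<exists>l. first N l))"

text \<open>Looser than careful greedy play. Where nothing is hidden, a beam with an exposed red
  shows all its reds, so a single extremal red is a \<open>lone_red\<close>. A green from a redless
  beam is allowed whenever there is neither a hidden red behind an exposed one nor a lone
  red.\<close>

definition bob_move :: "(nat \<Rightarrow> nat set) \<Rightarrow> bool \<Rightarrow> nat \<Rightarrow> nat \<Rightarrow> bool" where
  "bob_move N z i a \<longleftrightarrow> exposed N z i a \<and>
     (if \<exists>j. hides N z j then hides N z i \<and> a \<in> reds
      else lone_red N z i a \<or>
        (\<nexists>j b. lone_red N z j b) \<and> (a \<in> reds \<or> N i \<inter> reds = {}))"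

section \<open>Elementary facts about positions\<close>

lemma lone_redD: "lone_red N z i a \<Longrightarrow> a \<in> reds \<and> a \<in> N i \<and> \<not> reds \<subseteq> N i"
proof -
  assume "lone_red N z i a"
  then have eq: "N i \<inter> reds = {a}" by (simp add: lone_red_def)
  have "1 = a \<and> 3 = a" if "reds \<subseteq> N i" using that eq by blast
  then show ?thesis using eq by fastforce
qed

lemma finite_active: "finite (active N)"
  by (simp add: active_def)

lemma first_unique: "first N i \<Longrightarrow> first N j \<Longrightarrow> i = j"
  using tournament[of i j] by (auto simp: first_def active_def)

lemma last_unique: "last N i \<Longrightarrow> last N j \<Longrightarrow> i = j"
  using tournament[of i j] by (auto simp: last_def active_def)

lemma first_last_only: "first N l \<Longrightarrow> last N l \<Longrightarrow> active N = {l}"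
  using tournament[of l] by (auto simp: first_def last_def active_def)

lemma first_subset: "first N l \<Longrightarrow> active N' \<subseteq> active N \<Longrightarrow> l \<in> active N' \<Longrightarrow> first N' l"
  by (auto simp: first_def)

lemma last_subset: "last N l \<Longrightarrow> active N' \<subseteq> active N \<Longrightarrow> l \<in> active N' \<Longrightarrow> last N' l"
  by (auto simp: last_def)

lemma first_last_exist:
  assumes "first N l" "active N' \<subseteq> active N" "active N' \<noteq> {}"
  obtains l' r' where "first N' l'" "last N' r'"
proof -
  have "\<forall>j\<in>active N'. \<not> B l j" "l < k" "active N' \<subseteq> {..<k}"
    using assms by (auto simp: first_def active_def)
  then show ?thesis
    using half_turn[of l "active N'"] assms(3) that by (auto simp: first_def last_def)
qed

lemma first_nonempty: "first N l \<Longrightarrow> active N \<noteq> {}"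
  by (auto simp: first_def)

lemma remove_simps [simp]: "remove N i a i = N i - {a}" "j \<noteq> i \<Longrightarrow> remove N i a j = N j"
  by (auto simp: remove_def)

lemma active_remove_subset: "active (remove N i a) \<subseteq> active N"
  by (auto simp: active_def remove_def)

lemma active_remove: "N i - {a} \<noteq> {} \<Longrightarrow> active (remove N i a) = active N"
  by (auto simp: active_def remove_def)

lemma active_remove_last: "N i - {a} = {} \<Longrightarrow> active (remove N i a) = active N - {i}"
  by (auto simp: active_def remove_def)

lemma first_remove: "N i - {a} \<noteq> {} \<Longrightarrow> first (remove N i a) j \<longleftrightarrow> first N j"
  and last_remove: "N i - {a} \<noteq> {} \<Longrightarrow> last (remove N i a) j \<longleftrightarrow> last N j"
  by (auto simp: first_def last_def active_remove)

lemma doubles_remove: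
  assumes "i < k" "a \<in> N i"
  shows "doubles (remove N i a) + of_bool (reds \<subseteq> N i \<and> a \<in> reds) = doubles N"
proof (cases "reds \<subseteq> N i \<and> a \<in> reds")
  case True
  then have "{j. j < k \<and> reds \<subseteq> remove N i a j} = {j. j < k \<and> reds \<subseteq> N j} - {i}"
    by (auto simp: remove_def)
  moreover have "card {j. j < k \<and> reds \<subseteq> N j} > 0"
    using True assms by (auto simp: card_gt_0_iff)
  ultimately show ?thesis using True assms by (simp add: doubles_def)
next
  case False
  then have "{j. j < k \<and> reds \<subseteq> remove N i a j} = {j. j < k \<and> reds \<subseteq> N j}"
    by (auto simp: remove_def)
  then show ?thesis using False by (auto simp: doubles_def)
qed

lemma exposed_active: "exposed N z i a \<Longrightarrow> i \<in> active N" "exposed N z i a \<Longrightarrow> i < k"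
  "exposed N z i a \<Longrightarrow> a \<in> N i"
  by (auto simp: exposed_def active_def)

lemma exposed_first: "first N l \<Longrightarrow> exposed N z l a \<longleftrightarrow> a \<in> N l"
  by (auto simp: exposed_def first_def active_def)

lemma exposed_min:
  "z \<or> \<not> last N i \<Longrightarrow> \<not> first N i \<Longrightarrow> exposed N z i a \<longleftrightarrow> i < k \<and> a \<in> N i \<and> (\<forall>b\<in>N i. a \<le> b)"
  by (auto simp: exposed_def)

lemma exposed_last:
  "last N i \<Longrightarrow> \<not> first N i \<Longrightarrow>
    exposed N False i a \<longleftrightarrow> a \<in> N i \<and> ((\<forall>b\<in>N i. a \<le> b) \<or> (\<forall>b\<in>N i. b \<le> a))"
  by (auto simp: exposed_def last_def active_def)

lemma not_hides_first: "first N l \<Longrightarrow> \<not> hides N z l"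
  by (auto simp: hides_def exposed_first)

text \<open>In the invariants, \<open>b\<close> is Bob's score so far. If Alice has taken \<open>A\<close> first reds of a beam, then
  Bob has taken \<open>k - doubles N - A\<close> of them, so \<open>b + doubles N - k\<close> is the number of second reds
  taken by Bob minus \<open>A\<close>.\<close>

definition fresh :: "nat set set" where "fresh = {{}, {2, 3}, {0, 1, 2, 3}}"

text \<open>In this phase each exhausted beam has given its second red to Bob and Alice has taken no
  red, which is why the empty beams bound the balance. When a beam becomes first, the
  \<open>h\<close> beams on its outer side are empty, and the bound has reached
  \<open>k + h\<close>.\<close>

definition start :: "(nat \<Rightarrow> nat set) \<Rightarrow> bool \<Rightarrow> nat \<Rightarrow> bool" where
  "start N z b \<longleftrightarrow> z \<and> active N \<noteq> {} \<and> (\<nexists>l. first N l) \<and> (\<forall>i<k. N i \<in> fresh) \<and>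
     b + doubles N \<ge> k + card {i. i < k \<and> N i = {}}"

lemma fresh_Min_green: "M \<in> fresh \<Longrightarrow> a \<in> M \<Longrightarrow> \<forall>b\<in>M. a \<le> b \<Longrightarrow> a \<notin> reds"
  by (auto simp: fresh_def)

lemma fresh_has_red: "M \<in> fresh \<Longrightarrow> a \<in> M \<Longrightarrow> M \<inter> reds \<noteq> {}"
  by (auto simp: fresh_def)

definition start_bob :: "(nat \<Rightarrow> nat set) \<Rightarrow> bool \<Rightarrow> nat \<Rightarrow> bool" where
  "start_bob N z b \<longleftrightarrow> z \<and> (\<nexists>l. first N l) \<and>
     (\<exists>i<k. N i \<in> {{3}, {1, 2, 3}} \<and> (\<forall>j<k. j \<noteq> i \<longrightarrow> N j \<in> fresh)) \<and>
     b + doubles N \<ge> k + card {i. i < k \<and> N i = {}}"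

text \<open>The sets in which the outermost cherry is green or the only one. A beam that shows just
  its outermost cherry then hides no red behind an exposed red.\<close>

definition tails :: "nat set set" where "tails = {{3}, {2, 3}, {0, 1, 2, 3}}"

definition middle :: "(nat \<Rightarrow> nat set) \<Rightarrow> bool \<Rightarrow> nat \<Rightarrow> bool" where
  "middle N z b \<longleftrightarrow> z \<and> (\<exists>l. first N l \<and> (\<forall>i\<in>active N - {l}. N i \<in> tails)) \<and>
     b + doubles N \<ge> k + h"

text \<open>At worst Alice has broken a double in the first beam, where the remaining red repays Bob
  at once, or she has uncovered a red with another one hidden behind it, to which Bob must
  reply.\<close>

definition middle_bob :: "(nat \<Rightarrow> nat set) \<Rightarrow> bool \<Rightarrow> nat \<Rightarrow> bool" where
  "middle_bob N z b \<longleftrightarrow> z \<and> (\<exists>l. first N l \<and>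
     ((\<forall>i\<in>active N - {l}. N i \<in> tails) \<and>
        b + doubles N + of_bool (\<exists>i a. lone_red N z i a) \<ge> k + h \<or>
      (\<exists>i\<in>active N - {l}. N i = {1, 2, 3} \<and> (\<forall>j\<in>active N - {l, i}. N j \<in> tails)) \<and>
        b + doubles N \<ge> k + h))"

definition finished :: "(nat \<Rightarrow> nat set) \<Rightarrow> nat \<Rightarrow> bool" where
  "finished N b \<longleftrightarrow> active N = {} \<and> b + doubles N \<ge> k + h"

definition whole :: "nat set" where "whole = {0, 1, 2, 3}"
definition front :: "nat set" where "front = {0, 1, 2}"
definition rear :: "nat set" where "rear = {1, 2, 3}"

text \<open>The non-empty intervals of {0, 1, 2, 3}: once the centre is gone, the last beam loses
  cherries only at its two ends.\<close>

definition segments :: "nat set set" where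
  "segments = insert rear (insert front (tails \<union> {{0}, {1}, {2}, {0, 1}, {1, 2}}))"

definition endpoint :: "nat set \<Rightarrow> nat \<Rightarrow> bool" where
  "endpoint M a \<longleftrightarrow> a \<in> M \<and> ((\<forall>b\<in>M. a \<le> b) \<or> (\<forall>b\<in>M. b \<le> a))"

definition ordered :: "(nat \<Rightarrow> nat set) \<Rightarrow> nat \<Rightarrow> nat \<Rightarrow> bool" where
  "ordered N l r \<longleftrightarrow> first N l \<and> last N r \<and> l \<noteq> r \<and>
     (\<forall>i\<in>active N - {l, r}. N i \<in> insert rear tails) \<and> N r \<in> segments"

definition opened :: "(nat \<Rightarrow> nat set) \<Rightarrow> nat \<Rightarrow> nat \<Rightarrow> nat set" where
  "opened N l r = {i \<in> active N - {l, r}. N i = rear}"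

text \<open>Once the centre is gone, a full last beam shows its innermost red and hides the other one, so
  Alice can take a first red there and leave nothing for Bob. This costs one, hence the reserve of one
  that is needed unless the last beam has been reduced to \<open>front\<close>. An opened beam, whose second red is
  hidden behind the first, costs one more.\<close>

definition ending :: "(nat \<Rightarrow> nat set) \<Rightarrow> bool \<Rightarrow> nat \<Rightarrow> bool" where
  "ending N z b \<longleftrightarrow> \<not> z \<and>
     ((\<exists>l. first N l \<and> last N l \<and> b + doubles N \<ge> k + h) \<or>
      (\<exists>l r. ordered N l r \<and> card (opened N l r) + of_bool (N r = whole) \<le> 1 \<and>
         b + doubles N + of_bool (N r = front) \<ge> k + h + 1 + card (opened N l r)))"

text \<open>One move of Alice creates at most one more hiding beam, hence the bound 2. If there is a
  hiding beam, Bob has to reply in one, and this restores the reserve: an opened beam disappears, or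
  a full last beam becomes \<open>front\<close>. Otherwise the reserve must be present already or be
  refilled by a lone red.\<close>

definition ending_bob :: "(nat \<Rightarrow> nat set) \<Rightarrow> bool \<Rightarrow> nat \<Rightarrow> bool" where
  "ending_bob N z b \<longleftrightarrow> \<not> z \<and>
     ((\<exists>l. first N l \<and> last N l \<and> b + doubles N + of_bool (\<exists>i a. lone_red N z i a) \<ge> k + h) \<or>
      (\<exists>l r. ordered N l r \<and> card (opened N l r) + of_bool (N r = whole) \<le> 2 \<and>
         (if opened N l r \<noteq> {} \<or> N r = whole
          then b + doubles N + of_bool (N r = front) \<ge> k + h + card (opened N l r)
          else b + doubles N + of_bool (\<exists>i a. lone_red N z i a) + of_bool (N r = front) \<ge> k + h + 1)))"

definition good_alice :: "(nat \<Rightarrow> nat set) \<Rightarrow> bool \<Rightarrow> nat \<Rightarrow> bool" where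
  "good_alice N z b \<longleftrightarrow> start N z b \<or> middle N z b \<or> ending N z b \<or> finished N b"

definition good_bob :: "(nat \<Rightarrow> nat set) \<Rightarrow> bool \<Rightarrow> nat \<Rightarrow> bool" where
  "good_bob N z b \<longleftrightarrow> start_bob N z b \<or> middle_bob N z b \<or> ending_bob N z b \<or> finished N b"

section \<open>Play while no beam is first\<close>

text \<open>Only outermost cherries are exposed, and in a fresh beam these are green.\<close>

lemma alice_start:
  assumes "start N z b" "alice_move N z N' z'"
  shows "start_bob N' z' b"
proof -
  have z: "z" and nf: "\<And>l. \<not> first N l" and ne: "active N \<noteq> {}"
    and fr: "\<And>i. i < k \<Longrightarrow> N i \<in> fresh"
    and v: "b + doubles N \<ge> k + card {i. i < k \<and> N i = {}}"
    using assms(1) by (auto simp: start_def)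
  obtain i a where ia: "exposed N z i a" "N' = remove N i a" "z' = z"
    using assms(2) nf ne by (auto simp: alice_move_def)
  have i: "i < k" "a \<in> N i" using ia exposed_active by blast+
  have min: "\<forall>b\<in>N i. a \<le> b" using exposed_min[of z N i a] ia(1) z nf by blast
  have "N i = {2, 3} \<and> a = 2 \<or> N i = {0, 1, 2, 3} \<and> a = 0"
    using fr[OF i(1)] i(2) min by (auto simp: fresh_def)
  then have "N i - {a} \<in> {{3}, {1, 2, 3}} \<and> a \<notin> reds"
    by (elim disjE conjE) (simp_all add: insert_Diff_if)
  then have N'i: "N' i \<in> {{3}, {1, 2, 3}}" and rem: "N i - {a} \<noteq> {}" and g: "a \<notin> reds"
    by (auto simp add: ia(2) simp del: insert_iff)
  have "{j. j < k \<and> N' j = {}} = {j. j < k \<and> N j = {}}"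
    using rem i(2) unfolding ia(2) by (auto simp: remove_def)
  moreover have "doubles N' = doubles N"
    using doubles_remove[where N = N, OF i] g unfolding ia(2) by simp
  moreover have "\<forall>j<k. j \<noteq> i \<longrightarrow> N' j \<in> fresh" using fr unfolding ia(2) by simp
  moreover have "\<nexists>l. first N' l" using nf first_remove[of N i a, OF rem] ia(2) by blast
  ultimately show ?thesis
    unfolding start_bob_def using z ia(3) N'i i(1) v by (intro conjI exI[of _ i]) simp_all
qed

text \<open>The beam just touched by Alice is the only one with an exposed red, and no active beam
  is redless, so Bob's reply is forced.\<close>

lemma bob_start:
  assumes "start_bob N z b" "bob_move N z i a"
  shows "good_alice (remove N i a) z (b + of_bool (a \<in> reds))"
proof -
  have z: "z" and nf: "\<And>l. \<not> first N l"
    and v: "b + doubles N \<ge> k + card {i. i < k \<and> N i = {}}"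
    using assms(1) by (auto simp: start_bob_def)
  obtain j where j: "j < k" "N j \<in> {{3}, {1, 2, 3}}" "\<And>i. i < k \<Longrightarrow> i \<noteq> j \<Longrightarrow> N i \<in> fresh"
    using assms(1) by (auto simp: start_bob_def)
  have ex: "exposed N z i a \<longleftrightarrow> i < k \<and> a \<in> N i \<and> (\<forall>b\<in>N i. a \<le> b)" for i a
    using exposed_min[of z N i a] z nf by blast
  have red: "i = j" if "exposed N z i a" "a \<in> reds" for i a
    using that j(3)[of i] fresh_Min_green[of "N i" a] ex[of i a] by blast
  have nred: "N i \<inter> reds \<noteq> {}" if "i < k" "a \<in> N i" for i a
    using that j(2) j(3)[of i] fresh_has_red[of "N i" a] by (cases "i = j") auto
  have ia: "exposed N z i a" using assms(2) by (simp add: bob_move_def)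
  then have i: "i < k" "a \<in> N i" using exposed_active by blast+
  have "a \<in> reds"
    using assms(2) nred[OF i] by (auto simp: bob_move_def lone_red_def split: if_splits)
  then have ij: "i = j" using red ia by blast
  let ?N = "remove N i a"
  consider "N i = {3}" "a = 3" | "N i = {1, 2, 3}" "a = 1"
    using j(2) ij ia \<open>a \<in> reds\<close> by (auto simp: ex)
  then show ?thesis
  proof cases
    case 1
    \<comment> \<open>The beam is now exhausted: Bob's extra point matches the extra empty
      beam.\<close>
    have d: "doubles ?N = doubles N" using doubles_remove[where N = N, OF i] 1 by simp
    have emp: "{j. j < k \<and> ?N j = {}} = insert i {j. j < k \<and> N j = {}}"
      using 1 i by (auto simp: remove_def)
    have v': "b + 1 + doubles ?N \<ge> k + card {j. j < k \<and> ?N j = {}}"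
      unfolding emp d using v 1 by (subst card_insert_disjoint) auto
    have fr: "?N l \<in> fresh" if "l < k" for l
      using j(3)[OF that] ij 1 by (cases "l = i") (auto simp: fresh_def)
    consider "active ?N = {}" | "active ?N \<noteq> {}" "\<nexists>l. first ?N l" | l where "first ?N l" by blast
    then show ?thesis
    proof cases
      case A: 1
      then have "{j. j < k \<and> ?N j = {}} = {..<k}" by (auto simp: active_def)
      then have "b + 1 + doubles ?N \<ge> k + k" using v' by simp
      then have "finished ?N (b + 1)" unfolding finished_def using A k by linarith
      then show ?thesis using 1 by (simp add: good_alice_def)
    next
      case 2
      then have "start ?N z (b + 1)" using fr v' z by (simp add: start_def)
      then show ?thesis using 1 by (simp add: good_alice_def)
    next
      case 3
      \<comment> \<open>All \<open>h\<close> beams on the outer side of the new first beam are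
        empty.\<close>
      have "{j. j < k \<and> B l j} \<subseteq> {j. j < k \<and> ?N j = {}}"
        using 3 by (auto simp: first_def active_def)
      then have "h \<le> card {j. j < k \<and> ?N j = {}}"
        using card_mono[of "{j. j < k \<and> ?N j = {}}"] card_B[of l] 3
        by (fastforce simp: first_def active_def)
      moreover have "\<forall>i\<in>active ?N - {l}. ?N i \<in> tails"
      proof
        fix j assume "j \<in> active ?N - {l}"
        then have "?N j \<in> fresh" "?N j \<noteq> {}" using fr by (auto simp: active_def)
        then show "?N j \<in> tails" unfolding fresh_def tails_def by blast
      qed
      ultimately have "middle ?N z (b + 1)" using v' 3 z by (auto simp: middle_def)
      then show ?thesis using 1 by (simp add: good_alice_def)
    qed
  next
    case 2
    have rem: "N i - {a} \<noteq> {}" using 2 by auto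
    have d: "b + 1 + doubles ?N = b + doubles N" using doubles_remove[where N = N, OF i] 2 by simp
    have emp: "{j. j < k \<and> ?N j = {}} = {j. j < k \<and> N j = {}}"
      using 2 by (auto simp: remove_def)
    have fr: "?N l \<in> fresh" if "l < k" for l
      using j(3)[OF that] ij 2 by (cases "l = i") (auto simp: fresh_def)
    have "start ?N z (b + 1)"
      unfolding start_def emp d
      using fr v z nf first_remove[of N i a, OF rem] active_remove[of N i a, OF rem] i
      by (auto simp: active_def)
    then show ?thesis using 2 by (simp add: good_alice_def)
  qed
qed

section \<open>Play with the centre and a first beam\<close>

lemma tails_Min_cases:
  assumes "M \<in> tails" "a \<in> M" "\<forall>b\<in>M. a \<le> b"
  shows "M = {3} \<and> a = 3 \<or> M = {2, 3} \<and> a = 2 \<or> M = {0, 1, 2, 3} \<and> a = 0"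
proof -
  consider "M = {3}" | "M = {2, 3}" | "M = {0, 1, 2, 3}" using assms(1) unfolding tails_def by blast
  then show ?thesis
  proof cases
    case 2
    then have "a = 2" using assms(2,3) by force
    then show ?thesis using 2 by blast
  next
    case 3
    then have "a = 0" using assms(3) by simp
    then show ?thesis using 3 by blast
  qed (use assms in simp)
qed

lemma tails_members: "{3} \<in> tails" "{2, 3} \<in> tails"
  by (simp_all add: tails_def)

lemma not_in_tails: "{1, 2, 3} \<notin> tails" "{0, 1, 2} \<notin> tails"
proof -
  have t: "\<forall>M\<in>tails. 3 \<in> M \<and> (1 \<in> M \<longrightarrow> 0 \<in> M)" by (simp add: tails_def)
  show "{1, 2, 3} \<notin> tails"
  proof
    assume "{1, 2, 3} \<in> tails"
    from t[rule_format, OF this] show False by simp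
  qed
  show "{0, 1, 2} \<notin> tails"
  proof
    assume "{0, 1, 2} \<in> tails"
    from t[rule_format, OF this] show False by simp
  qed
qed

lemma insert_rear_tails_subset: "insert rear tails \<subseteq> segments"
  unfolding segments_def by blast

lemma first_survives:
  assumes "first N l" "i \<noteq> l"
  shows "first (remove N i a) l"
proof (rule first_subset[OF assms(1) active_remove_subset])
  show "l \<in> active (remove N i a)" using assms by (simp add: first_def active_def)
qed

lemma last_survives:
  assumes "last N r" "i \<noteq> r"
  shows "last (remove N i a) r"
proof (rule last_subset[OF assms(1) active_remove_subset])
  show "r \<in> active (remove N i a)" using assms by (simp add: last_def active_def)
qed

text \<open>This is the immediate compensation for a double broken in the first beam: the beam is
  completely exposed, so its other red is available to Bob.\<close>

lemma lone_red_after_double: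
  assumes "first N l" "a \<in> N l" "a \<in> reds" "reds \<subseteq> N l"
  shows "\<exists>i b. lone_red (remove N l a) z i b"
proof -
  obtain b where b: "b \<in> reds" "b \<noteq> a" "\<forall>c\<in>reds. c = a \<or> c = b"
    using assms(3) by (cases "a = 1") simp_all
  then have bN: "b \<in> N l - {a}" using assms(4) by blast
  then have rem: "N l - {a} \<noteq> {}" by blast
  have "first (remove N l a) l" using first_remove[of N l a, OF rem] assms(1) by blast
  then have "exposed (remove N l a) z l b" using bN by (simp add: exposed_first)
  moreover have "remove N l a l \<inter> reds = {b}" using b bN by (simp only: remove_simps) blast
  ultimately show ?thesis unfolding lone_red_def by blast
qed

lemma alice_middle:
  assumes "middle N z b" "alice_move N z N' z'"
  shows "good_bob N' z' b"
proof -
  obtain l where z: "z" and l: "first N l" and t: "\<And>i. i \<in> active N - {l} \<Longrightarrow> N i \<in> tails"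
    and v: "b + doubles N \<ge> k + h"
    using assms(1) by (auto simp: middle_def)
  consider (beam) i a where "exposed N z i a" "N' = remove N i a" "z' = z" | (centre) "\<not> z'" "N' = N"
    using assms(2) by (auto simp: alice_move_def)
  then show ?thesis
  proof cases
    case (beam i a)
    have i: "i < k" "a \<in> N i" "i \<in> active N" using beam exposed_active by blast+
    have d: "doubles N' + of_bool (reds \<subseteq> N i \<and> a \<in> reds) = doubles N"
      using doubles_remove[where N = N, OF i(1,2)] beam(2) by simp
    show ?thesis
    proof (cases "i = l")
      case True
      show ?thesis
      proof (cases "N l - {a} = {}")
        case False
        then have act: "active N' = active N" "first N' l"
          using True beam(2) active_remove first_remove l by auto
        have "\<forall>j\<in>active N' - {l}. N' j \<in> tails" using act t True beam(2) by auto
        moreover have "b + doubles N' + of_bool (\<exists>i a. lone_red N' z' i a) \<ge> k + h"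
        proof (cases "reds \<subseteq> N i \<and> a \<in> reds")
          case True
          then have "\<exists>i a. lone_red N' z' i a"
            using lone_red_after_double[of N l a z'] l \<open>i = l\<close> i(2) beam(2) by simp
          then show ?thesis using d v True by simp
        next
          case False
          then show ?thesis using d v by auto
        qed
        ultimately have "middle_bob N' z' b" using z beam act unfolding middle_bob_def by blast
        then show ?thesis by (simp add: good_bob_def)
      next
        case emp: True
        then have nd: "\<not> (reds \<subseteq> N i \<and> a \<in> reds)" using True by auto
        have act: "active N' = active N - {l}"
          using emp True beam(2) active_remove_last[of N l a] by simp
        have d': "doubles N' = doubles N" using d nd by auto
        show ?thesis
        proof (cases "active N' = {}")
          case True
          then have "finished N' b" using d' v by (simp add: finished_def)
          then show ?thesis by (simp add: good_bob_def)
        next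
          case False
          obtain l' r' where "first N' l'" "last N' r'"
            using first_last_exist[OF l, of N'] act False by auto
          moreover have "\<forall>j\<in>active N' - {l'}. N' j \<in> tails"
            using act t True beam(2) by auto
          ultimately have "middle_bob N' z' b" using z beam d' v unfolding middle_bob_def by auto
          then show ?thesis by (simp add: good_bob_def)
        qed
      qed
    next
      case False
      then have nf: "\<not> first N i" using l first_unique by blast
      have min: "\<forall>b\<in>N i. a \<le> b" using exposed_min[of z N i a] beam(1) z nf by blast
      have l': "first N' l" using first_survives[OF l False] beam(2) by simp
      have others: "N' j \<in> tails" if "j \<in> active N' - {l, i}" for j
        using that t[of j] active_remove_subset[of N i a] beam(2) by auto
      have d': "doubles N' = doubles N"
        using tails_Min_cases[OF t i(2) min] i(3) False d by auto
      consider "N i = {3}" "a = 3" | "N i = {2, 3}" "a = 2" | "N i = {0, 1, 2, 3}" "a = 0"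
        using tails_Min_cases[OF t i(2) min] i(3) False by blast
      then have "middle_bob N' z' b"
      proof cases
        case 1
        then have "i \<notin> active N'" using beam(2) by (simp add: active_def)
        then have "\<forall>j\<in>active N' - {l}. N' j \<in> tails" using others by blast
        then show ?thesis using z beam(3) l' d' v unfolding middle_bob_def by auto
      next
        case 2
        then have "N' i \<in> tails" using beam(2) by (auto simp: tails_def)
        then have "\<forall>j\<in>active N' - {l}. N' j \<in> tails" using others by blast
        then show ?thesis using z beam(3) l' d' v unfolding middle_bob_def by auto
      next
        \<comment> \<open>Only this move of Alice uncovers a red with another red hidden behind
          it.\<close>
        case 3
        then have "N' i = {1, 2, 3}" "i \<in> active N' - {l}"
          using beam(2) i(1) False by (auto simp: active_def)
        then show ?thesis using z beam(3) l' d' v others unfolding middle_bob_def by auto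
      qed
      then show ?thesis by (simp add: good_bob_def)
    qed
  next
    case centre
    obtain r where r: "last N r"
      using first_last_exist[OF l order_refl] first_nonempty[OF l] by metis
    have "ending_bob N False b"
    proof (cases "l = r")
      case True
      then show ?thesis using l r v unfolding ending_bob_def by auto
    next
      case False
      have rt: "N r \<in> tails" using t[of r] r False by (auto simp: last_def)
      have ord: "ordered N l r"
        using l r False t rt insert_rear_tails_subset unfolding ordered_def by blast
      have op: "opened N l r = {}"
        using t not_in_tails(1) unfolding opened_def rear_def[symmetric] by fastforce
      have nf: "\<not> first N r" using l first_unique False by blast
      \<comment> \<open>With the centre gone, a last beam \<open>{3}\<close> or
        \<open>{2, 3}\<close> shows its red as a lone one; taking it supplies the reserve that the
        ending requires. A full last beam hides a red instead, and then the reserve is not demanded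
        until Bob has replied there.\<close>
      have lone: "lone_red N False r 3" if "N r = {3} \<or> N r = {2, 3}"
        unfolding lone_red_def exposed_last[OF r nf] using that by (elim disjE) simp_all
      have "N r \<noteq> front" using rt not_in_tails(2) unfolding front_def by metis
      moreover have "N r = whole \<or> (\<exists>i a. lone_red N False i a)"
        using rt lone unfolding tails_def whole_def by blast
      ultimately have "if opened N l r \<noteq> {} \<or> N r = whole
          then b + doubles N + of_bool (N r = front) \<ge> k + h + card (opened N l r)
          else b + doubles N + of_bool (\<exists>i a. lone_red N False i a) + of_bool (N r = front) \<ge> k + h + 1"
        using op v by (cases "N r = whole") simp_all
      moreover have "card (opened N l r) + of_bool (N r = whole) \<le> (2::nat)" using op by simp
      ultimately show ?thesis unfolding ending_bob_def using ord by blast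
    qed
    then show ?thesis using centre by (simp add: good_bob_def)
  qed
qed

lemma bob_middle:
  assumes "middle_bob N z b" "bob_move N z i a"
  shows "good_alice (remove N i a) z (b + of_bool (a \<in> reds))"
proof -
  let ?N = "remove N i a"
  have z: "z" using assms(1) by (simp add: middle_bob_def)
  have ia: "exposed N z i a" using assms(2) by (simp add: bob_move_def)
  then have i: "i < k" "a \<in> N i" "i \<in> active N" using exposed_active by blast+
  have d: "doubles ?N + of_bool (reds \<subseteq> N i \<and> a \<in> reds) = doubles N"
    using doubles_remove[where N = N, OF i(1,2)] .
  obtain l where l: "first N l" and
    cases: "(\<forall>i\<in>active N - {l}. N i \<in> tails) \<and>
        b + doubles N + of_bool (\<exists>i a. lone_red N z i a) \<ge> k + h \<or>
      (\<exists>i\<in>active N - {l}. N i = {1, 2, 3} \<and> (\<forall>j\<in>active N - {l, i}. N j \<in> tails)) \<and>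
        b + doubles N \<ge> k + h"
    using assms(1) by (auto simp: middle_bob_def)
  have ex: "exposed N z j c \<longleftrightarrow> j < k \<and> c \<in> N j \<and> (\<forall>b\<in>N j. c \<le> b)" if "j \<noteq> l" for j c
    using exposed_min[of z N j c] z first_unique[OF l, of j] that by blast
  have nh: "\<not> hides N z j" if "j \<in> active N - {l}" "N j \<in> tails" for j
  proof -
    have j: "j \<noteq> l" using that by blast
    have single: "N j = {3}" if e: "exposed N z j c" "c \<in> reds" for c
    proof -
      have "c \<in> N j" "\<forall>b\<in>N j. c \<le> b" using ex[OF j, of c] e(1) by blast+
      from tails_Min_cases[OF \<open>N j \<in> tails\<close> this] e(2) show ?thesis
        by (elim disjE conjE) simp_all
    qed
    show ?thesis
    proof
      assume "hides N z j"
      then obtain c d where "exposed N z j c" "c \<in> reds" "d \<in> N j" "\<not> exposed N z j d"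
        unfolding hides_def by blast
      then show False using single exposed_active(3) by (metis singletonD)
    qed
  qed
  have nh': "\<not> hides N z j" if "j \<notin> active N" for j
    using that exposed_active by (auto simp: hides_def)
  from cases show ?thesis
  proof (elim disjE conjE)
    assume t: "\<forall>i\<in>active N - {l}. N i \<in> tails"
      and v: "b + doubles N + of_bool (\<exists>i a. lone_red N z i a) \<ge> k + h"
    have none: "\<not> hides N z j" for j
      using nh[of j] nh'[of j] t not_hides_first[OF l] by blast
    have mv: "lone_red N z i a \<or> (\<nexists>j b. lone_red N z j b) \<and> (a \<in> reds \<or> N i \<inter> reds = {})"
      using assms(2) none by (simp add: bob_move_def)
    have v': "b + of_bool (a \<in> reds) + doubles ?N \<ge> k + h"
    proof (cases "lone_red N z i a")
      case True
      then have "of_bool (a \<in> reds) = (1::nat)" "of_bool (reds \<subseteq> N i \<and> a \<in> reds) = (0::nat)"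
        using lone_redD[of N z i a] by simp_all
      moreover have "of_bool (\<exists>i a. lone_red N z i a) \<le> (1::nat)" by simp
      ultimately show ?thesis using d v by linarith
    next
      case False
      then have "(\<nexists>j b. lone_red N z j b)" using mv by blast
      then have "b + doubles N \<ge> k + h" using v by simp
      moreover have "of_bool (reds \<subseteq> N i \<and> a \<in> reds) \<le> (of_bool (a \<in> reds) :: nat)" by simp
      ultimately show ?thesis using d by linarith
    qed
    show ?thesis
    proof (cases "active ?N = {}")
      case True
      then have "finished ?N (b + of_bool (a \<in> reds))" using v' by (simp add: finished_def)
      then show ?thesis by (simp add: good_alice_def)
    next
      case False
      \<comment> \<open>Outside the first beam the exposed cherry is green with a red behind it
        unless the beam is \<open>{3}\<close>, and Bob takes a green only from a redless
        beam.\<close>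
      have "i \<noteq> l \<Longrightarrow> N i = {3} \<and> a = 3"
      proof -
        assume il: "i \<noteq> l"
        have Ni: "N i \<in> tails" using t i(3) il by blast
        have min: "\<forall>b\<in>N i. a \<le> b" using ex[OF il] ia by blast
        have has_red: "a \<in> reds \<or> N i \<inter> reds = {}" using mv lone_redD[of N z i a] by blast
        show "N i = {3} \<and> a = 3"
          using tails_Min_cases[OF Ni i(2) min] has_red by (elim disjE) simp_all
      qed
      then have still: "?N j \<in> tails" if "j \<in> active ?N" "j \<noteq> l" for j
        using that t active_remove_subset[of N i a] by (cases "j = i") (auto simp: active_def)
      obtain l' where l': "first ?N l'" and "l' = l \<or> i = l \<and> N l - {a} = {}"
      proof (cases "i = l \<and> N l - {a} = {}")
        case True
        then show ?thesis using first_last_exist[OF l active_remove_subset False] that by metis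
      next
        case nonemp: False
        then have "first ?N l"
          using first_survives[OF l, of i a] first_remove[of N i a l] l by (cases "i = l") auto
        then show ?thesis using that by blast
      qed
      have "\<forall>j\<in>active ?N - {l'}. ?N j \<in> tails"
      proof
        fix j assume j: "j \<in> active ?N - {l'}"
        have "j \<noteq> l"
        proof
          assume "j = l"
          then have "i = l" "N l - {a} = {}" using j \<open>l' = l \<or> i = l \<and> N l - {a} = {}\<close> by blast+
          then show False using j \<open>j = l\<close> by (simp add: active_def)
        qed
        then show "?N j \<in> tails" using still j by blast
      qed
      then have "middle ?N z (b + of_bool (a \<in> reds))"
        unfolding middle_def using z l' v' by blast
      then show ?thesis by (simp add: good_alice_def)
    qed
  next
    assume "\<exists>i\<in>active N - {l}. N i = {1, 2, 3} \<and> (\<forall>j\<in>active N - {l, i}. N j \<in> tails)"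
      and v: "b + doubles N \<ge> k + h"
    then obtain j where j: "j \<in> active N - {l}" "N j = {1, 2, 3}"
      and t: "\<And>m. m \<in> active N - {l, j} \<Longrightarrow> N m \<in> tails" by blast
    have jk: "j < k" using j(1) by (simp add: active_def)
    have exj: "exposed N z j c \<longleftrightarrow> c = 1" for c
    proof -
      have "exposed N z j c \<longleftrightarrow> c \<in> {1, 2, 3} \<and> (\<forall>b\<in>{1, 2, 3}. c \<le> b)"
        using ex[of j c] j jk by simp
      then show ?thesis by auto
    qed
    then have "hides N z j" unfolding hides_def j(2) by simp
    moreover have "\<not> hides N z m" if "m \<noteq> j" for m
      using nh[of m] nh'[of m] t[of m] not_hides_first[OF l] that by blast
    \<comment> \<open>The opened beam is the only hiding one, so Bob takes its outer red and returns
      it to \<open>tails\<close>.\<close>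
    ultimately have ij: "i = j" using assms(2) by (auto simp: bob_move_def split: if_splits)
    then have a: "a = 1" using ia exj by blast
    have Nj: "N j - {a} \<in> tails" unfolding j(2) a by (simp add: tails_def insert_Diff_if)
    have rem: "N i - {a} \<noteq> {}" unfolding ij j(2) a by simp
    have "first ?N l" using first_remove[of N i a, OF rem] l by blast
    moreover have "\<forall>m\<in>active ?N - {l}. ?N m \<in> tails"
    proof
      fix m assume "m \<in> active ?N - {l}"
      then show "?N m \<in> tails"
        using t[of m] active_remove[of N i a, OF rem] ij Nj by (cases "m = j") simp_all
    qed
    moreover have "b + 1 + doubles ?N = b + doubles N" using d ij j(2) a by auto
    ultimately have "middle ?N z (b + 1)" using z v unfolding middle_def by auto
    then show ?thesis using a by (simp add: good_alice_def)
  qed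
qed

section \<open>Intervals of a beam and their ends\<close>

lemma nat_less_4: "a < 4 \<longleftrightarrow> a = 0 \<or> a = 1 \<or> a = 2 \<or> a = (3::nat)"
  by auto

lemma beam_set_eqI:
  assumes "M \<subseteq> {..<4}" "L \<subseteq> {..<4}"
  shows "M = L \<longleftrightarrow> (0 \<in> M \<longleftrightarrow> 0 \<in> L) \<and> (1 \<in> M \<longleftrightarrow> 1 \<in> L) \<and> (2 \<in> M \<longleftrightarrow> 2 \<in> L) \<and> (3 \<in> M \<longleftrightarrow> (3::nat) \<in> L)"
  (is "_ = ?R")
proof
  assume r: ?R
  have "x \<in> M \<longleftrightarrow> x \<in> L" for x
  proof (cases "x < 4")
    case True
    then show ?thesis using r unfolding nat_less_4 by (elim disjE) simp_all
  next
    case False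
    then show ?thesis using assms by auto
  qed
  then show "M = L" by blast
qed simp

lemma special_iff:
  assumes "M \<subseteq> {..<4}"
  shows "M = whole \<longleftrightarrow> 0 \<in> M \<and> 1 \<in> M \<and> 2 \<in> M \<and> 3 \<in> M"
    and "M = front \<longleftrightarrow> 0 \<in> M \<and> 1 \<in> M \<and> 2 \<in> M \<and> 3 \<notin> M"
    and "M = rear \<longleftrightarrow> 0 \<notin> M \<and> 1 \<in> M \<and> 2 \<in> M \<and> 3 \<in> M"
proof -
  have "whole \<subseteq> {..<4}" "front \<subseteq> {..<4}" "rear \<subseteq> {..<4}"
    by (simp_all add: whole_def front_def rear_def)
  then show "M = whole \<longleftrightarrow> 0 \<in> M \<and> 1 \<in> M \<and> 2 \<in> M \<and> 3 \<in> M"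
    "M = front \<longleftrightarrow> 0 \<in> M \<and> 1 \<in> M \<and> 2 \<in> M \<and> 3 \<notin> M"
    "M = rear \<longleftrightarrow> 0 \<notin> M \<and> 1 \<in> M \<and> 2 \<in> M \<and> 3 \<in> M"
    using beam_set_eqI[OF assms] by (simp_all add: whole_def front_def rear_def)
qed

lemma segments_iff:
  assumes "M \<subseteq> {..<4}"
  shows "M \<in> segments \<longleftrightarrow> (0 \<in> M \<or> 1 \<in> M \<or> 2 \<in> M \<or> 3 \<in> M) \<and>
     (0 \<in> M \<and> 2 \<in> M \<longrightarrow> 1 \<in> M) \<and> (1 \<in> M \<and> 3 \<in> M \<longrightarrow> 2 \<in> M) \<and>
     (0 \<in> M \<and> 3 \<in> M \<longrightarrow> 1 \<in> M \<and> 2 \<in> M)"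
proof -
  have lit: "M = L \<longleftrightarrow> (0 \<in> M \<longleftrightarrow> 0 \<in> L) \<and> (1 \<in> M \<longleftrightarrow> 1 \<in> L) \<and> (2 \<in> M \<longleftrightarrow> 2 \<in> L) \<and> (3 \<in> M \<longleftrightarrow> (3::nat) \<in> L)"
    if "L \<subseteq> {..<4}" for L using beam_set_eqI[OF assms that] .
  show ?thesis
    unfolding segments_def tails_def rear_def front_def
    by (cases "0 \<in> M"; cases "1 \<in> M"; cases "2 \<in> M"; cases "3 \<in> M"; simp add: lit)
qed

lemma ball_beam_set:
  assumes "M \<subseteq> {..<4}"
  shows "(\<forall>b\<in>M. P b) \<longleftrightarrow>
    (0 \<in> M \<longrightarrow> P 0) \<and> (1 \<in> M \<longrightarrow> P 1) \<and> (2 \<in> M \<longrightarrow> P 2) \<and> (3 \<in> M \<longrightarrow> P (3::nat))" (is "_ = ?R")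
proof
  assume r: ?R
  show "\<forall>b\<in>M. P b"
  proof
    fix b assume "b \<in> M"
    moreover from this have "b < 4" using assms by blast
    ultimately show "P b" using r unfolding nat_less_4 by (elim disjE) simp_all
  qed
qed simp

lemma endpoint_iff:
  assumes "M \<subseteq> {..<4}"
  shows "endpoint M 0 \<longleftrightarrow> 0 \<in> M" "endpoint M 3 \<longleftrightarrow> 3 \<in> M"
    "endpoint M 1 \<longleftrightarrow> 1 \<in> M \<and> (0 \<notin> M \<or> 2 \<notin> M \<and> 3 \<notin> M)"
    "endpoint M 2 \<longleftrightarrow> 2 \<in> M \<and> (3 \<notin> M \<or> 0 \<notin> M \<and> 1 \<notin> M)"
proof -
  note M = ball_beam_set[OF assms]
  show "endpoint M 0 \<longleftrightarrow> 0 \<in> M" "endpoint M 3 \<longleftrightarrow> 3 \<in> M"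
    "endpoint M 1 \<longleftrightarrow> 1 \<in> M \<and> (0 \<notin> M \<or> 2 \<notin> M \<and> 3 \<notin> M)"
    "endpoint M 2 \<longleftrightarrow> 2 \<in> M \<and> (3 \<notin> M \<or> 0 \<notin> M \<and> 1 \<notin> M)"
    unfolding endpoint_def M by (simp_all, blast)
qed

text \<open>This is the accounting for the last beam. A red taken from the whole beam costs a
  double, but the credit for \<open>front\<close> offsets it. In any other interval, breaking a
  double, or taking an end of \<open>front\<close>, leaves exactly one red, and this red is at an
  end, open to Bob.\<close>

lemma segment_remove:
  assumes M: "M \<in> segments" "M \<subseteq> {..<4}" and a: "endpoint M a" "M - {a} \<noteq> {}"
  shows "M - {a} \<in> segments" "M - {a} \<noteq> whole"
    and "M = whole \<Longrightarrow> a \<in> reds \<longleftrightarrow> M - {a} = front"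
    and "M \<noteq> whole \<Longrightarrow> M - {a} \<noteq> front"
    and "M \<noteq> whole \<Longrightarrow> reds \<subseteq> M \<and> a \<in> reds \<or> M = front \<Longrightarrow>
      \<exists>c. (M - {a}) \<inter> reds = {c} \<and> endpoint (M - {a}) c"
proof -
  have a4: "a = 0 \<or> a = 1 \<or> a = 2 \<or> a = 3" using a(1) M(2) nat_less_4[of a] unfolding endpoint_def by blast
  have M': "M - {a} \<subseteq> {..<4}" using M(2) by blast
  have ne: "0 \<in> M - {a} \<or> 1 \<in> M - {a} \<or> 2 \<in> M - {a} \<or> 3 \<in> M - {a}"
    using ball_beam_set[OF M', of "\<lambda>_. False"] a(2) by blast
  note iffs = segments_iff[OF M'] special_iff[OF M'] endpoint_iff[OF M'] special_iff[OF M(2)]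
    segments_iff[OF M(2)]
  note facts = M(1)[unfolded iffs] a(1) ne
  have all: "(M - {a} \<in> segments \<and> M - {a} \<noteq> whole \<and>
      (if M = whole then (a = 1 \<or> a = 3 \<longleftrightarrow> M - {a} = front) else M - {a} \<noteq> front \<and>
        (1 \<in> M \<and> 3 \<in> M \<and> (a = 1 \<or> a = 3) \<or> M = front \<longrightarrow>
        1 \<in> M - {a} \<and> 3 \<notin> M - {a} \<and> endpoint (M - {a}) 1 \<or>
        3 \<in> M - {a} \<and> 1 \<notin> M - {a} \<and> endpoint (M - {a}) 3)))"
    using a4
  proof (elim disjE)
    assume "a = 0"
    show ?thesis using facts unfolding iffs unfolding \<open>a = 0\<close> endpoint_iff[OF M(2)]
      by (cases "1 \<in> M"; cases "2 \<in> M"; cases "3 \<in> M"; simp)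
  next
    assume "a = 1"
    show ?thesis using facts unfolding iffs unfolding \<open>a = 1\<close> endpoint_iff[OF M(2)]
      by (cases "0 \<in> M"; cases "2 \<in> M"; cases "3 \<in> M"; simp)
  next
    assume "a = 2"
    show ?thesis using facts unfolding iffs unfolding \<open>a = 2\<close> endpoint_iff[OF M(2)]
      by (cases "1 \<in> M"; cases "0 \<in> M"; cases "3 \<in> M"; simp)
  next
    assume "a = 3"
    show ?thesis using facts unfolding iffs unfolding \<open>a = 3\<close> endpoint_iff[OF M(2)]
      by (cases "1 \<in> M"; cases "2 \<in> M"; cases "0 \<in> M"; simp)
  qed
  then show "M - {a} \<in> segments" "M - {a} \<noteq> whole" by blast+
  show "M = whole \<Longrightarrow> a \<in> reds \<longleftrightarrow> M - {a} = front" using all by simp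
  show "M \<noteq> whole \<Longrightarrow> M - {a} \<noteq> front" using all by simp
  assume "M \<noteq> whole" "reds \<subseteq> M \<and> a \<in> reds \<or> M = front"
  then have "1 \<in> M - {a} \<and> 3 \<notin> M - {a} \<and> endpoint (M - {a}) 1 \<or>
      3 \<in> M - {a} \<and> 1 \<notin> M - {a} \<and> endpoint (M - {a}) 3"
    using all by simp
  then show "\<exists>c. (M - {a}) \<inter> reds = {c} \<and> endpoint (M - {a}) c"
  proof
    assume *: "1 \<in> M - {a} \<and> 3 \<notin> M - {a} \<and> endpoint (M - {a}) 1"
    then have "(M - {a}) \<inter> reds = {1}" by blast
    then show ?thesis using * by blast
  next
    assume *: "3 \<in> M - {a} \<and> 1 \<notin> M - {a} \<and> endpoint (M - {a}) 3"
    then have "(M - {a}) \<inter> reds = {3}" by blast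
    then show ?thesis using * by blast
  qed
qed


lemma segments_subset: "M \<in> segments \<Longrightarrow> M \<subseteq> {..<4}"
proof -
  have "\<forall>M\<in>segments. M \<subseteq> {..<4}"
    by (simp add: segments_def tails_def rear_def front_def)
  then show "M \<in> segments \<Longrightarrow> M \<subseteq> {..<4}" by blast
qed

lemma suffix_Min_cases:
  assumes "M \<in> insert rear tails" "a \<in> M" "\<forall>b\<in>M. a \<le> b"
  shows "M = {3} \<and> a = 3 \<or> M = {2, 3} \<and> a = 2 \<and> M - {a} = {3} \<or>
    M = whole \<and> a = 0 \<and> M - {a} = rear \<or> M = rear \<and> a = 1 \<and> M - {a} = {2, 3}"
proof (cases "M = rear")
  case True
  have "a \<in> {1, 2, 3} \<and> (\<forall>b\<in>{1, 2, 3}. a \<le> b)" using assms(2,3) unfolding True rear_def by blast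
  then have "a = 1" by auto
  moreover have "rear - {1} = {2, 3}" by (simp add: rear_def insert_Diff_if)
  ultimately show ?thesis using True by blast
next
  case False
  then have "M \<in> tails" using assms(1) by blast
  moreover have "whole - {0} = rear" by (simp add: whole_def rear_def insert_Diff_if)
  moreover have "{2, 3} - {2} = {3 :: nat}" by (simp add: insert_Diff_if)
  ultimately show ?thesis using tails_Min_cases[OF _ assms(2,3)] unfolding whole_def by metis
qed

lemma rear_facts: "rear \<notin> tails" "rear \<noteq> {3}" "rear \<noteq> {2, 3}" "rear \<noteq> {}" "reds \<subseteq> rear"
proof -
  show "rear \<notin> tails" using not_in_tails(1) by (simp add: rear_def)
  then show "rear \<noteq> {3}" "rear \<noteq> {2, 3}" by (metis insertCI tails_def)+
qed (simp_all add: rear_def)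

lemma whole_facts: "whole \<in> tails" "whole \<noteq> rear" "whole \<noteq> front" "reds \<subseteq> whole"
proof -
  show "whole \<noteq> rear" "whole \<noteq> front"
    using special_iff(1)[of rear] special_iff(1)[of front] by (auto simp: rear_def front_def)
qed (simp_all add: whole_def tails_def)

lemma front_facts: "front \<inter> reds = {1}" "\<not> reds \<subseteq> front" "front - {a} \<noteq> {}" "whole - {a} \<noteq> {}"
proof -
  show "front - {a} \<noteq> {}" "whole - {a} \<noteq> {}"
    by (cases "a = 0"; simp add: front_def whole_def insert_Diff_if)+
qed (simp_all add: front_def)

lemma exposed_last_endpoint:
  "last N r \<Longrightarrow> \<not> first N r \<Longrightarrow> exposed N False r a \<longleftrightarrow> endpoint (N r) a"
  unfolding endpoint_def by (rule exposed_last)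

lemma not_double_if_emptied: "M - {a} = {} \<Longrightarrow> \<not> (reds \<subseteq> M \<and> a \<in> reds)"
proof
  assume "M - {a} = {}" "reds \<subseteq> M \<and> a \<in> reds"
  then have "1 = a" "3 = a" by blast+
  then show False by simp
qed

text \<open>A lone red raises the score without breaking a double. One of two reds raises the score
  and lowers the number of doubles, so the sum is kept. A green taken by Bob comes from a redless
  beam and changes neither.\<close>

lemma quiet_gain:
  assumes "bob_move N z i a" "\<nexists>j. hides N z j"
  shows "b + of_bool (a \<in> reds) + doubles (remove N i a) \<ge>
    b + doubles N + of_bool (\<exists>i a. lone_red N z i a)"
    and "a \<notin> reds \<Longrightarrow> N i \<inter> reds = {}"
proof -
  have mv: "lone_red N z i a \<or> (\<nexists>j b. lone_red N z j b) \<and> (a \<in> reds \<or> N i \<inter> reds = {})"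
    using assms by (simp add: bob_move_def)
  then show "a \<notin> reds \<Longrightarrow> N i \<inter> reds = {}" using lone_redD[of N z i a] by blast
  have "exposed N z i a" using assms(1) by (simp add: bob_move_def)
  then have i: "i < k" "a \<in> N i" using exposed_active by blast+
  have d: "doubles (remove N i a) + of_bool (reds \<subseteq> N i \<and> a \<in> reds) = doubles N"
    using doubles_remove[where N = N, OF i] .
  show "b + of_bool (a \<in> reds) + doubles (remove N i a) \<ge>
    b + doubles N + of_bool (\<exists>i a. lone_red N z i a)"
  proof (cases "lone_red N z i a")
    case True
    then have "of_bool (a \<in> reds) = (1::nat)" "of_bool (reds \<subseteq> N i \<and> a \<in> reds) = (0::nat)"
      using lone_redD[of N z i a] by simp_all
    moreover have "of_bool (\<exists>i a. lone_red N z i a) \<le> (1::nat)" by simp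
    ultimately show ?thesis using d by linarith
  next
    case False
    then have "of_bool (\<exists>i a. lone_red N z i a) = (0::nat)" using mv by simp
    moreover have "of_bool (reds \<subseteq> N i \<and> a \<in> reds) \<le> (of_bool (a \<in> reds) :: nat)" by simp
    ultimately show ?thesis using d by linarith
  qed
qed

section \<open>Play after the centre is gone\<close>

lemma opened_finite: "finite (opened N l r)"
  using finite_active by (simp add: opened_def)

lemma openedD: "i \<in> opened N l r \<Longrightarrow> N i = rear"
  by (simp add: opened_def)

lemma ending_bob_manyI:
  assumes "ordered N l r" "card (opened N l r) + of_bool (N r = whole) \<le> (2::nat)"
    and "b + doubles N + of_bool (N r = front) \<ge> k + h + card (opened N l r)"
    and "opened N l r = {} \<Longrightarrow> N r \<noteq> whole \<Longrightarrow>
      b + doubles N + of_bool (\<exists>i a. lone_red N False i a) + of_bool (N r = front) \<ge> k + h + 1"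
  shows "good_bob N False b"
proof -
  have "if opened N l r \<noteq> {} \<or> N r = whole
      then b + doubles N + of_bool (N r = front) \<ge> k + h + card (opened N l r)
      else b + doubles N + of_bool (\<exists>i a. lone_red N False i a) + of_bool (N r = front) \<ge> k + h + 1"
    using assms(3,4) by (cases "opened N l r = {} \<and> N r \<noteq> whole") auto
  then have "ending_bob N False b" unfolding ending_bob_def using assms(1,2) by blast
  then show ?thesis by (simp add: good_bob_def)
qed

lemma ending_manyI:
  assumes "ordered N l r" "card (opened N l r) + of_bool (N r = whole) \<le> (1::nat)"
    and "b + doubles N + of_bool (N r = front) \<ge> k + h + 1 + card (opened N l r)"
  shows "good_alice N False b"
  unfolding good_alice_def ending_def using assms by blast

text \<open>If the last beam is exhausted, its successor is either a former middle beam, which is an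
  interval, or the first beam, which is then alone. Beams only leave the middle, so no opened beam
  is added.\<close>

lemma ordered_emptied:
  assumes o: "ordered N l r" and i: "i \<in> active N" and emp: "N i - {a} = {}"
  obtains (one) l' where "first (remove N i a) l'" "last (remove N i a) l'"
    | (many) l' r' where "ordered (remove N i a) l' r'" "opened (remove N i a) l' r' \<subseteq> opened N l r"
      "i \<noteq> r \<Longrightarrow> r' = r \<and> remove N i a r = N r"
proof -
  let ?N = "remove N i a"
  have lr: "first N l" "last N r" "l \<noteq> r" "N r \<in> segments"
    and H: "\<And>j. j \<in> active N - {l, r} \<Longrightarrow> N j \<in> insert rear tails"
    using o by (auto simp: ordered_def)
  have act: "active ?N = active N - {i}" using active_remove_last[of N i a, OF emp] .
  have "l \<in> active N" "r \<in> active N" using lr by (auto simp: first_def last_def)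
  then have "active ?N \<noteq> {}" using act lr(3) by blast
  then obtain l' r' where l'r': "first ?N l'" "last ?N r'"
    using first_last_exist[OF lr(1) active_remove_subset] by metis
  have l': "l' = l" if "i \<noteq> l"
    using first_survives[OF lr(1) that] l'r'(1) first_unique by blast
  have r': "r' = r" if "i \<noteq> r"
    using last_survives[OF lr(2) that] l'r'(2) last_unique by blast
  show ?thesis
  proof (cases "l' = r'")
    case True
    then show ?thesis using one l'r' by blast
  next
    case False
    have same: "?N j = N j" "j \<in> active N" "j \<noteq> i" if "j \<in> active ?N" for j
      using that act by auto
    have mid: "j \<in> active N - {l, r} \<and> ?N j = N j" if "j \<in> active ?N - {l', r'}" for j
      using that same[of j] l' r' by blast
    have "?N r' \<in> segments"
    proof (cases "r' = r")
      case True
      then show ?thesis using same[of r'] l'r'(2) lr(4) by (simp add: last_def)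
    next
      case r: False
      have a: "r' \<in> active ?N" using l'r'(2) by (simp add: last_def)
      have "r' \<noteq> l" using l' same(3)[OF a] False by blast
      then have "N r' \<in> insert rear tails" using H[of r'] r same(2)[OF a] by blast
      then show ?thesis using same(1)[OF a] insert_rear_tails_subset by auto
    qed
    then have "ordered ?N l' r'"
      unfolding ordered_def using l'r' False mid H by metis
    moreover have "opened ?N l' r' \<subseteq> opened N l r"
      unfolding opened_def using mid by blast
    moreover have "r' = r \<and> ?N r = N r" if "i \<noteq> r" using r' that by simp
    ultimately show ?thesis using many by blast
  qed
qed

lemma ordered_kept:
  assumes o: "ordered N l r" and ne: "N i - {a} \<noteq> {}"
    and i: "i \<noteq> l \<Longrightarrow> i \<noteq> r \<Longrightarrow> N i - {a} \<in> insert rear tails" "i = r \<Longrightarrow> N r - {a} \<in> segments"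
  shows "ordered (remove N i a) l r"
proof -
  let ?N = "remove N i a"
  have lr: "first N l" "last N r" "l \<noteq> r" "N r \<in> segments"
    and H: "\<And>j. j \<in> active N - {l, r} \<Longrightarrow> N j \<in> insert rear tails"
    using o by (auto simp: ordered_def)
  have "?N j \<in> insert rear tails" if "j \<in> active ?N - {l, r}" for j
    using that H[of j] i(1) active_remove[of N i a, OF ne] by (cases "j = i") auto
  moreover have "?N r \<in> segments" using lr(4) i(2) by (cases "i = r") auto
  ultimately show ?thesis
    unfolding ordered_def using first_remove[of N i a, OF ne] last_remove[of N i a, OF ne] lr by blast
qed

lemma opened_remove:
  assumes "N i - {a} \<noteq> {}" "i \<in> active N"
  shows "opened (remove N i a) l r =
    (if i \<noteq> l \<and> i \<noteq> r \<and> N i - {a} = rear then insert i (opened N l r) else opened N l r - {i})"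
  unfolding opened_def active_remove[of N i a, OF assms(1)]
  using assms(2) by (auto simp: remove_def)

lemma alice_ending:
  assumes "ending N z b" "alice_move N z N' z'"
  shows "good_bob N' z' b"
proof -
  have z: "\<not> z" using assms(1) by (simp add: ending_def)
  then obtain i a where ia: "exposed N False i a" "N' = remove N i a" "\<not> z'"
    using assms(2) by (auto simp: alice_move_def)
  have z': "z' = False" using ia(3) by simp
  have i: "i < k" "a \<in> N i" "i \<in> active N" using ia exposed_active by blast+
  define D where "D \<longleftrightarrow> reds \<subseteq> N i \<and> a \<in> reds"
  have d: "doubles N' + of_bool D = doubles N"
    unfolding D_def ia(2) using doubles_remove[where N = N, OF i(1,2)] .
  have lone_first: "\<exists>i a. lone_red N' False i a" if "first N l" "i = l" D for l
    using lone_red_after_double[of N l a False] that i(2) ia(2) unfolding D_def by blast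
  consider (one) l where "first N l" "last N l" "b + doubles N \<ge> k + h"
    | (many) l r where "ordered N l r" "card (opened N l r) + of_bool (N r = whole) \<le> (1::nat)"
      "b + doubles N + of_bool (N r = front) \<ge> k + h + 1 + card (opened N l r)"
    using assms(1) unfolding ending_def by blast
  then show ?thesis
  proof cases
    case one
    have il: "i = l" using first_last_only[OF one(1,2)] i(3) by blast
    show ?thesis
    proof (cases "N i - {a} = {}")
      case True
      have "active N' = {}"
        using active_remove_last[of N i a, OF True] first_last_only[OF one(1,2)] il ia(2) by simp
      moreover have "doubles N' = doubles N" using not_double_if_emptied[OF True] d unfolding D_def[symmetric] by simp
      ultimately show ?thesis using one(3) by (simp add: good_bob_def finished_def)
    next
      case False
      then have fl: "first N' l" "last N' l"
        using first_remove[of N i a] last_remove[of N i a] one(1,2) ia(2) by blast+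
      have "b + doubles N' + of_bool (\<exists>i a. lone_red N' False i a) \<ge> k + h"
      proof (cases D)
        case True
        then show ?thesis using lone_first[OF one(1) il] d one(3) by simp
      next
        case False
        then show ?thesis using d one(3) by simp
      qed
      then have "ending_bob N' z' b" unfolding ending_bob_def z' using fl by blast
      then show ?thesis by (simp add: good_bob_def)
    qed
  next
    case many
    have lr: "first N l" "last N r" "l \<noteq> r" "N r \<in> segments"
      and H: "\<And>j. j \<in> active N - {l, r} \<Longrightarrow> N j \<in> insert rear tails"
      using many(1) by (auto simp: ordered_def)
    have nfr: "\<not> first N r" using lr first_unique by blast
    have card1: "card (opened N l r) \<le> 1" using many(2) by linarith
    have g1: "of_bool (N r = front) \<le> (1::nat)" by simp
    show ?thesis
    proof (cases "N i - {a} = {}")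
      case emp: True
      have d': "doubles N' = doubles N" using not_double_if_emptied[OF emp] d unfolding D_def[symmetric] by simp
      from many(1) i(3) emp show ?thesis
      proof (cases rule: ordered_emptied)
        case (one l')
        have "b + doubles N' + of_bool (\<exists>i a. lone_red N' False i a) \<ge> k + h"
          using many(3) d' g1 by linarith
        then have "ending_bob N' z' b" unfolding ending_bob_def z' using one ia(2) by blast
        then show ?thesis by (simp add: good_bob_def)
      next
        case m: (many l' r')
        note m' = m[folded ia(2)]
        have le: "card (opened N' l' r') \<le> card (opened N l r)"
          using card_mono[OF opened_finite m'(2)] .
        show ?thesis
        proof (cases "i = r")
          case False
          then have r: "r' = r" "N' r = N r" using m'(3) by blast+
          show ?thesis unfolding z'
            by (rule ending_bob_manyI[OF m'(1)]; use le many(2,3) d' r in simp)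
        next
          case True
          \<comment> \<open>A beam exhausted by one move held one cherry; hence the reserve does not
            rest on the credit for \<open>front\<close>, which would vanish with the beam.\<close>
          then have "N r \<noteq> front" using emp front_facts(3)[of a] by metis
          then have v: "b + doubles N' \<ge> k + h + 1 + card (opened N l r)" using many(3) d' by simp
          have "of_bool (N' r' = whole) \<le> (1::nat)" by simp
          then show ?thesis unfolding z'
            by - (rule ending_bob_manyI[OF m'(1)]; use le card1 v in simp)
        qed
      qed
    next
      case ne: False
      have op: "opened N' l r =
          (if i \<noteq> l \<and> i \<noteq> r \<and> N i - {a} = rear then insert i (opened N l r) else opened N l r - {i})"
        using opened_remove[of N i a, OF ne i(3)] ia(2) by simp
      have notin: "l \<notin> opened N l r" "r \<notin> opened N l r" by (auto simp: opened_def)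
      consider "i = l" | "i = r" | "i \<noteq> l" "i \<noteq> r" by blast
      then show ?thesis
      proof cases
        case 1
        have ord: "ordered N' l r" using ordered_kept[OF many(1) ne] 1 lr(3) ia(2) by blast
        have same: "opened N' l r = opened N l r" "N' r = N r" using op 1 notin lr(3) ia(2) by simp_all
        have x: "of_bool D \<le> (of_bool (\<exists>i a. lone_red N' False i a) :: nat)"
          using lone_first[OF lr(1) 1] by simp
        have D1: "of_bool D \<le> (1::nat)" by simp
        show ?thesis unfolding z'
          by (rule ending_bob_manyI[OF ord]; unfold same) (use many(2,3) d x D1 in linarith)+
      next
        case 2
        have ar: "endpoint (N r) a" using exposed_last_endpoint[OF lr(2) nfr] ia(1) 2 by blast
        note sr = segment_remove[OF lr(4) segments_subset[OF lr(4)] ar ne[unfolded 2]]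
        have ord: "ordered N' l r" using ordered_kept[OF many(1) ne] 2 lr(3) sr(1) ia(2) by blast
        have same: "opened N' l r = opened N l r" using op 2 notin by simp
        have N'r: "N' r = N r - {a}" using ia(2) 2 by simp
        have nw: "N' r \<noteq> whole" using sr(2) N'r by simp
        show ?thesis
        proof (cases "N r = whole")
          case True
          then have o0: "opened N l r = {}" using many(2) opened_finite[of N l r] by simp
          have v: "b + doubles N \<ge> k + h + 1" using many(3) o0 True whole_facts(3) by simp
          have g: "of_bool D = (of_bool (N' r = front) :: nat)"
            using sr(3)[OF True] N'r 2 True whole_facts(4) unfolding D_def by simp
          show ?thesis unfolding z'
            by (rule ending_bob_manyI[OF ord]; unfold same o0) (use v d g nw in simp_all)
        next
          case False
          then have g: "N' r \<noteq> front" using sr(4) N'r by simp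
          have w: "D \<or> N r = front \<Longrightarrow> \<exists>i a. lone_red N' False i a"
          proof -
            assume "D \<or> N r = front"
            then obtain c where c: "N' r \<inter> reds = {c}" "endpoint (N' r) c"
              using sr(5)[OF False] 2 N'r unfolding D_def by metis
            have "last N' r" "\<not> first N' r" using ord lr(3) first_unique by (auto simp: ordered_def)
            then show ?thesis using exposed_last_endpoint[of N' r c] c unfolding lone_red_def by blast
          qed
          \<comment> \<open>Breaking a double and losing the credit for \<open>front\<close> exclude
            each other, so one lone red is enough to repay Alice's move.\<close>
          have Dg: "\<not> (D \<and> N r = front)" using 2 front_facts(2) unfolding D_def by metis
          consider "D" "N r \<noteq> front" | "\<not> D" "N r = front" | "\<not> D" "N r \<noteq> front" using Dg by blast
          then show ?thesis
          proof cases
            case 1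
            show ?thesis unfolding z'
              by (rule ending_bob_manyI[OF ord]; unfold same) (use 1 w many(2,3) d g nw False in simp_all)
          next
            case 2
            show ?thesis unfolding z'
              by (rule ending_bob_manyI[OF ord]; unfold same) (use 2 w many(2,3) d g nw False in simp_all)
          next
            case 3
            show ?thesis unfolding z'
              by (rule ending_bob_manyI[OF ord]; unfold same) (use 3 many(2,3) d g nw False in simp_all)
          qed
        qed
      next
        case 3
        have Ni: "N i \<in> insert rear tails" using H i(3) 3 by blast
        have nf: "\<not> first N i" "\<not> last N i" using 3 lr first_unique last_unique by blast+
        have min: "\<forall>b\<in>N i. a \<le> b" using exposed_min[of False N i a] nf ia(1) by blast
        have r: "N' r = N r" using 3 ia(2) by simp
        consider "N i = {2, 3}" "a = 2" "N i - {a} = {3}" | "N i = whole" "a = 0" "N i - {a} = rear"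
          | "N i = rear" "a = 1" "N i - {a} = {2, 3}"
          using suffix_Min_cases[OF Ni i(2) min] ne by fastforce
        then show ?thesis
        proof cases
          case A: 1
          have "N i - {a} \<in> insert rear tails" unfolding A(3) using tails_members by blast
          then have ord: "ordered N' l r" using ordered_kept[OF many(1) ne] 3 ia(2) by blast
          have "i \<notin> opened N l r" using A(1) rear_facts(3) openedD[of i N l r] by argo
          then have same: "opened N' l r = opened N l r" using op A(3) rear_facts(2) by simp
          have d': "doubles N' = doubles N" using d A(2) by (simp add: D_def)
          show ?thesis unfolding z'
            by (rule ending_bob_manyI[OF ord]; use same r d' many(2,3) in simp)
        next
          case A: 2
          have "N i - {a} \<in> insert rear tails" unfolding A(3) by blast
          then have ord: "ordered N' l r" using ordered_kept[OF many(1) ne] 3 ia(2) by blast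
          have "i \<notin> opened N l r" using A(1) whole_facts(2) openedD[of i N l r] by argo
          \<comment> \<open>The number of opened beams grows by one, which is exactly the amount by
            which the threshold on Bob's turn is lower.\<close>
          then have card: "card (opened N' l r) = card (opened N l r) + 1"
            using op A(3) 3 opened_finite[of N l r] by simp
          have d': "doubles N' = doubles N" using d A(2) by (simp add: D_def)
          show ?thesis unfolding z'
            by (rule ending_bob_manyI[OF ord]; use card r d' many(2,3) in simp)
        next
          case A: 3
          have "N i - {a} \<in> insert rear tails" unfolding A(3) using tails_members by blast
          then have ord: "ordered N' l r" using ordered_kept[OF many(1) ne] 3 ia(2) by blast
          have in_op: "i \<in> opened N l r" using A(1) i(3) 3 by (simp add: opened_def)
          then have "card (opened N l r) > 0" using opened_finite[of N l r] card_gt_0_iff by blast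
          \<comment> \<open>This beam exhausts the allowance for hiding beams, so the last beam is
            not full. The extra unit reserved for the opened beam pays for the double that is broken
            here.\<close>
          then have c1: "card (opened N l r) = 1" "N r \<noteq> whole" using many(2) by (auto simp: not_le)
          have "opened N' l r = opened N l r - {i}" using op A(3) rear_facts(3) by simp
          then have same: "card (opened N' l r) = 0" using c1(1) in_op by simp
          have d': "doubles N' + 1 = doubles N" using d A(1,2) rear_facts(5) by (simp add: D_def)
          show ?thesis unfolding z'
            by (rule ending_bob_manyI[OF ord]; unfold same r) (use many(3) c1 d' in simp_all)
        qed
      qed
    qed
  qed
qed

lemma hides_ordered:
  assumes o: "ordered N l r"
  shows "hides N False j \<longleftrightarrow> j \<in> opened N l r \<or> j = r \<and> N r = whole"
proof -
  have lr: "first N l" "last N r" "l \<noteq> r" "N r \<in> segments"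
    and H: "\<And>j. j \<in> active N - {l, r} \<Longrightarrow> N j \<in> insert rear tails"
    using o by (auto simp: ordered_def)
  have nfr: "\<not> first N r" using lr first_unique by blast
  have r: "hides N False r \<longleftrightarrow> N r = whole"
  proof -
    note M = segments_subset[OF lr(4)]
    have "hides N False r \<longleftrightarrow> (endpoint (N r) 1 \<or> endpoint (N r) 3) \<and>
        (1 \<in> N r \<and> \<not> endpoint (N r) 1 \<or> 3 \<in> N r \<and> \<not> endpoint (N r) 3)"
      unfolding hides_def exposed_last_endpoint[OF lr(2) nfr] by simp
    then show ?thesis
      using lr(4) unfolding endpoint_iff[OF M] special_iff[OF M] segments_iff[OF M] by blast
  qed
  consider "j \<notin> active N" | "j = l" | "j = r" | "j \<in> active N - {l, r}" by blast
  then show ?thesis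
  proof cases
    case 1
    then have "\<not> hides N False j" using exposed_active(1) unfolding hides_def by blast
    then show ?thesis using 1 lr(2) by (auto simp: opened_def last_def)
  next
    case 2
    then show ?thesis using not_hides_first[OF lr(1)] lr(3) by (auto simp: opened_def)
  next
    case 3
    then show ?thesis using r by (auto simp: opened_def)
  next
    case 4
    have nf: "\<not> first N j" "\<not> last N j" using 4 lr first_unique last_unique by blast+
    have ex: "exposed N False j c \<longleftrightarrow> c \<in> N j \<and> (\<forall>b\<in>N j. c \<le> b)" for c
      using exposed_min[of False N j c] nf 4 by (auto simp: active_def)
    have "hides N False j \<longleftrightarrow> N j = rear"
    proof
      assume "hides N False j"
      then obtain c e where c: "c \<in> N j" "\<forall>b\<in>N j. c \<le> b" "c \<in> reds"
        and e: "e \<in> N j" "\<not> (\<forall>b\<in>N j. e \<le> b)"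
        unfolding hides_def ex by blast
      then show "N j = rear"
        using suffix_Min_cases[OF H[OF 4] c(1,2)] by (elim disjE conjE) simp_all
    next
      assume eq: "N j = rear"
      then have "exposed N False j 1" "3 \<in> N j" "\<not> exposed N False j 3"
        unfolding ex rear_def by simp_all
      then show "hides N False j" unfolding hides_def by blast
    qed
    then show ?thesis using 4 by (auto simp: opened_def)
  qed
qed

lemma bob_ending:
  assumes "ending_bob N z b" "bob_move N z i a"
  shows "good_alice (remove N i a) z (b + of_bool (a \<in> reds))"
proof -
  have z: "z = False" using assms(1) by (simp add: ending_bob_def)
  have ia: "exposed N False i a" using assms(2) unfolding bob_move_def z by blast
  have i: "i < k" "a \<in> N i" "i \<in> active N" using ia exposed_active by blast+
  let ?N = "remove N i a"
  define c where "c = b + of_bool (a \<in> reds)"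
  have d: "doubles ?N + of_bool (reds \<subseteq> N i \<and> a \<in> reds) = doubles N"
    using doubles_remove[where N = N, OF i(1,2)] .
  consider (one) l where "first N l" "last N l"
      "b + doubles N + of_bool (\<exists>i a. lone_red N False i a) \<ge> k + h"
    | (many) l r where "ordered N l r" "card (opened N l r) + of_bool (N r = whole) \<le> (2::nat)"
      "if opened N l r \<noteq> {} \<or> N r = whole
          then b + doubles N + of_bool (N r = front) \<ge> k + h + card (opened N l r)
          else b + doubles N + of_bool (\<exists>i a. lone_red N False i a) + of_bool (N r = front) \<ge> k + h + 1"
    using assms(1) unfolding ending_bob_def z by blast
  then have "good_alice ?N z c"
  proof cases
    case one
    have il: "i = l" using first_last_only[OF one(1,2)] i(3) by blast
    have none: "\<nexists>j. hides N z j"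
    proof
      assume "\<exists>j. hides N z j"
      then obtain j where j: "hides N z j" ..
      then have "j \<in> active N" using exposed_active(1) unfolding hides_def by blast
      then have "j = l" using first_last_only[OF one(1,2)] by blast
      then show False using j not_hides_first[OF one(1)] by blast
    qed
    have v: "c + doubles ?N \<ge> k + h"
      using quiet_gain(1)[OF assms(2) none, of b] one(3) unfolding z c_def by linarith
    show ?thesis
    proof (cases "N i - {a} = {}")
      case True
      have "active ?N = {}"
        using active_remove_last[of N i a, OF True] first_last_only[OF one(1,2)] il by simp
      then have "finished ?N c" using v by (simp add: finished_def)
      then show ?thesis by (simp add: good_alice_def)
    next
      case False
      then have "first ?N l" "last ?N l"
        using first_remove[of N i a] last_remove[of N i a] one(1,2) by blast+
      then have "ending ?N z c" unfolding ending_def z using v by blast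
      then show ?thesis by (simp add: good_alice_def)
    qed
  next
    case many
    have lr: "first N l" "last N r" "l \<noteq> r" "N r \<in> segments"
      and H: "\<And>j. j \<in> active N - {l, r} \<Longrightarrow> N j \<in> insert rear tails"
      using many(1) by (auto simp: ordered_def)
    have nfr: "\<not> first N r" using lr first_unique by blast
    have notin: "l \<notin> opened N l r" "r \<notin> opened N l r" by (auto simp: opened_def)
    show ?thesis
    proof (cases "opened N l r \<noteq> {} \<or> N r = whole")
      case hid: True
      then have v: "b + doubles N + of_bool (N r = front) \<ge> k + h + card (opened N l r)"
        using many(3) by simp
      have "\<exists>j. hides N z j" using hid hides_ordered[OF many(1)] unfolding z by blast
      then have red: "a \<in> reds" and "hides N False i"
        using assms(2) unfolding bob_move_def z by simp_all
      then consider "i \<in> opened N l r" | "i = r" "N r = whole"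
        using hides_ordered[OF many(1)] by blast
      then show ?thesis
      proof cases
        \<comment> \<open>Score and doubles compensate each other, and the requirement drops with
          the number of opened beams.\<close>
        case 1
        then have ne: "i \<noteq> l" "i \<noteq> r" and Ni: "N i = rear" by (auto simp: opened_def)
        have nf: "\<not> first N i" "\<not> last N i" using ne lr first_unique last_unique by blast+
        have min: "\<forall>b\<in>N i. a \<le> b" using exposed_min[of False N i a] nf ia by blast
        have "a = 1 \<and> N i - {a} = {2, 3}"
          using suffix_Min_cases[OF _ i(2) min] Ni rear_facts whole_facts(2) by (metis insertI1)
        then have A: "a = 1" "N i - {a} = {2, 3}" by blast+
        have rem: "N i - {a} \<noteq> {}" unfolding A(2) by simp
        have "N i - {a} \<in> insert rear tails" unfolding A(2) using tails_members by blast
        then have ord: "ordered ?N l r" using ordered_kept[OF many(1) rem] ne by blast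
        have "opened ?N l r = opened N l r - {i}"
          using opened_remove[of N i a, OF rem i(3)] A(2) rear_facts(3) by simp
        then have card: "card (opened ?N l r) + 1 = card (opened N l r)"
          using 1 opened_finite[of N l r] by (metis Suc_eq_plus1 card_Suc_Diff1)
        have d': "doubles ?N + 1 = doubles N" using d A(1) rear_facts(5) Ni by simp
        have b: "c = b + 1" using red by (simp add: c_def)
        have r: "?N r = N r" using ne by simp
        show ?thesis unfolding z
          by (rule ending_manyI[OF ord]; unfold b r) (use card many(2) v d' in linarith)+
      next
        case 2
        have ar: "endpoint (N r) a" using exposed_last_endpoint[OF lr(2) nfr] ia 2 by blast
        have rem: "N r - {a} \<noteq> {}" using 2(2) front_facts(4) by metis
        note sr = segment_remove[OF lr(4) segments_subset[OF lr(4)] ar rem]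
        have ord: "ordered ?N l r" using ordered_kept[of N l r i a] many(1) rem 2 lr(3) sr(1) by blast
        have same: "opened ?N l r = opened N l r"
          using opened_remove[of N i a l r] rem i(3) 2(1) notin by simp
        \<comment> \<open>The only red end of a full beam is its innermost cherry. Bob exchanges a
          double for a point, and the credit for \<open>front\<close> comes on top.\<close>
        have N'r: "?N r = front" using sr(3)[OF 2(2)] red 2(1) by simp
        have nw: "?N r \<noteq> whole" using sr(2) 2(1) by simp
        have d': "doubles ?N + 1 = doubles N" using d red whole_facts(4) 2 by simp
        have b: "c = b + 1" using red by (simp add: c_def)
        have nfront: "N r \<noteq> front" using 2(2) whole_facts(3) by metis
        show ?thesis unfolding z
          by (rule ending_manyI[OF ord]; unfold b same) (use 2(2) many(2) v d' N'r nw nfront in simp_all)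
      qed
    next
      case quiet: False
      then have op0: "opened N l r = {}" and nwh: "N r \<noteq> whole" by blast+
      have none: "\<nexists>j. hides N z j" using quiet hides_ordered[OF many(1)] unfolding z by blast
      have "b + doubles N + of_bool (\<exists>i a. lone_red N False i a) + of_bool (N r = front) \<ge> k + h + 1"
        using many(3) quiet by simp
      then have v: "c + doubles ?N + of_bool (N r = front) \<ge> k + h + 1"
        using quiet_gain(1)[OF assms(2) none, of b] unfolding z c_def by linarith
      show ?thesis
      proof (cases "N i - {a} = {}")
        case emp: True
        from many(1) i(3) emp show ?thesis
        proof (cases rule: ordered_emptied)
          case (one l')
          have "of_bool (N r = front) \<le> (1::nat)" by simp
          then have "c + doubles ?N \<ge> k + h" using v by linarith
          then have "ending ?N z c" unfolding ending_def z using one by blast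
          then show ?thesis by (simp add: good_alice_def)
        next
          case m: (many l' r')
          have o0: "opened ?N l' r' = {}" using m(2) op0 by blast
          show ?thesis
          proof (cases "i = r")
            case False
            then have r: "r' = r" "?N r = N r" using m(3) by blast+
            show ?thesis unfolding z
              by (rule ending_manyI[OF m(1)]; use v nwh o0 r in simp)
          next
            case True
            then have "N r \<noteq> front" using emp front_facts(3)[of a] by metis
            then show ?thesis unfolding z
              by - (rule ending_manyI[OF m(1)]; unfold o0; use v in simp)
          qed
        qed
      next
        case ne: False
        consider "i = l" | "i = r" | "i \<noteq> l" "i \<noteq> r" by blast
        then show ?thesis
        proof cases
          case 1
          have ord: "ordered ?N l r" using ordered_kept[OF many(1) ne] 1 lr(3) by blast
          have same: "opened ?N l r = {}" "?N r = N r"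
            using opened_remove[of N i a l r, OF ne i(3)] op0 1 lr(3) by simp_all
          show ?thesis unfolding z
            by (rule ending_manyI[OF ord]; unfold same) (use v nwh in simp_all)
        next
          case 2
          have ar: "endpoint (N r) a" using exposed_last_endpoint[OF lr(2) nfr] ia 2 by blast
          note sr = segment_remove[OF lr(4) segments_subset[OF lr(4)] ar ne[unfolded 2]]
          have ord: "ordered ?N l r" using ordered_kept[OF many(1) ne] 2 lr(3) sr(1) by blast
          have o0: "opened ?N l r = {}"
            using opened_remove[of N i a l r, OF ne i(3)] op0 2 by simp
          \<comment> \<open>Both ends of \<open>front\<close> are green while its red remains, so
            Bob's rule keeps him from destroying this credit.\<close>
          have "N r \<noteq> front"
          proof
            assume f: "N r = front"
            have "a \<notin> reds" using ar unfolding f by (auto simp: endpoint_def front_def)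
            then have "N i \<inter> reds = {}" using quiet_gain(2)[OF assms(2) none] by blast
            then show False using f 2 front_facts(1) by simp
          qed
          moreover have "?N r \<noteq> whole" using sr(2) 2 by simp
          ultimately show ?thesis unfolding z
            by - (rule ending_manyI[OF ord]; unfold o0; use v in simp)
        next
          case 3
          \<comment> \<open>A middle beam that is neither opened nor \<open>{3}\<close> offers only
            a green with a red behind it; without hidden pairs, Bob does not take such a
            green.\<close>
          have mid: "i \<in> active N - {l, r}" using 3 i(3) by blast
          then have "N i \<noteq> rear" using op0 unfolding opened_def by blast
          moreover have nf: "\<not> first N i" "\<not> last N i" using 3 lr first_unique last_unique by blast+
          have min: "\<forall>b\<in>N i. a \<le> b" using exposed_min[of False N i a] nf ia by blast
          moreover have "N i \<noteq> {3} \<or> a \<noteq> 3" using ne by auto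
          ultimately have "N i = {2, 3} \<and> a = 2 \<or> N i = whole \<and> a = 0"
            using suffix_Min_cases[OF H[OF mid] i(2) min] by blast
          then have "a \<notin> reds \<and> 3 \<in> N i"
            unfolding whole_def by (elim disjE conjE) simp_all
          then show ?thesis using quiet_gain(2)[OF assms(2) none] by blast
        qed
      qed
    qed
  qed
  then show ?thesis by (simp only: c_def)
qed

section \<open>The invariant over the whole game\<close>

lemma alice_step: "good_alice N z b \<Longrightarrow> alice_move N z N' z' \<Longrightarrow> good_bob N' z' b"
proof -
  assume g: "good_alice N z b" and m: "alice_move N z N' z'"
  have "good_bob N' z' b" if f: "finished N b"
  proof -
    have "active N' = {} \<and> doubles N' = doubles N"
      using m f exposed_active(1) unfolding alice_move_def finished_def by blast
    then show ?thesis using f by (simp add: good_bob_def finished_def)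
  qed
  moreover have "good_bob N' z' b" if "start N z b"
    using alice_start[OF that m] by (simp add: good_bob_def)
  ultimately show ?thesis using g alice_middle[OF _ m] alice_ending[OF _ m] unfolding good_alice_def by blast
qed

lemma bob_step:
  "good_bob N z b \<Longrightarrow> bob_move N z i a \<Longrightarrow> good_alice (remove N i a) z (b + of_bool (a \<in> reds))"
proof -
  assume g: "good_bob N z b" and m: "bob_move N z i a"
  have "i \<in> active N" using m exposed_active(1) unfolding bob_move_def by blast
  then have "\<not> finished N b" by (auto simp: finished_def)
  then show ?thesis
    using g bob_start[OF _ m] bob_middle[OF _ m] bob_ending[OF _ m] unfolding good_bob_def by blast
qed

text \<open>The exposed end beam either shows a red cherry or has none left.\<close>

lemma bob_not_stuck:
  assumes "good_bob N z b" "active N \<noteq> {}"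
  shows "(\<exists>i. \<exists>a\<in>reds. exposed N z i a) \<or> (\<exists>i\<in>active N. N i \<inter> reds = {})"
proof -
  have first: ?thesis if "first N l" for l
    using that exposed_first[OF that, of z] unfolding first_def by blast
  have "\<not> finished N b" using assms(2) by (simp add: finished_def)
  then consider "start_bob N z b" | "middle_bob N z b" | "ending_bob N z b"
    using assms(1) unfolding good_bob_def by blast
  then show ?thesis
  proof cases
    case 1
    then obtain i where i: "i < k" "N i \<in> {{3}, {1, 2, 3}}" unfolding start_bob_def by blast
    then have "exposed N z i 3 \<or> exposed N z i 1" unfolding exposed_def by fastforce
    then show ?thesis by blast
  next
    case 2
    then show ?thesis using first unfolding middle_bob_def by blast
  next
    case 3
    then show ?thesis using first unfolding ending_bob_def ordered_def by blast
  qed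
qed

lemma good_alice_initial:
  assumes N: "\<And>i. i < k \<Longrightarrow> N i = {..<4}"
  shows "good_alice N True 0"
proof -
  have four: "{..<4} = {0, 1, 2, 3::nat}" by auto
  have four_ne: "{..<4::nat} \<noteq> {}" by (simp add: lessThan_empty_iff)
  have k_pos: "k \<noteq> 0" using k by simp
  have act: "active N = {..<k}" using N four_ne by (auto simp: active_def)
  have "{i. i < k \<and> reds \<subseteq> N i} = {..<k}" using N by auto
  then have "doubles N = k" unfolding doubles_def by simp
  moreover have "\<nexists>l. first N l"
  proof
    assume "\<exists>l. first N l"
    then obtain l where l: "l < k" "\<forall>j<k. \<not> B l j" unfolding first_def act by auto
    then have "{j. j < k \<and> B l j} = {}" by blast
    then have "card {j. j < k \<and> B l j} = 0" by (simp only: card.empty)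
    then show False using card_B[OF l(1)] h by linarith
  qed
  moreover have "{i. i < k \<and> N i = {}} = {}" using N four_ne by blast
  moreover have "\<forall>i<k. N i \<in> fresh" using N by (simp add: fresh_def four)
  ultimately have "start N True 0"
    unfolding start_def act using k_pos by (simp add: lessThan_empty_iff)
  then show ?thesis by (simp add: good_alice_def)
qed

lemma good_end:
  assumes "good_alice N z b \<or> good_bob N z b" "active N = {}"
  shows "b \<ge> k + h"
proof -
  have "doubles N = 0" using assms(2) by (auto simp: doubles_def active_def)
  moreover have "\<not> first N l" for l using assms(2) by (simp add: first_def)
  moreover have "\<not> start_bob N z b"
    using assms(2) unfolding start_bob_def active_def by fastforce
  ultimately show ?thesis
    using assms unfolding good_alice_def good_bob_def start_def middle_def middle_bob_def
      ending_def ending_bob_def ordered_def finished_def by auto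
qed

end

section \<open>Extremal cherries of a sun\<close>

lemma extremal_antimono:
  assumes "c \<in> extremal D" "c \<in> C" "C \<subseteq> D"
  shows "c \<in> extremal C"
  using assms hull_mono[of "C - {c}" "D - {c}" convex] by (auto simp: extremal_def)

lemma orient_convex_combination:
  assumes "u + v = 1"
  shows "orient q p (u *\<^sub>R x + v *\<^sub>R y) = u * orient q p x + v * orient q p y"
proof -
  have v: "v = 1 - u" using assms by simp
  show ?thesis unfolding v orient_coords by (simp add: algebra_simps)
qed

text \<open>An open half plane together with the single point \<open>q\<close> of its boundary line
  is convex, and it avoids the boundary point \<open>p\<close>. The sign of \<open>s\<close> selects
  the half plane.\<close>

lemma not_in_hull_of_one_side:
  assumes "p \<noteq> q" and side: "\<And>x. x \<in> X \<Longrightarrow> x = q \<or> s * orient q p x > 0"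
  shows "p \<notin> convex hull X"
proof -
  let ?T = "{x. x = q \<or> s * orient q p x > 0}"
  have "convex ?T"
  proof (rule convexI)
    fix x y :: complex and u v :: real
    assume x: "x \<in> ?T" and y: "y \<in> ?T" and uv: "0 \<le> u" "0 \<le> v" "u + v = 1"
    have q: "orient q p q = 0" by (simp add: orient_coords)
    have eq: "s * orient q p (u *\<^sub>R x + v *\<^sub>R y) = u * (s * orient q p x) + v * (s * orient q p y)"
      using orient_convex_combination[OF uv(3)] by (simp add: algebra_simps)
    show "u *\<^sub>R x + v *\<^sub>R y \<in> ?T"
    proof (cases "x = q \<and> y = q \<or> u = 0 \<or> v = 0")
      case True
      then show ?thesis using x y uv by (auto simp flip: scaleR_left_distrib)
    next
      case False
      then have "u > 0" "v > 0" using uv by auto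
      then have "u * (s * orient q p x) + v * (s * orient q p y) > 0"
        using False x y q by (auto intro: add_pos_pos)
      then show ?thesis unfolding eq[symmetric] by simp
    qed
  qed
  then have "convex hull X \<subseteq> ?T"
    using side by (intro hull_minimal) auto
  moreover have "p \<notin> ?T" using assms(1) by (simp add: orient_coords)
  ultimately show ?thesis by blast
qed

text \<open>The three signed areas are the barycentric coordinates of \<open>p\<close> up to
  normalisation.\<close>

lemma in_triangle:
  assumes "s * orient p r t \<ge> 0" "s * orient q p t > 0" "s * orient q r p > 0"
  shows "p \<in> convex hull {q, r, t}"
proof -
  let ?a = "s * orient p r t" and ?b = "s * orient q p t" and ?c = "s * orient q r p"
  let ?D = "?a + ?b + ?c"
  have D: "?D > 0" using assms by linarith
  have eq: "?D *\<^sub>R p = ?a *\<^sub>R q + ?b *\<^sub>R r + ?c *\<^sub>R t"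
    by (simp add: complex_eq_iff orient_coords algebra_simps)
  have "p = (1 / ?D) *\<^sub>R (?D *\<^sub>R p)" using D by simp
  also have "\<dots> = (?a / ?D) *\<^sub>R q + (?b / ?D) *\<^sub>R r + (?c / ?D) *\<^sub>R t"
    unfolding eq by (simp add: scaleR_add_right)
  finally have "p = (?a / ?D) *\<^sub>R q + (?b / ?D) *\<^sub>R r + (?c / ?D) *\<^sub>R t" .
  moreover have "?a / ?D + ?b / ?D + ?c / ?D = 1"
    using D by (simp flip: add_divide_distrib)
  moreover have "?a / ?D \<ge> 0" "?b / ?D \<ge> 0" "?c / ?D \<ge> 0"
    using assms D by auto
  ultimately show ?thesis unfolding convex_hull_3 by blast
qed

text \<open>The sign \<open>\<sigma>\<close> accounts for the two possible senses in which the beams bend.\<close>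

locale oriented_sun = beam_tournament k h B for k h :: nat and B :: "nat \<Rightarrow> nat \<Rightarrow> bool" +
  fixes \<zeta> :: complex and Y :: "nat \<Rightarrow> nat \<Rightarrow> complex" and \<sigma> :: real
  assumes sun: "sun k \<zeta> Y"
    and outside: "\<And>i j a b c. i < k \<Longrightarrow> j < k \<Longrightarrow> B i j \<Longrightarrow> a < b \<Longrightarrow> b < 4 \<Longrightarrow> c < 4 \<Longrightarrow>
      \<sigma> * orient (Y i a) (Y i b) (Y j c) < 0"
    and inside: "\<And>i j a b c. i < k \<Longrightarrow> j < k \<Longrightarrow> B j i \<Longrightarrow> a < b \<Longrightarrow> b < 4 \<Longrightarrow> c < 4 \<Longrightarrow>
      \<sigma> * orient (Y i a) (Y i b) (Y j c) > 0"
    and convex: "\<And>i a b c. i < k \<Longrightarrow> a < b \<Longrightarrow> b < c \<Longrightarrow> c < 4 \<Longrightarrow>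
      \<sigma> * orient (Y i a) (Y i b) (Y i c) > 0"
    and convex_centre: "\<And>i a b. i < k \<Longrightarrow> a < b \<Longrightarrow> b < 4 \<Longrightarrow>
      \<sigma> * orient (Y i a) (Y i b) \<zeta> > 0"
    and turn: "\<And>i j a b. i < k \<Longrightarrow> j < k \<Longrightarrow> B i j \<Longrightarrow> a < 4 \<Longrightarrow> b < 4 \<Longrightarrow>
      \<sigma> * orient \<zeta> (Y i a) (Y j b) > 0"
    and dist_decreasing: "\<And>i a b. i < k \<Longrightarrow> a < b \<Longrightarrow> b < 4 \<Longrightarrow> dist \<zeta> (Y i b) < dist \<zeta> (Y i a)"
begin

section \<open>The outermost remaining cherry of a beam\<close>

abbreviation S :: "complex set" where "S \<equiv> sun_cherries k \<zeta> Y"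

lemma sun_cherriesE:
  assumes "x \<in> S"
  obtains "x = \<zeta>" | i a where "i < k" "a < 4" "x = Y i a"
  using assms by (auto simp: sun_cherries_def beam_def)

lemma cherry_in: "i < k \<Longrightarrow> a < 4 \<Longrightarrow> Y i a \<in> S" and centre_in: "\<zeta> \<in> S"
  by (auto simp: sun_cherries_def beam_def)

lemma cherry_eq_iff:
  "i < k \<Longrightarrow> j < k \<Longrightarrow> a < 4 \<Longrightarrow> b < 4 \<Longrightarrow> Y i a = Y j b \<longleftrightarrow> i = j \<and> a = b"
proof -
  have "inj_on (\<lambda>(i, j). Y i j) ({..<k} \<times> {..<4})"
    using sun unfolding sun_def by (elim conjE)
  then show "i < k \<Longrightarrow> j < k \<Longrightarrow> a < 4 \<Longrightarrow> b < 4 \<Longrightarrow> Y i a = Y j b \<longleftrightarrow> i = j \<and> a = b"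
    by (auto dest: inj_onD[where x = "(i, a)" and y = "(j, b)"])
qed

lemma cherry_neq_centre: "i < k \<Longrightarrow> a < 4 \<Longrightarrow> Y i a \<noteq> \<zeta>"
proof -
  have "\<forall>i<k. \<zeta> \<notin> beam Y i" using sun unfolding sun_def by (elim conjE)
  then show "i < k \<Longrightarrow> a < 4 \<Longrightarrow> Y i a \<noteq> \<zeta>" by (force simp: beam_def)
qed

lemma cherry_in_beam_iff: "i < k \<Longrightarrow> j < k \<Longrightarrow> a < 4 \<Longrightarrow> Y j a \<in> beam Y i \<longleftrightarrow> j = i"
  using cherry_eq_iff[of j i a] by (auto simp: beam_def)

lemma centre_notin_beam: "i < k \<Longrightarrow> \<zeta> \<notin> beam Y i"
  using cherry_neq_centre[of i] by (auto simp: beam_def)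

lemma finite_S: "finite S"
  using sun unfolding sun_def cake_def by (elim conjE)

text \<open>The removal condition of a sun is applied to the cherries further out on the arc; by
  \<open>dist_decreasing\<close> the next one is the farthest of those that remain. Taking away
  further cherries preserves extremality.\<close>

lemma outermost_extremal:
  assumes "C \<subseteq> S" "i < k" "a < 4" "Y i a \<in> C" "\<And>b. b < a \<Longrightarrow> Y i b \<notin> C"
  shows "Y i a \<in> extremal C"
proof -
  let ?A = "Y i ` {..<a}"
  have sub: "?A \<subset> beam Y i"
  proof
    show "?A \<subseteq> beam Y i" using assms(3) by (auto simp: beam_def)
    have "Y i a \<in> beam Y i - ?A" using assms by (auto simp: beam_def)
    then show "?A \<noteq> beam Y i" by blast
  qed
  have c: "Y i a \<in> beam Y i - ?A" using assms by (auto simp: beam_def)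
  have d: "\<forall>d\<in>beam Y i - ?A. dist \<zeta> d \<le> dist \<zeta> (Y i a)"
  proof
    fix d assume "d \<in> beam Y i - ?A"
    then obtain b where b: "b < 4" "d = Y i b" "\<not> b < a" by (auto simp: beam_def)
    then show "dist \<zeta> d \<le> dist \<zeta> (Y i a)"
      using dist_decreasing[of i a b] assms(2) by (cases "a = b") auto
  qed
  have "\<forall>A c. A \<subset> beam Y i \<and> c \<in> beam Y i - A \<and> (\<forall>d\<in>beam Y i - A. dist \<zeta> d \<le> dist \<zeta> c) \<longrightarrow>
        c \<in> extremal (S - A)"
    using sun assms(2) unfolding sun_def by blast
  then have "Y i a \<in> extremal (S - ?A)" using sub c d by blast
  then show ?thesis
    by (rule extremal_antimono) (use assms in auto)
qed

text \<open>Once the rest of its own beam is removed, each cherry is the outermost one.\<close>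

lemma not_in_hull_of_other_beams:
  assumes "i < k" "a < 4"
  shows "Y i a \<notin> convex hull (S - beam Y i)"
proof -
  let ?C = "insert (Y i a) (S - beam Y i)"
  have "Y i a \<in> extremal ?C"
  proof (rule outermost_extremal)
    fix b assume "b < a"
    then show "Y i b \<notin> ?C" using assms cherry_eq_iff[of i i b a] by (auto simp: beam_def)
  qed (use assms cherry_in in auto)
  moreover have "?C - {Y i a} = S - beam Y i" using assms by (auto simp: beam_def)
  ultimately show ?thesis by (simp add: extremal_def)
qed

lemma not_extremal_if_in_triangle:
  assumes "p \<in> convex hull {q, r, t}" "{q, r, t} \<subseteq> C" "p \<notin> {q, r, t}"
  shows "p \<notin> extremal C"
proof -
  have "{q, r, t} \<subseteq> C - {p}" using assms by blast
  then have "p \<in> convex hull (C - {p})" using assms(1) hull_mono by blast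
  then show ?thesis by (simp add: extremal_def)
qed

section \<open>Triangles that hide a cherry\<close>

text \<open>The cherry lies in the triangle formed by one further out in its beam, one of a beam on
  the outer side and one of a beam on the inner side. Two sides are controlled by the line through
  the two cherries of beam \<open>i\<close>. For the third, either the three beams wind around the
  centre and signed areas add up, or a violation would put the cherry into the convex hull of the
  centre and other beams.\<close>

lemma hidden_between_beams:
  assumes "i < k" "j < k" "l < k" "B i j" "B l i" "a < b" "b < 4" "c < 4" "d < 4"
    and C: "{Y i a, Y j c, Y l d} \<subseteq> C"
  shows "Y i b \<notin> extremal C"
proof -
  let ?q = "Y i a" and ?p = "Y i b" and ?r = "Y j c" and ?t = "Y l d"
  have ne: "i \<noteq> j" "i \<noteq> l" "j \<noteq> l"
    using assms(1-5) irrefl[of i] tournament[of i j] by metis+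
  have pr: "\<sigma> * orient \<zeta> ?p ?r > 0" and tp: "\<sigma> * orient \<zeta> ?t ?p > 0"
    using turn[of i j b c] turn[of l i d b] assms(1-9) by simp_all
  have "\<sigma> * orient ?p ?r ?t \<ge> 0"
  proof (cases "B j l")
    case True
    then have "\<sigma> * orient \<zeta> ?r ?t > 0" using turn[of j l c d] assms(1-9) by simp
    moreover have "orient ?p ?r ?t = orient \<zeta> ?p ?r + orient \<zeta> ?r ?t + orient \<zeta> ?t ?p"
      by (simp add: orient_coords algebra_simps)
    ultimately show ?thesis using pr tp by (simp add: distrib_left)
  next
    case False
    show ?thesis
    proof (rule ccontr)
      assume "\<not> \<sigma> * orient ?p ?r ?t \<ge> 0"
      then have "\<sigma> * orient ?p ?t ?r \<ge> 0" by (simp add: orient_coords algebra_simps)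
      then have "?p \<in> convex hull {\<zeta>, ?t, ?r}" using pr tp by (intro in_triangle)
      moreover have "{\<zeta>, ?t, ?r} \<subseteq> S - beam Y i"
        using ne assms(1-3,8,9) by (simp add: cherry_in centre_in cherry_in_beam_iff centre_notin_beam)
      ultimately show False
        using not_in_hull_of_other_beams[of i b] assms hull_mono by blast
    qed
  qed
  moreover have "\<sigma> * orient ?q ?p ?t > 0" using inside[of i l a b d] assms(1-9) by simp
  moreover have "\<sigma> * orient ?q ?p ?r < 0" using outside[of i j a b c] assms(1-9) by simp
  then have "\<sigma> * orient ?q ?r ?p > 0" by (simp add: orient_coords algebra_simps)
  ultimately have "?p \<in> convex hull {?q, ?r, ?t}" by (intro in_triangle)
  then show ?thesis
    using C by (rule not_extremal_if_in_triangle) (use assms(1-9) ne in \<open>simp add: cherry_eq_iff\<close>)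
qed

text \<open>The centre, lying on the inner side, replaces the third vertex of the preceding
  triangle.\<close>

lemma hidden_by_centre:
  assumes "i < k" "j < k" "B i j" "a < b" "b < 4" "c < 4" and C: "{Y i a, Y j c, \<zeta>} \<subseteq> C"
  shows "Y i b \<notin> extremal C"
proof -
  let ?q = "Y i a" and ?p = "Y i b" and ?r = "Y j c"
  have ne: "i \<noteq> j" using assms irrefl by blast
  have "\<sigma> * orient \<zeta> ?p ?r > 0" using turn[of i j b c] assms(1-6) by simp
  then have "\<sigma> * orient ?p ?r \<zeta> \<ge> 0" by (simp add: orient_rotate)
  moreover have "\<sigma> * orient ?q ?p \<zeta> > 0" using convex_centre[of i a b] assms(1-6) by simp
  moreover have "\<sigma> * orient ?q ?p ?r < 0" using outside[of i j a b c] assms(1-6) by simp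
  then have "\<sigma> * orient ?q ?r ?p > 0" by (simp add: orient_coords algebra_simps)
  ultimately have "?p \<in> convex hull {?q, ?r, \<zeta>}" by (intro in_triangle)
  then show ?thesis
    using C by (rule not_extremal_if_in_triangle) (use assms(1-6) ne in \<open>simp add: cherry_eq_iff cherry_neq_centre\<close>)
qed

text \<open>Here a cherry further in on the same beam is the third vertex.\<close>

lemma hidden_inside_beam:
  assumes "i < k" "j < k" "B i j" "a < b" "b < d" "d < 4" "c < 4"
    and C: "{Y i a, Y j c, Y i d} \<subseteq> C"
  shows "Y i b \<notin> extremal C"
proof -
  let ?q = "Y i a" and ?p = "Y i b" and ?r = "Y j c" and ?t = "Y i d"
  have ne: "i \<noteq> j" using assms irrefl by blast
  have "\<sigma> * orient ?p ?t ?r < 0" using outside[of i j b d c] assms(1-7) by simp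
  then have "\<sigma> * orient ?p ?r ?t \<ge> 0" by (simp add: orient_coords algebra_simps)
  moreover have "\<sigma> * orient ?q ?p ?t > 0" using convex[of i a b d] assms(1-7) by simp
  moreover have "\<sigma> * orient ?q ?p ?r < 0" using outside[of i j a b c] assms(1-7) by simp
  then have "\<sigma> * orient ?q ?r ?p > 0" by (simp add: orient_coords algebra_simps)
  ultimately have "?p \<in> convex hull {?q, ?r, ?t}" by (intro in_triangle)
  then show ?thesis
    using C by (rule not_extremal_if_in_triangle) (use assms(1-7) ne in \<open>simp add: cherry_eq_iff\<close>)
qed

section \<open>Half planes that expose a cherry\<close>

lemma exposed_if_no_outside:
  assumes C: "C \<subseteq> S" and "i < k" "b < 4" and b: "Y i b \<in> C"
    and none: "\<And>j c. j < k \<Longrightarrow> c < 4 \<Longrightarrow> Y j c \<in> C \<Longrightarrow> \<not> B i j"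
  shows "Y i b \<in> extremal C"
proof (cases "\<exists>a<b. Y i a \<in> C")
  case False
  then show ?thesis using outermost_extremal[OF C \<open>i < k\<close> \<open>b < 4\<close> b] by blast
next
  case True
  \<comment> \<open>All other remaining cherries have to be on the inner side of the line. Cherries
    of the beam between \<open>a\<close> and \<open>b\<close> would be on its outer side, so the
    nearest remaining one is chosen.\<close>
  define a where "a = Max {a. a < b \<and> Y i a \<in> C}"
  have "a \<in> {a. a < b \<and> Y i a \<in> C}" unfolding a_def using True by (intro Max_in) auto
  then have a: "a < b" "Y i a \<in> C" by auto
  have between: "c \<le> a" if "c < b" "Y i c \<in> C" for c
    unfolding a_def using that by (intro Max_ge) auto
  have "Y i b \<notin> convex hull (C - {Y i b})"
  proof (rule not_in_hull_of_one_side[where q = "Y i a" and s = \<sigma>])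
    show "Y i b \<noteq> Y i a" using a cherry_eq_iff[of i i b a] \<open>i < k\<close> \<open>b < 4\<close> by simp
    fix x assume x: "x \<in> C - {Y i b}"
    then have "x \<in> S" using C by blast
    then show "x = Y i a \<or> \<sigma> * orient (Y i a) (Y i b) x > 0"
    proof (cases rule: sun_cherriesE)
      case 1
      then show ?thesis using convex_centre[of i a b] a \<open>i < k\<close> \<open>b < 4\<close> by simp
    next
      case (2 j c)
      show ?thesis
      proof (cases "j = i")
        case False
        have "\<not> B i j" using none[of j c] 2 x by simp
        then have "B j i" using tournament[of i j] False 2 \<open>i < k\<close> by simp
        then show ?thesis using inside[of i j a b c] 2 a \<open>i < k\<close> \<open>b < 4\<close> by simp
      next
        case True
        then consider "c < a" | "c = a" | "b < c" using between[of c] x 2 by fastforce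
        then show ?thesis
        proof cases
          case 1
          then have "\<sigma> * orient (Y i c) (Y i a) (Y i b) > 0" using convex[of i c a b] a \<open>i < k\<close> \<open>b < 4\<close> by simp
          then show ?thesis using 2 True by (simp add: orient_rotate)
        next
          case 3
          then show ?thesis using convex[of i a b c] a \<open>i < k\<close> 2 True by simp
        qed (use 2 True in simp)
      qed
    qed
  qed
  then show ?thesis using b by (simp add: extremal_def)
qed

lemma innermost_exposed_if_no_inside:
  assumes C: "C \<subseteq> S" and "i < k" "b < 4" and b: "Y i b \<in> C" and z: "\<zeta> \<notin> C"
    and last: "\<And>c. b < c \<Longrightarrow> c < 4 \<Longrightarrow> Y i c \<notin> C"
    and none: "\<And>j c. j < k \<Longrightarrow> c < 4 \<Longrightarrow> Y j c \<in> C \<Longrightarrow> \<not> B j i"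
  shows "Y i b \<in> extremal C"
proof (cases "\<exists>a<b. Y i a \<in> C")
  case False
  then show ?thesis using outermost_extremal[OF C \<open>i < k\<close> \<open>b < 4\<close> b] by blast
next
  case True
  \<comment> \<open>All other remaining cherries now have to be on the outer side. For those of the
    same beam this means lying between \<open>a\<close> and \<open>b\<close>, so \<open>a\<close> is
    the outermost one.\<close>
  define a where "a = (LEAST a. Y i a \<in> C)"
  have a: "Y i a \<in> C" unfolding a_def using b by (rule LeastI)
  have first: "a \<le> c" if "Y i c \<in> C" for c
    unfolding a_def using that by (rule Least_le)
  then have ab: "a < b" using True le_less_trans by blast
  have "Y i b \<notin> convex hull (C - {Y i b})"
  proof (rule not_in_hull_of_one_side[where q = "Y i a" and s = "- \<sigma>"])
    show "Y i b \<noteq> Y i a" using ab cherry_eq_iff[of i i b a] \<open>i < k\<close> \<open>b < 4\<close> by simp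
    fix x assume x: "x \<in> C - {Y i b}"
    then have "x \<in> S" using C by blast
    then show "x = Y i a \<or> - \<sigma> * orient (Y i a) (Y i b) x > 0"
    proof (cases rule: sun_cherriesE)
      case 1
      then show ?thesis using z x by blast
    next
      case (2 j c)
      show ?thesis
      proof (cases "j = i")
        case False
        have "\<not> B j i" using none[of j c] 2 x by simp
        then have "B i j" using tournament[of i j] False 2 \<open>i < k\<close> by simp
        then show ?thesis using outside[of i j a b c] 2 ab \<open>i < k\<close> \<open>b < 4\<close> by simp
      next
        case True
        show ?thesis
        proof (cases "c = a")
          case False
          have "c \<noteq> b" "Y i c \<in> C" using x 2 True by auto
          then have "a < c" "c < b" using first[of c] last[of c] 2 False
            by (simp_all add: nat_less_le) (meson linorder_linear nat_less_le)
          then have "\<sigma> * orient (Y i a) (Y i c) (Y i b) > 0" using convex[of i a c b] \<open>i < k\<close> \<open>b < 4\<close> by simp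
          then show ?thesis using 2 True by (simp add: orient_coords algebra_simps)
        qed (use 2 True in simp)
      qed
    qed
  qed
  then show ?thesis using b by (simp add: extremal_def)
qed

text \<open>A line through an extremal centre leaves all beams on one side; turning it about the centre
  until it meets the last of them yields a beam with nothing on its outer side.\<close>

lemma centre_extremal:
  assumes C: "C \<subseteq> S" and z: "\<zeta> \<in> extremal C" and ne: "C \<noteq> {\<zeta>}"
  obtains i a where "i < k" "a < 4" "Y i a \<in> C" "\<And>j c. j < k \<Longrightarrow> c < 4 \<Longrightarrow> Y j c \<in> C \<Longrightarrow> \<not> B i j"
proof -
  let ?X = "C - {\<zeta>}"
  have fin: "finite ?X" using C finite_S finite_subset by blast
  have X: "?X \<noteq> {}" using z ne by (auto simp: extremal_def)
  have "\<zeta> \<notin> convex hull ?X" using z by (simp add: extremal_def)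
  moreover have "closed (convex hull ?X)"
    using fin finite_imp_compact_convex_hull compact_imp_closed by blast
  ultimately obtain n b where n: "n \<bullet> \<zeta> < b" "\<And>x. x \<in> convex hull ?X \<Longrightarrow> b < n \<bullet> x"
    using separating_hyperplane_closed_point[of "convex hull ?X" \<zeta>] by auto
  have pos: "n \<bullet> (x - \<zeta>) > 0" if "x \<in> ?X" for x
    using n(1) n(2)[OF hull_inc[OF that]] by (simp add: inner_diff_right)
  \<comment> \<open>Up to the sign \<sigma>, this is the tangent of the angle from \<open>n\<close>
    to \<open>x - \<zeta>\<close>; its maximum marks the last cherry met when turning about the
    centre.\<close>
  define f where "f x = \<sigma> * orient 0 n (x - \<zeta>) / (n \<bullet> (x - \<zeta>))" for x
  have "Max (f ` ?X) \<in> f ` ?X" using fin X by (intro Max_in) auto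
  then obtain x where x: "x \<in> ?X" "f x = Max (f ` ?X)" by (metis imageE)
  have max: "f w \<le> f x" if "w \<in> ?X" for w
    using that fin unfolding x(2) by simp
  obtain i a where ia: "i < k" "a < 4" "x = Y i a"
    using x(1) C sun_cherriesE[of x] by blast
  have "\<not> B i j" if jc: "j < k" "c < 4" "Y j c \<in> C" for j c
  proof
    assume B: "B i j"
    let ?w = "Y j c"
    have w: "?w \<in> ?X" using jc cherry_neq_centre by auto
    have "\<sigma> * orient 0 n (?w - \<zeta>) * (n \<bullet> (x - \<zeta>)) \<le> \<sigma> * orient 0 n (x - \<zeta>) * (n \<bullet> (?w - \<zeta>))"
      using max[OF w] pos[OF w] pos[OF x(1)] by (simp add: f_def field_simps)
    moreover have "(n \<bullet> n) * (\<sigma> * orient \<zeta> x ?w) =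
        \<sigma> * orient 0 n (?w - \<zeta>) * (n \<bullet> (x - \<zeta>)) - \<sigma> * orient 0 n (x - \<zeta>) * (n \<bullet> (?w - \<zeta>))"
      by (simp add: orient_coords inner_complex_def algebra_simps)
    moreover have "n \<bullet> n > 0" using pos[OF x(1)] by (cases "n = 0") auto
    moreover have "\<sigma> * orient \<zeta> x ?w > 0" using turn[of i j a c] B ia jc by simp
    ultimately show False by (metis diff_gt_0_iff_gt linorder_not_less mult_pos_pos)
  qed
  then show ?thesis using that ia x by blast
qed

section \<open>Playing on a sun\<close>

definition cherries :: "complex set \<Rightarrow> nat \<Rightarrow> nat set" where
  "cherries C i = {a. i < k \<and> a < 4 \<and> Y i a \<in> C}"

lemma cherries_remove:
  assumes "i < k" "a < 4"
  shows "cherries (C - {Y i a}) = remove (cherries C) i a"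
proof
  fix j
  show "cherries (C - {Y i a}) j = remove (cherries C) i a j"
    using assms cherry_eq_iff[of j i _ a] by (cases "j = i") (auto simp: cherries_def)
qed

lemma cherries_remove_centre: "cherries (C - {\<zeta>}) = cherries C"
  using cherry_neq_centre by (auto simp: cherries_def fun_eq_iff)

lemma active_cherries: "j \<in> active (cherries C) \<longleftrightarrow> j < k \<and> (\<exists>c<4. Y j c \<in> C)"
  by (auto simp: active_def cherries_def)

lemma exposed_imp_extremal:
  assumes C: "C \<subseteq> S" and e: "exposed (cherries C) (\<zeta> \<in> C) i a"
  shows "Y i a \<in> extremal C"
proof -
  have a: "i < k" "a < 4" "Y i a \<in> C" using exposed_active(3)[OF e] by (auto simp: cherries_def)
  consider "\<forall>b\<in>cherries C i. a \<le> b" | "first (cherries C) i"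
    | "last (cherries C) i" "\<zeta> \<notin> C" "\<forall>b\<in>cherries C i. b \<le> a"
    using e unfolding exposed_def by blast
  then show ?thesis
  proof cases
    case 1
    have "Y i b \<notin> C" if "b < a" for b
    proof
      assume "Y i b \<in> C"
      then have "b \<in> cherries C i" using that a by (simp add: cherries_def)
      then show False using 1 that by fastforce
    qed
    then show ?thesis using outermost_extremal[OF C a] by blast
  next
    case 2
    have "\<not> B i j" if "j < k" "c < 4" "Y j c \<in> C" for j c
      using 2 that active_cherries[of j C] unfolding first_def by blast
    then show ?thesis using exposed_if_no_outside[OF C a] by blast
  next
    case 3
    have "\<not> B j i" if "j < k" "c < 4" "Y j c \<in> C" for j c
      using 3 that active_cherries[of j C] unfolding last_def by blast
    moreover have "Y i c \<notin> C" if "a < c" "c < 4" for c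
      using 3(3) that a by (auto simp: cherries_def)
    ultimately show ?thesis using innermost_exposed_if_no_inside[OF C a 3(2)] by blast
  qed
qed

text \<open>An unexposed cherry has another one further out in its beam and an active beam on its
  outer side. The condition that fails at the other end supplies the third vertex of a triangle
  around it: a beam on the inner side, the centre, or a cherry further in.\<close>

lemma extremal_imp_exposed:
  assumes C: "C \<subseteq> S" and a: "i < k" "a < 4" and e: "Y i a \<in> extremal C"
  shows "exposed (cherries C) (\<zeta> \<in> C) i a"
proof (rule ccontr)
  let ?N = "cherries C"
  assume ne: "\<not> exposed ?N (\<zeta> \<in> C) i a"
  have aC: "Y i a \<in> C" using e by (simp add: extremal_def)
  then have aN: "a \<in> ?N i" using a by (simp add: cherries_def)
  have act: "i \<in> active ?N" using active_cherries a aC by blast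
  obtain b where b: "b \<in> ?N i" "b < a"
    using ne aN a(1) unfolding exposed_def by (meson linorder_not_less)
  then have bC: "Y i b \<in> C" "b < 4" by (auto simp: cherries_def)
  have "\<not> first ?N i" using ne aN a(1) unfolding exposed_def by blast
  then obtain j c where j: "j < k" "c < 4" "Y j c \<in> C" "B i j"
    using act active_cherries unfolding first_def by metis
  show False
  proof (cases "last ?N i")
    case False
    then obtain l d where l: "l < k" "d < 4" "Y l d \<in> C" "B l i"
      using act active_cherries unfolding last_def by metis
    have "Y i a \<notin> extremal C"
      using hidden_between_beams[OF a(1) j(1) l(1) j(4) l(4) b(2) a(2) j(2) l(2)] bC(1) j(3) l(3) by blast
    then show False using e by blast
  next
    case True
    show False
    proof (cases "\<zeta> \<in> C")
      case z: True
      have "Y i a \<notin> extremal C"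
        using hidden_by_centre[OF a(1) j(1,4) b(2) a(2) j(2)] bC(1) j(3) z by blast
      then show False using e by blast
    next
      case False
      then obtain d where d: "d \<in> ?N i" "a < d"
        using ne aN a(1) True unfolding exposed_def by (meson linorder_not_less)
      then have dC: "Y i d \<in> C" "d < 4" by (auto simp: cherries_def)
      have "Y i a \<notin> extremal C"
        using hidden_inside_beam[OF a(1) j(1,4) b(2) d(2) dC(2) j(2)] bC(1) j(3) dC(1) by blast
      then show False using e by blast
    qed
  qed
qed

lemma extremal_iff_exposed:
  assumes "C \<subseteq> S" "i < k" "a < 4"
  shows "Y i a \<in> extremal C \<longleftrightarrow> exposed (cherries C) (\<zeta> \<in> C) i a"
  using exposed_imp_extremal extremal_imp_exposed assms by blast

lemma inactive_imp_centre:
  assumes "C \<subseteq> S" "active (cherries C) = {}"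
  shows "C \<subseteq> {\<zeta>}"
proof
  fix x assume x: "x \<in> C"
  then have "x \<in> S" using assms(1) by blast
  then show "x \<in> {\<zeta>}"
  proof (cases rule: sun_cherriesE)
    case (2 i a)
    then have "i \<in> active (cherries C)" using active_cherries x by blast
    then show ?thesis using assms(2) by blast
  qed simp
qed

lemma extremal_alice_move:
  assumes C: "C \<subseteq> S" and x: "x \<in> extremal C"
  shows "alice_move (cherries C) (\<zeta> \<in> C) (cherries (C - {x})) (\<zeta> \<in> C - {x})"
proof -
  have "x \<in> C" using x by (simp add: extremal_def)
  then have "x \<in> S" using C by blast
  then show ?thesis
  proof (cases rule: sun_cherriesE)
    case 1
    have "active (cherries C) = {} \<or> (\<exists>l. first (cherries C) l)"
    proof (cases "C = {\<zeta>}")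
      case True
      then show ?thesis using cherry_neq_centre by (auto simp: active_def cherries_def)
    next
      case False
      obtain i a where ia: "i < k" "a < 4" "Y i a \<in> C"
          "\<And>j c. j < k \<Longrightarrow> c < 4 \<Longrightarrow> Y j c \<in> C \<Longrightarrow> \<not> B i j"
        using centre_extremal[OF C x[unfolded 1] False] by blast
      have "first (cherries C) i"
        unfolding first_def using ia active_cherries by blast
      then show ?thesis by blast
    qed
    then show ?thesis
      using 1 \<open>x \<in> C\<close> cherries_remove_centre[of C] unfolding alice_move_def by auto
  next
    case (2 i a)
    have "exposed (cherries C) (\<zeta> \<in> C) i a"
      using extremal_imp_exposed[OF C] 2 x by blast
    moreover have "\<zeta> \<in> C - {x} \<longleftrightarrow> \<zeta> \<in> C" using 2 cherry_neq_centre[of i a] by auto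
    ultimately show ?thesis
      using cherries_remove[of i a C] 2 unfolding alice_move_def by auto
  qed
qed

section \<open>Careful greedy play as an abstract move\<close>

lemma red_iff: "i < k \<Longrightarrow> a < 4 \<Longrightarrow> Y i a \<in> sun_red k Y \<longleftrightarrow> a \<in> reds"
  unfolding sun_red_def using cherry_eq_iff[of i _ a 1] cherry_eq_iff[of i _ a 3] by auto

lemma beam_slices:
  assumes C: "C \<subseteq> S" and i: "i < k"
  shows "beam Y i \<inter> extremal C \<inter> sun_red k Y = Y i ` {a \<in> reds. exposed (cherries C) (\<zeta> \<in> C) i a}"
    and "beam Y i \<inter> C \<inter> sun_red k Y - extremal C =
      Y i ` {a \<in> reds. a \<in> cherries C i \<and> \<not> exposed (cherries C) (\<zeta> \<in> C) i a}"
    and "beam Y i \<inter> C \<inter> sun_red k Y = Y i ` (cherries C i \<inter> reds)"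
    and "beam Y i \<inter> C - sun_red k Y = Y i ` (cherries C i - reds)"
    and "beam Y i \<inter> extremal C - sun_red k Y = Y i ` {a. a \<notin> reds \<and> exposed (cherries C) (\<zeta> \<in> C) i a}"
proof -
  have slice: "beam Y i \<inter> P = Y i ` Q" if "\<And>a. a < 4 \<Longrightarrow> Y i a \<in> P \<longleftrightarrow> a \<in> Q" "\<And>a. a \<in> Q \<Longrightarrow> a < 4" for P Q
  proof (intro equalityI subsetI)
    fix x assume "x \<in> beam Y i \<inter> P"
    then obtain a where "a < 4" "x = Y i a" "x \<in> P" by (auto simp: beam_def)
    then show "x \<in> Y i ` Q" using that(1)[of a] by blast
  next
    fix x assume "x \<in> Y i ` Q"
    then obtain a where "a \<in> Q" "x = Y i a" by blast
    then show "x \<in> beam Y i \<inter> P" using that(1)[of a] that(2)[of a] by (simp add: beam_def)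
  qed
  have ex4: "a < 4" if "exposed (cherries C) (\<zeta> \<in> C) i a" for a
    using exposed_active(3)[OF that] by (simp add: cherries_def)
  have mem: "a \<in> cherries C i \<longleftrightarrow> a < 4 \<and> Y i a \<in> C" for a using i by (simp add: cherries_def)
  note facts = red_iff[OF i] extremal_iff_exposed[OF C i] mem
  have 1: "beam Y i \<inter> (extremal C \<inter> sun_red k Y) = Y i ` {a \<in> reds. exposed (cherries C) (\<zeta> \<in> C) i a}"
    by (rule slice) (auto simp: facts dest: ex4)
  have 2: "beam Y i \<inter> (C \<inter> sun_red k Y - extremal C) =
      Y i ` {a \<in> reds. a \<in> cherries C i \<and> \<not> exposed (cherries C) (\<zeta> \<in> C) i a}"
    by (rule slice) (auto simp: facts dest: ex4)
  have 3: "beam Y i \<inter> (C \<inter> sun_red k Y) = Y i ` (cherries C i \<inter> reds)"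
    by (rule slice) (auto simp: facts dest: ex4)
  have 4: "beam Y i \<inter> (C - sun_red k Y) = Y i ` (cherries C i - reds)"
    by (rule slice) (auto simp: facts dest: ex4)
  have 5: "beam Y i \<inter> (extremal C - sun_red k Y) = Y i ` {a. a \<notin> reds \<and> exposed (cherries C) (\<zeta> \<in> C) i a}"
    by (rule slice) (auto simp: facts dest: ex4)
  show "beam Y i \<inter> extremal C \<inter> sun_red k Y = Y i ` {a \<in> reds. exposed (cherries C) (\<zeta> \<in> C) i a}"
    using 1 by (simp only: Int_assoc)
  show "beam Y i \<inter> C \<inter> sun_red k Y - extremal C =
      Y i ` {a \<in> reds. a \<in> cherries C i \<and> \<not> exposed (cherries C) (\<zeta> \<in> C) i a}"
    using 2 by (simp only: Int_assoc Int_Diff)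
  show "beam Y i \<inter> C \<inter> sun_red k Y = Y i ` (cherries C i \<inter> reds)"
    using 3 by (simp only: Int_assoc)
  show "beam Y i \<inter> C - sun_red k Y = Y i ` (cherries C i - reds)"
    using 4 by (simp only: Int_Diff)
  show "beam Y i \<inter> extremal C - sun_red k Y = Y i ` {a. a \<notin> reds \<and> exposed (cherries C) (\<zeta> \<in> C) i a}"
    using 5 by (simp only: Int_Diff)
qed

lemma extremal_red:
  assumes "C \<subseteq> S" "c \<in> extremal C \<inter> sun_red k Y"
  obtains i a where "i < k" "a \<in> reds" "c = Y i a" "exposed (cherries C) (\<zeta> \<in> C) i a"
proof -
  obtain i where i: "i < k" "c \<in> beam Y i"
    using assms(2) by (auto simp: sun_red_def beam_def)
  then have "c \<in> Y i ` {a \<in> reds. exposed (cherries C) (\<zeta> \<in> C) i a}"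
    using beam_slices(1)[OF assms(1) i(1)] assms(2) by blast
  then show ?thesis using that i(1) by blast
qed

text \<open>In the second claim, the absence of hidden pairs makes the exposed reds of a beam, if
  there are any, all its remaining reds. Thus a count of one describes a lone red.\<close>

lemma careful_greedy_sets:
  fixes C
  assumes C: "C \<subseteq> S"
  defines "N \<equiv> cherries C" and "z \<equiv> \<zeta> \<in> C"
  shows "{i. i < k \<and> beam Y i \<inter> extremal C \<inter> sun_red k Y \<noteq> {} \<and>
      beam Y i \<inter> C \<inter> sun_red k Y - extremal C \<noteq> {}} = {i. hides N z i}"
    and "i < k \<Longrightarrow> \<nexists>j. hides N z j \<Longrightarrow>
      card (beam Y i \<inter> extremal C \<inter> sun_red k Y) = 1 \<longleftrightarrow> (\<exists>a. lone_red N z i a)"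
    and "{i. i < k \<and> beam Y i \<inter> C - sun_red k Y \<noteq> {} \<and> beam Y i \<inter> C \<inter> sun_red k Y = {}} =
      {i \<in> active N. N i \<inter> reds = {}}"
    and "extremal C \<inter> sun_red k Y = {} \<longleftrightarrow> (\<nexists>i a. a \<in> reds \<and> exposed N z i a)"
proof -
  have hk: "i < k" if "hides N z i" for i using that exposed_active(2) unfolding hides_def by blast
  have "(i < k \<and> beam Y i \<inter> extremal C \<inter> sun_red k Y \<noteq> {} \<and>
      beam Y i \<inter> C \<inter> sun_red k Y - extremal C \<noteq> {}) \<longleftrightarrow> hides N z i" for i
  proof (cases "i < k")
    case True
    show ?thesis
      unfolding beam_slices(1,2)[OF C True] hides_def N_def z_def image_is_empty using True by blast
  qed (use hk in blast)
  then show "{i. i < k \<and> beam Y i \<inter> extremal C \<inter> sun_red k Y \<noteq> {} \<and>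
      beam Y i \<inter> C \<inter> sun_red k Y - extremal C \<noteq> {}} = {i. hides N z i}" by (rule Collect_cong)
  have "(i < k \<and> beam Y i \<inter> C - sun_red k Y \<noteq> {} \<and> beam Y i \<inter> C \<inter> sun_red k Y = {}) \<longleftrightarrow>
      i \<in> active N \<and> N i \<inter> reds = {}" for i
  proof (cases "i < k")
    case True
    show ?thesis
      unfolding beam_slices(3,4)[OF C True] N_def image_is_empty active_def mem_Collect_eq
      using True by blast
  qed (simp add: active_def)
  then show "{i. i < k \<and> beam Y i \<inter> C - sun_red k Y \<noteq> {} \<and> beam Y i \<inter> C \<inter> sun_red k Y = {}} =
      {i \<in> active N. N i \<inter> reds = {}}" by (rule Collect_cong)
  show "extremal C \<inter> sun_red k Y = {} \<longleftrightarrow> (\<nexists>i a. a \<in> reds \<and> exposed N z i a)"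
  proof
    assume "extremal C \<inter> sun_red k Y = {}"
    then show "\<nexists>i a. a \<in> reds \<and> exposed N z i a"
      using beam_slices(1)[OF C] exposed_active(2) unfolding N_def z_def by blast
  next
    assume none: "\<nexists>i a. a \<in> reds \<and> exposed N z i a"
    show "extremal C \<inter> sun_red k Y = {}"
    proof (rule ccontr)
      assume "extremal C \<inter> sun_red k Y \<noteq> {}"
      then obtain c where "c \<in> extremal C \<inter> sun_red k Y" by blast
      then show False using extremal_red[OF C] none unfolding N_def z_def by metis
    qed
  qed
  show "card (beam Y i \<inter> extremal C \<inter> sun_red k Y) = 1 \<longleftrightarrow> (\<exists>a. lone_red N z i a)"
    if i: "i < k" and nh: "\<nexists>j. hides N z j"
  proof -
    let ?R = "{a \<in> reds. exposed N z i a}"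
    have "inj_on (Y i) ?R"
    proof (rule inj_onI)
      fix a b assume "a \<in> ?R" "b \<in> ?R" and eq: "Y i a = Y i b"
      then have "a < 4" "b < 4" by auto
      then show "a = b" using cherry_eq_iff[OF i i] eq by blast
    qed
    then have "card (beam Y i \<inter> extremal C \<inter> sun_red k Y) = card ?R"
      unfolding beam_slices(1)[OF C i] N_def z_def by (rule card_image)
    moreover have "card ?R = 1 \<longleftrightarrow> (\<exists>a. ?R = {a})" using card_1_singleton_iff[of ?R] by simp
    moreover have "?R = {a} \<longleftrightarrow> lone_red N z i a" for a
    proof
      assume R: "?R = {a}"
      then have a: "a \<in> reds" "exposed N z i a" by blast+
      then have "exposed N z i b" if "b \<in> reds" "b \<in> N i" for b
        using nh that unfolding hides_def by blast
      then have "N i \<inter> reds = ?R" using exposed_active(3) by blast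
      then show "lone_red N z i a" using a R unfolding lone_red_def by blast
    next
      assume "lone_red N z i a"
      then show "?R = {a}" using exposed_active(3) unfolding lone_red_def by blast
    qed
    ultimately show ?thesis by simp
  qed
qed

lemma careful_greedy_eq:
  fixes C
  assumes C: "C \<subseteq> S"
  defines "N \<equiv> cherries C" and "z \<equiv> \<zeta> \<in> C"
  shows "careful_greedy k Y C =
    (if \<exists>i. \<exists>a\<in>reds. exposed N z i a then
       (if \<exists>j. hides N z j then \<Union>i\<in>{i. hides N z i}. beam Y i \<inter> extremal C \<inter> sun_red k Y
        else if \<exists>i a. lone_red N z i a
          then \<Union>i\<in>{i. \<exists>a. lone_red N z i a}. beam Y i \<inter> extremal C \<inter> sun_red k Y
        else extremal C \<inter> sun_red k Y)
     else \<Union>i\<in>{i \<in> active N. N i \<inter> reds = {}}. beam Y i \<inter> extremal C - sun_red k Y)"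
proof -
  note sets = careful_greedy_sets[OF C, folded N_def z_def]
  have lk: "i < k" if "lone_red N z i a" for i a
    using that exposed_active(2) unfolding lone_red_def by blast
  have single: "{i. i < k \<and> card (beam Y i \<inter> extremal C \<inter> sun_red k Y) = 1} = {i. \<exists>a. lone_red N z i a}"
    if "\<nexists>j. hides N z j"
    using sets(2)[OF _ that] lk by blast
  have e: "extremal C \<inter> sun_red k Y \<noteq> {} \<longleftrightarrow> (\<exists>i. \<exists>a\<in>reds. exposed N z i a)"
    using sets(4) by blast
  have h: "{i. hides N z i} \<noteq> {} \<longleftrightarrow> (\<exists>j. hides N z j)" by blast
  show ?thesis
  proof (cases "\<exists>j. hides N z j")
    case True
    then show ?thesis unfolding careful_greedy_def Let_def sets(1,3) e h by simp
  next
    case False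
    have l: "{i. \<exists>a. lone_red N z i a} \<noteq> {} \<longleftrightarrow> (\<exists>i a. lone_red N z i a)" by blast
    show ?thesis unfolding careful_greedy_def Let_def sets(1,3) single[OF False] e h l
      using False by simp
  qed
qed

lemma careful_greedy_extremal:
  assumes "C \<subseteq> S"
  shows "careful_greedy k Y C \<subseteq> extremal C"
  unfolding careful_greedy_eq[OF assms] by (auto split: if_splits)

lemma careful_greedy_bob_move:
  assumes C: "C \<subseteq> S" and c: "c \<in> careful_greedy k Y C"
  obtains i a where "i < k" "a < 4" "c = Y i a" "bob_move (cherries C) (\<zeta> \<in> C) i a"
proof -
  let ?N = "cherries C" and ?z = "\<zeta> \<in> C"
  have lt: "i < k \<and> a < 4" if "exposed ?N ?z i a" for i a
    using exposed_active(2,3)[OF that] by (simp add: cherries_def)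
  have no_red: "\<not> hides ?N ?z j \<and> \<not> lone_red ?N ?z j b" if "\<not> (\<exists>i. \<exists>a\<in>reds. exposed ?N ?z i a)" for j b
    using that lone_redD[of ?N ?z j b] unfolding hides_def lone_red_def by blast
  have red: "\<exists>a\<in>reds. exposed ?N ?z i a \<and> c = Y i a"
    if "i < k" "c \<in> beam Y i \<inter> extremal C \<inter> sun_red k Y" for i
    using that(2) unfolding beam_slices(1)[OF C that(1)] by blast
  consider (hide) i where "i < k" "hides ?N ?z i" "c \<in> beam Y i \<inter> extremal C \<inter> sun_red k Y"
    | (lone) i b where "\<nexists>j. hides ?N ?z j" "lone_red ?N ?z i b" "c \<in> beam Y i \<inter> extremal C \<inter> sun_red k Y"
    | (double) "\<nexists>j. hides ?N ?z j" "\<nexists>i b. lone_red ?N ?z i b" "c \<in> extremal C \<inter> sun_red k Y"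
    | (green) i where "\<not> (\<exists>i. \<exists>a\<in>reds. exposed ?N ?z i a)" "i \<in> active ?N" "?N i \<inter> reds = {}"
        "c \<in> beam Y i \<inter> extremal C - sun_red k Y"
  proof -
    let ?red = "\<exists>i. \<exists>a\<in>reds. exposed ?N ?z i a"
    note eq = c[unfolded careful_greedy_eq[OF C]]
    show thesis
    proof (cases ?red)
      case False
      then have "c \<in> (\<Union>i\<in>{i \<in> active ?N. ?N i \<inter> reds = {}}. beam Y i \<inter> extremal C - sun_red k Y)"
        using eq by (simp only: if_False)
      then show thesis using that(4) False by blast
    next
      case red: True
      show thesis
      proof (cases "\<exists>j. hides ?N ?z j")
        case True
        then have "c \<in> (\<Union>i\<in>{i. hides ?N ?z i}. beam Y i \<inter> extremal C \<inter> sun_red k Y)"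
          using eq red by (simp only: if_True)
        then obtain i where i: "hides ?N ?z i" "c \<in> beam Y i \<inter> extremal C \<inter> sun_red k Y" by blast
        then show thesis using that(1) lt unfolding hides_def by blast
      next
        case nh: False
        show thesis
        proof (cases "\<exists>i a. lone_red ?N ?z i a")
          case True
          then have "c \<in> (\<Union>i\<in>{i. \<exists>a. lone_red ?N ?z i a}. beam Y i \<inter> extremal C \<inter> sun_red k Y)"
            using eq red nh by (simp only: if_True if_False)
          then show thesis using that(2)[OF nh] by blast
        next
          case False
          then have "c \<in> extremal C \<inter> sun_red k Y"
            using eq red nh by (simp only: if_True if_False)
          then show thesis using that(3)[OF nh False] by blast
        qed
      qed
    qed
  qed
  then show ?thesis
  proof cases
    case hide
    obtain a where a: "a \<in> reds" "exposed ?N ?z i a" "c = Y i a" using red hide by blast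
    have "bob_move ?N ?z i a" using a hide(2) unfolding bob_move_def by auto
    then show ?thesis using that lt[OF a(2)] a by blast
  next
    case lone
    have b: "exposed ?N ?z i b" "?N i \<inter> reds = {b}" using lone(2) by (auto simp: lone_red_def)
    have i: "i < k" using lt b(1) by blast
    obtain a where a: "a \<in> reds" "exposed ?N ?z i a" "c = Y i a" using red i lone(3) by blast
    have "a = b" using a exposed_active(3)[OF a(2)] b(2) by blast
    then have "bob_move ?N ?z i a" using lone(1,2) a unfolding bob_move_def by simp
    then show ?thesis using that lt[OF a(2)] a by blast
  next
    case double
    obtain i a where a: "i < k" "a \<in> reds" "c = Y i a" "exposed ?N ?z i a"
      using extremal_red[OF C double(3)] by blast
    then have "bob_move ?N ?z i a" using double(1,2) unfolding bob_move_def by simp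
    then show ?thesis using that lt[OF a(4)] a by blast
  next
    case green
    have i: "i < k" using green(2) by (simp add: active_def)
    obtain a where a: "exposed ?N ?z i a" "c = Y i a"
      using green(4) unfolding beam_slices(5)[OF C i] by blast
    have "bob_move ?N ?z i a"
      using a(1) green(3) no_red[OF green(1)] unfolding bob_move_def by simp
    then show ?thesis using that lt[OF a(1)] a by blast
  qed
qed

lemma active_exposed:
  assumes "i \<in> active N"
  obtains a where "exposed N z i a"
proof -
  have "N i \<noteq> {}" "i < k" using assms by (auto simp: active_def)
  then obtain a where "a \<in> N i" by blast
  then have "(LEAST a. a \<in> N i) \<in> N i" by (rule LeastI)
  then have "exposed N z i (LEAST a. a \<in> N i)"
    using \<open>i < k\<close> Least_le[of "\<lambda>a. a \<in> N i"] unfolding exposed_def by blast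
  then show ?thesis using that by blast
qed

text \<open>Failure is possible only when no red is extremal; then \<open>bob_not_stuck\<close>
  yields a redless active beam, and its outermost cherry is an admissible green.\<close>

lemma careful_greedy_nonempty:
  assumes C: "C \<subseteq> S" and good: "good_bob (cherries C) (\<zeta> \<in> C) b" and act: "active (cherries C) \<noteq> {}"
  shows "careful_greedy k Y C \<noteq> {}"
proof -
  let ?N = "cherries C" and ?z = "\<zeta> \<in> C"
  have ne: "beam Y i \<inter> extremal C \<inter> sun_red k Y \<noteq> {}" if "a \<in> reds" "exposed ?N ?z i a" for i a
  proof -
    have "Y i a \<in> Y i ` {a \<in> reds. exposed ?N ?z i a}" using that by blast
    then show ?thesis using beam_slices(1)[OF C exposed_active(2)[OF that(2)]] by blast
  qed
  have UN_nonempty: "(\<Union>i\<in>I. X i) \<noteq> {}" if "X i \<noteq> {}" "i \<in> I" for X :: "nat \<Rightarrow> complex set" and i I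
    using that by blast
  show ?thesis
  proof (cases "\<exists>i. \<exists>a\<in>reds. exposed ?N ?z i a")
    case True
    show ?thesis
    proof (cases "\<exists>j. hides ?N ?z j")
      case h: True
      then obtain i where i: "hides ?N ?z i" ..
      then obtain a where "a \<in> reds" "exposed ?N ?z i a" unfolding hides_def by blast
      then have "beam Y i \<inter> extremal C \<inter> sun_red k Y \<noteq> {}" by (rule ne)
      with i show ?thesis
        unfolding careful_greedy_eq[OF C] if_P[OF True] if_P[OF h] by (intro UN_nonempty) simp_all
    next
      case h: False
      show ?thesis
      proof (cases "\<exists>i a. lone_red ?N ?z i a")
        case l: True
        then obtain i a where i: "lone_red ?N ?z i a" by blast
        then have "a \<in> reds" "exposed ?N ?z i a" using lone_redD[OF i] unfolding lone_red_def by blast+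
        then have "beam Y i \<inter> extremal C \<inter> sun_red k Y \<noteq> {}" by (rule ne)
        moreover have "i \<in> {i. \<exists>a. lone_red ?N ?z i a}" using i by blast
        ultimately show ?thesis
          unfolding careful_greedy_eq[OF C] if_P[OF True] if_not_P[OF h] if_P[OF l]
          by (intro UN_nonempty)
      next
        case l: False
        obtain i a where "a \<in> reds" "exposed ?N ?z i a" using True by blast
        then have "beam Y i \<inter> extremal C \<inter> sun_red k Y \<noteq> {}" by (rule ne)
        then have "extremal C \<inter> sun_red k Y \<noteq> {}" by blast
        then show ?thesis
          unfolding careful_greedy_eq[OF C] if_P[OF True] if_not_P[OF h] if_not_P[OF l] .
      qed
    qed
  next
    case False
    then obtain i where i: "i \<in> active ?N" "?N i \<inter> reds = {}" using bob_not_stuck[OF good act] by blast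
    obtain a where a: "exposed ?N ?z i a" using active_exposed[OF i(1)] by blast
    then have "a \<notin> reds" using False by blast
    then have "Y i a \<in> Y i ` {a. a \<notin> reds \<and> exposed ?N ?z i a}" using a by blast
    then have "beam Y i \<inter> extremal C - sun_red k Y \<noteq> {}"
      using beam_slices(5)[OF C exposed_active(2)[OF a]] by blast
    moreover have "i \<in> {i \<in> active ?N. ?N i \<inter> reds = {}}" using i by blast
    ultimately show ?thesis
      unfolding careful_greedy_eq[OF C] if_not_P[OF False] by (intro UN_nonempty)
  qed
qed

lemma extremal_nonempty:
  assumes C: "C \<subseteq> S" and "C \<noteq> {}"
  shows "extremal C \<noteq> {}"
proof (cases "active (cherries C) = {}")
  case True
  then have "C = {\<zeta>}" using inactive_imp_centre[OF C] assms(2) by blast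
  then show ?thesis by (simp add: extremal_def)
next
  case False
  then obtain i a where "exposed (cherries C) (\<zeta> \<in> C) i a" using active_exposed by blast
  then show ?thesis using exposed_imp_extremal[OF C] by blast
qed

section \<open>Numbers of cherries\<close>

lemma Union_beam_image: "(\<Union>i<k. Y i ` A) = (\<lambda>(i, j). Y i j) ` ({..<k} \<times> A)"
proof (intro equalityI subsetI)
  fix x assume "x \<in> (\<Union>i<k. Y i ` A)"
  then obtain i j where "(i, j) \<in> {..<k} \<times> A" "x = Y i j" by blast
  then show "x \<in> (\<lambda>(i, j). Y i j) ` ({..<k} \<times> A)" by (metis image_eqI case_prod_conv)
qed auto

lemma inj_cherry: "A \<subseteq> {..<4} \<Longrightarrow> inj_on (\<lambda>(i, j). Y i j) ({..<k} \<times> A)"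
proof -
  have "inj_on (\<lambda>(i, j). Y i j) ({..<k} \<times> {..<4})"
    using sun unfolding sun_def by (elim conjE)
  then show "A \<subseteq> {..<4} \<Longrightarrow> inj_on (\<lambda>(i, j). Y i j) ({..<k} \<times> A)"
    by (rule inj_on_subset) blast
qed

lemma card_Union_beam_image:
  assumes "A \<subseteq> {..<4}"
  shows "card (\<Union>i<k. Y i ` A) = k * card A"
  unfolding Union_beam_image card_image[OF inj_cherry[OF assms]] by (simp add: card_cartesian_product)

lemma card_S: "card S = 4 * k + 1"
proof -
  have "\<zeta> \<notin> (\<Union>i<k. Y i ` {..<4})" using cherry_neq_centre by blast
  then show ?thesis
    unfolding sun_cherries_def beam_def using card_Union_beam_image[of "{..<4}"] by simp
qed

lemma num_red_S: "num_red (sun_red k Y) S = 2 * k"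
proof -
  have red: "sun_red k Y = (\<Union>i<k. Y i ` reds)" unfolding sun_red_def by simp
  have "sun_red k Y \<subseteq> S"
  proof
    fix x assume "x \<in> sun_red k Y"
    then obtain i a where "i < k" "a \<in> reds" "x = Y i a" unfolding red by blast
    then show "x \<in> S" using cherry_in[of i a] by auto
  qed
  then have "S \<inter> sun_red k Y = (\<Union>i<k. Y i ` reds)" using red by blast
  moreover have "card (\<Union>i<k. Y i ` reds) = k * card reds" by (rule card_Union_beam_image) simp
  moreover have "card reds = 2" by simp
  ultimately show ?thesis unfolding num_red_def by simp
qed

section \<open>From plays to the minimax value\<close>

lemma legal_play_snoc:
  "legal_play C (xs @ [x]) \<longleftrightarrow> legal_play C xs \<and> x \<in> extremal (C - set xs)"
  by (auto simp: legal_play_def nth_append less_Suc_eq)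

lemma bob_follows_snoc:
  "bob_follows strat C (xs @ [x]) \<longleftrightarrow>
    bob_follows strat C xs \<and> (odd (length xs) \<longrightarrow> x \<in> strat (C - set xs))"
  by (auto simp: bob_follows_def nth_append less_Suc_eq)

lemma bob_score_snoc:
  "bob_score red (xs @ [x]) = bob_score red xs + of_bool (odd (length xs) \<and> x \<in> red)"
proof -
  have eq: "{n. n < length (xs @ [x]) \<and> odd n \<and> (xs @ [x]) ! n \<in> red} =
    {n. n < length xs \<and> odd n \<and> xs ! n \<in> red} \<union>
    (if odd (length xs) \<and> x \<in> red then {length xs} else {})"
    by (auto simp: nth_append less_Suc_eq)
  show ?thesis unfolding bob_score_def eq by (subst card_Un_disjoint) auto
qed

text \<open>The second conjunct ties the number of remaining cherries to the number of moves; the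
  parity argument for the centre rests on it.\<close>

lemma play_good:
  assumes "legal_play S xs" "bob_follows (careful_greedy k Y) S xs"
  shows "(if even (length xs) then good_alice else good_bob)
      (cherries (S - set xs)) (\<zeta> \<in> S - set xs) (bob_score (sun_red k Y) xs) \<and>
    card (S - set xs) + length xs = 4 * k + 1"
  using assms
proof (induction xs rule: rev_induct)
  case Nil
  have "cherries S i = {..<4}" if "i < k" for i
    using that cherry_in by (auto simp: cherries_def)
  then have "good_alice (cherries S) True 0" using good_alice_initial by blast
  then show ?case using card_S centre_in by (simp add: bob_score_def)
next
  case (snoc x xs)
  let ?C = "S - set xs"
  have C: "?C \<subseteq> S" by blast
  have C': "S - set (xs @ [x]) = ?C - {x}" by auto
  have x: "x \<in> extremal ?C" and legal: "legal_play S xs" "bob_follows (careful_greedy k Y) S xs"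
    and greedy: "odd (length xs) \<Longrightarrow> x \<in> careful_greedy k Y ?C"
    using snoc.prems unfolding legal_play_snoc bob_follows_snoc by blast+
  note IH = snoc.IH[OF legal]
  have "x \<in> ?C" using x by (simp add: extremal_def)
  then have "card (?C - {x}) + length (xs @ [x]) = 4 * k + 1"
    using IH card_Suc_Diff1[of ?C x] finite_S by simp
  moreover have "(if even (length (xs @ [x])) then good_alice else good_bob)
      (cherries (?C - {x})) (\<zeta> \<in> ?C - {x}) (bob_score (sun_red k Y) (xs @ [x]))"
  proof (cases "even (length xs)")
    case True
    then show ?thesis
      using IH alice_step[OF _ extremal_alice_move[OF C x]] by (simp add: bob_score_snoc)
  next
    case False
    obtain i a where ia: "i < k" "a < 4" "x = Y i a" "bob_move (cherries ?C) (\<zeta> \<in> ?C) i a"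
      using careful_greedy_bob_move[OF C greedy[OF False]] by blast
    have "\<zeta> \<in> ?C - {x} \<longleftrightarrow> \<zeta> \<in> ?C" using ia cherry_neq_centre[of i a] by auto
    moreover have "cherries (?C - {x}) = remove (cherries ?C) i a"
      using cherries_remove ia by simp
    moreover have "bob_score (sun_red k Y) (xs @ [x]) = bob_score (sun_red k Y) xs + of_bool (a \<in> reds)"
      unfolding bob_score_snoc using False ia red_iff[of i a] by simp
    moreover have "good_bob (cherries ?C) (\<zeta> \<in> ?C) (bob_score (sun_red k Y) xs)"
      using IH False by simp
    ultimately show ?thesis using bob_step[OF _ ia(4)] False by simp
  qed
  ultimately show ?case unfolding C' by blast
qed

lemma greedy_never_fails:
  assumes "legal_play S xs" "bob_follows (careful_greedy k Y) S xs" "odd (length xs)" "S - set xs \<noteq> {}"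
  shows "careful_greedy k Y (S - set xs) \<noteq> {}"
proof -
  let ?C = "S - set xs"
  have C: "?C \<subseteq> S" by blast
  note good = play_good[OF assms(1,2)]
  \<comment> \<open>If only the centre were left, 4 k moves would have been made and it would be
    Alice's turn.\<close>
  have "active (cherries ?C) \<noteq> {}"
  proof
    assume "active (cherries ?C) = {}"
    then have "?C = {\<zeta>}" using inactive_imp_centre[OF C] assms(4) by blast
    then have "card ?C = 1" by simp
    then have "length xs = 4 * k" using good by simp
    then show False using assms(3) by simp
  qed
  moreover have "good_bob (cherries ?C) (\<zeta> \<in> ?C) (bob_score (sun_red k Y) xs)"
    using good assms(3) by simp
  ultimately show ?thesis using careful_greedy_nonempty[OF C] by blast
qed

lemma finished_score:
  assumes "legal_play S xs" "bob_follows (careful_greedy k Y) S xs" "S - set xs = {}"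
  shows "bob_score (sun_red k Y) xs \<ge> k + h"
proof -
  have "active (cherries (S - set xs)) = {}" unfolding assms(3) by (simp add: active_def cherries_def)
  then show ?thesis
    using play_good[OF assms(1,2)] good_end by (auto split: if_splits)
qed

text \<open>The induction concerns plays, not positions, because the invariant involves the score so
  far. Every move of Alice continues a play of the required kind, while for Bob's maximum one
  careful greedy move is enough.\<close>

lemma game_value_bound:
  assumes "legal_play S xs" "bob_follows (careful_greedy k Y) S xs"
  shows "game_value (sun_red k Y) (if even (length xs) then Alice else Bob) (S - set xs) +
    bob_score (sun_red k Y) xs \<ge> k + h"
  using assms
proof (induction "card (S - set xs)" arbitrary: xs rule: less_induct)
  case less
  let ?C = "S - set xs" and ?red = "sun_red k Y"
  have C: "?C \<subseteq> S" and fin: "finite ?C" using finite_S by auto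
  show ?case
  proof (cases "?C = {}")
    case True
    then show ?thesis using finished_score[OF less.prems] by simp
  next
    case ne: False
    have ext: "extremal ?C \<noteq> {}" "finite (extremal ?C)"
      using extremal_nonempty[OF C ne] fin by (auto simp: extremal_def)
    have step: "game_value ?red (if even (length (xs @ [c])) then Alice else Bob) (?C - {c}) +
        bob_score ?red (xs @ [c]) \<ge> k + h"
      if "c \<in> extremal ?C" "odd (length xs) \<Longrightarrow> c \<in> careful_greedy k Y ?C" for c
    proof -
      have eq: "S - set (xs @ [c]) = ?C - {c}" by auto
      have "c \<in> ?C" using that(1) by (simp add: extremal_def)
      then have "card (S - set (xs @ [c])) < card ?C"
        unfolding eq using fin by (metis card_Diff1_less)
      moreover have "legal_play S (xs @ [c])" "bob_follows (careful_greedy k Y) S (xs @ [c])"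
        using less.prems that unfolding legal_play_snoc bob_follows_snoc by blast+
      ultimately show ?thesis using less.hyps[of "xs @ [c]"] unfolding eq by blast
    qed
    show ?thesis
    proof (cases "even (length xs)")
      case True
      have "k + h - bob_score ?red xs \<le> (MIN c\<in>extremal ?C. game_value ?red Bob (?C - {c}))"
      proof (rule Min.boundedI)
        fix v assume "v \<in> (\<lambda>c. game_value ?red Bob (?C - {c})) ` extremal ?C"
        then obtain c where c: "c \<in> extremal ?C" "v = game_value ?red Bob (?C - {c})" by blast
        then show "k + h - bob_score ?red xs \<le> v" using step[of c] True by (simp add: bob_score_snoc)
      qed (use ext in auto)
      then show ?thesis using True fin ne by (simp add: game_value.simps[of _ Alice])
    next
      case False
      obtain c where c: "c \<in> careful_greedy k Y ?C"
        using greedy_never_fails[OF less.prems False ne] by blast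
      then have cE: "c \<in> extremal ?C" using careful_greedy_extremal[OF C] by blast
      have "of_bool (c \<in> ?red) + game_value ?red Alice (?C - {c}) \<le>
          (MAX c\<in>extremal ?C. of_bool (c \<in> ?red) + game_value ?red Alice (?C - {c}))"
        by (rule Max_ge) (use ext cE in auto)
      then show ?thesis
        using step[OF cE c] False fin ne by (simp add: game_value.simps[of _ Bob] bob_score_snoc)
    qed
  qed
qed

lemma minimax_bound: "minimax S (sun_red k Y) \<ge> k + h"
proof -
  have "legal_play S []" "bob_follows (careful_greedy k Y) S []"
    by (simp_all add: legal_play_def bob_follows_def)
  from game_value_bound[OF this] show ?thesis by (simp add: minimax_def bob_score_def)
qed

end

section \<open>Every sun is oriented\<close>

text \<open>Beam \<open>j\<close> follows beam \<open>i\<close> by 1 to \<open>h\<close> steps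
  modulo 2 h + 1; the second disjunct is the wrapped case j + (2 h + 1) <= i + h.\<close>

definition succ_beam :: "nat \<Rightarrow> nat \<Rightarrow> nat \<Rightarrow> bool" where
  "succ_beam h i j \<longleftrightarrow> i < j \<and> j \<le> i + h \<or> j < i \<and> j + h + 1 \<le> i"

lemma succ_beam_tournament:
  "i < 2 * h + 1 \<Longrightarrow> j < 2 * h + 1 \<Longrightarrow> i \<noteq> j \<Longrightarrow> succ_beam h i j \<longleftrightarrow> \<not> succ_beam h j i"
  unfolding succ_beam_def by linarith

lemma succ_beam_irrefl: "\<not> succ_beam h i i"
  by (simp add: succ_beam_def)

lemma card_succ_beam:
  assumes "i < 2 * h + 1"
  shows "card {j. j < 2 * h + 1 \<and> succ_beam h i j} = h" 
    and "card {j. j < 2 * h + 1 \<and> succ_beam h j i} = h"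
proof -
  show 1: "card {j. j < 2 * h + 1 \<and> succ_beam h i j} = h" 
  proof -
    have "{j. j < 2 * h + 1 \<and> succ_beam h i j} = {i<..min (i + h) (2 * h)} \<union> {..<i - h}"
      using assms by (auto simp: succ_beam_def)
    moreover have "card ({i<..min (i + h) (2 * h)} \<union> {..<i - h}) = h"
      using assms by (subst card_Un_disjoint) auto
    ultimately show ?thesis by simp
  qed
  show "card {j. j < 2 * h + 1 \<and> succ_beam h j i} = h"
  proof -
    have "{j. j < 2 * h + 1 \<and> succ_beam h j i} = {i - h..<i} \<union> {i + h<..2 * h}"
      using assms by (auto simp: succ_beam_def)
    moreover have "card ({i - h..<i} \<union> {i + h<..2 * h}) = h"
      using assms by (subst card_Un_disjoint) auto
    ultimately show ?thesis by simp
  qed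
qed

text \<open>Seen from a beam with nothing on one side, the remaining beams are linearly ordered by their
  distance along the circle.\<close>

lemma half_turn_ranked:
  fixes f :: "nat \<Rightarrow> nat"
  assumes "finite J" "J \<noteq> {}" and rank: "\<And>i j. i \<in> J \<Longrightarrow> j \<in> J \<Longrightarrow> R i j \<Longrightarrow> f j < f i"
  shows "(\<exists>l\<in>J. \<forall>j\<in>J. \<not> R l j) \<and> (\<exists>r\<in>J. \<forall>j\<in>J. \<not> R j r)"
proof
  have "Min (f ` J) \<in> f ` J" using assms by (intro Min_in) auto
  then obtain l where "l \<in> J" "f l = Min (f ` J)" by (metis imageE)
  then have "\<forall>j\<in>J. \<not> R l j" using rank assms(1) by (metis Min_le finite_imageI imageI linorder_not_less)
  then show "\<exists>l\<in>J. \<forall>j\<in>J. \<not> R l j" using \<open>l \<in> J\<close> by blast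
  have "Max (f ` J) \<in> f ` J" using assms by (intro Max_in) auto
  then obtain r where "r \<in> J" "f r = Max (f ` J)" by (metis imageE)
  then have "\<forall>j\<in>J. \<not> R j r" using rank assms(1) by (metis Max_ge finite_imageI imageI linorder_not_less)
  then show "\<exists>r\<in>J. \<forall>j\<in>J. \<not> R j r" using \<open>r \<in> J\<close> by blast
qed

lemma succ_beam_half_turn:
  assumes "l < 2 * h + 1" "J \<subseteq> {..<2 * h + 1}" "J \<noteq> {}" "\<forall>j\<in>J. \<not> succ_beam h l j"
  shows "(\<exists>l\<in>J. \<forall>j\<in>J. \<not> succ_beam h l j) \<and> (\<exists>r\<in>J. \<forall>j\<in>J. \<not> succ_beam h j r)"
proof (rule half_turn_ranked)
  \<comment> \<open>The number of steps from \<open>l\<close> back to \<open>j\<close>. It is at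
    most \<open>h\<close> on \<open>J\<close>, since no member of \<open>J\<close> follows
    \<open>l\<close>; within this range a successor is nearer to \<open>l\<close>.\<close>
  let ?f = "\<lambda>j. if j \<le> l then l - j else l + (2 * h + 1) - j"
  fix i j assume ij: "i \<in> J" "j \<in> J" "succ_beam h i j"
  then have "i < 2 * h + 1" "j < 2 * h + 1" "\<not> succ_beam h l i" "\<not> succ_beam h l j" using assms by auto
  then show "?f j < ?f i" using ij(3) assms(1) unfolding succ_beam_def by auto
next
  show "finite J" using assms(2) by (rule finite_subset) simp
qed (fact assms(3))

lemma pred_beam_half_turn:
  assumes "l < 2 * h + 1" "J \<subseteq> {..<2 * h + 1}" "J \<noteq> {}" "\<forall>j\<in>J. \<not> succ_beam h j l"
  shows "(\<exists>l\<in>J. \<forall>j\<in>J. \<not> succ_beam h j l) \<and> (\<exists>r\<in>J. \<forall>j\<in>J. \<not> succ_beam h r j)"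
proof (rule half_turn_ranked)
  let ?f = "\<lambda>j. if l \<le> j then j - l else j + (2 * h + 1) - l"
  fix i j assume ij: "i \<in> J" "j \<in> J" "succ_beam h j i"
  then have "i < 2 * h + 1" "j < 2 * h + 1" "\<not> succ_beam h i l" "\<not> succ_beam h j l" using assms by auto
  then show "?f j < ?f i" using ij(3) assms(1) unfolding succ_beam_def by auto
next
  show "finite J" using assms(2) by (rule finite_subset) simp
qed (fact assms(3))

context
  fixes k h :: nat and \<zeta> :: complex and Y :: "nat \<Rightarrow> nat \<Rightarrow> complex"
  assumes k: "k = 2 * h + 1" and h: "h \<ge> 1" and sun: "sun k \<zeta> Y"
begin

section \<open>Bringing a sun into normal position\<close>

lemma
  shows sun_inj: "inj_on (\<lambda>(i, j). Y i j) ({..<k} \<times> {..<4})"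
    and sun_centre_notin: "\<forall>i<k. \<zeta> \<notin> beam Y i"
    and sun_symmetric: "\<forall>i<k. \<forall>j<4. Y i j = \<zeta> + cis (2 * pi * real i / real k) * (Y 0 j - \<zeta>)"
    and sun_outermost: "\<forall>i<k. \<forall>j\<in>{1, 2, 3}. dist \<zeta> (Y i j) < dist \<zeta> (Y i 0)"
    and sun_polygon: "\<forall>i<k. convex_polygon [Y i 0, Y i 1, Y i 2, Y i 3, \<zeta>]"
    and sun_count: "\<forall>i<k. \<forall>p\<in>beam Y i. \<forall>q\<in>beam Y i. p \<noteq> q \<longrightarrow>
        (\<forall>j<k. j \<noteq> i \<longrightarrow> affine hull {p, q} \<inter> convex hull (beam Y j) = {}) \<and>
        card {j. j < k \<and> j \<noteq> i \<and> beam Y j \<subseteq> left_side p q} = (k - 1) div 2"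
  using sun unfolding sun_def by - (elim conjE, assumption)+

definition arm :: complex where "arm = Y 0 0 - \<zeta>"
text \<open>Beam 0 after the similarity that sends the centre to 0 and the outermost cherry to
  1.\<close>

definition unit_beam :: "nat \<Rightarrow> complex" where "unit_beam a = (Y 0 a - \<zeta>) / arm"

abbreviation rotation :: "nat \<Rightarrow> complex" where
  "rotation j \<equiv> cis (2 * pi * real j / real k)"

lemma arm_nonzero: "arm \<noteq> 0"
  using sun_centre_notin k by (force simp: arm_def beam_def)

lemma cherry_eq_rotation: 
  assumes "i < k" "a < 4"
  shows "Y i a = \<zeta> + arm * (rotation i * unit_beam a)"
proof -
  have "Y i a = \<zeta> + rotation i * (Y 0 a - \<zeta>)" using sun_symmetric assms by blast
  then show ?thesis using arm_nonzero by (simp add: unit_beam_def)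
qed

lemma orient_unit_beam:
  assumes "a < 4" "b < 4" "j < k" "c < 4"
  shows "orient (Y 0 a) (Y 0 b) (Y j c) =
      (norm arm)\<^sup>2 * orient (unit_beam a) (unit_beam b) (rotation j * unit_beam c)"
    and "orient (Y 0 a) (Y 0 b) \<zeta> = (norm arm)\<^sup>2 * orient (unit_beam a) (unit_beam b) 0"
proof -
  have c: "Y 0 a = \<zeta> + arm * unit_beam a" "Y 0 b = \<zeta> + arm * unit_beam b"
    using cherry_eq_rotation[of 0] assms k by auto
  show "orient (Y 0 a) (Y 0 b) (Y j c) =
      (norm arm)\<^sup>2 * orient (unit_beam a) (unit_beam b) (rotation j * unit_beam c)"
    unfolding c cherry_eq_rotation[OF assms(3,4)] by (rule orient_affine_image)
  show "orient (Y 0 a) (Y 0 b) \<zeta> = (norm arm)\<^sup>2 * orient (unit_beam a) (unit_beam b) 0"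
    unfolding c using orient_affine_image[of \<zeta> arm _ _ 0] by simp
qed

text \<open>The difference j - i modulo \<open>k\<close>, for indices below
  \<open>k\<close>.\<close>

definition turn_index :: "nat \<Rightarrow> nat \<Rightarrow> nat" where
  "turn_index i j = (if i \<le> j then j - i else j + k - i)"

lemma rotation_turn_index:
  assumes "i < k" "j < k"
  shows "rotation j = rotation i * rotation (turn_index i j)"
proof (cases "i \<le> j")
  case True
  then have "real j = real i + real (turn_index i j)" by (simp add: turn_index_def)
  then show ?thesis by (simp add: cis_mult flip: add_divide_distrib distrib_left)
next
  case False
  then have "real i + real (turn_index i j) = real j + real k" using assms by (simp add: turn_index_def)
  then have "rotation i * rotation (turn_index i j) = cis (2 * pi * (real j + real k) / real k)"
    by (simp add: cis_mult flip: add_divide_distrib distrib_left)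
  also have "\<dots> = cis (2 * pi * real j / real k + 2 * pi)"
  proof -
    have "real k > 0" using k by simp
    then have "2 * pi * (real j + real k) / real k = 2 * pi * real j / real k + 2 * pi"
      by (simp add: distrib_left add_divide_distrib)
    then show ?thesis by (rule arg_cong)
  qed
  also have "\<dots> = rotation j" by (simp flip: cis_mult)
  finally show ?thesis ..
qed

lemma orient_turn:
  assumes "i < k" "j < k" "a < 4" "b < 4" "c < 4"
  shows "orient (Y i a) (Y i b) (Y j c) =
      (norm arm)\<^sup>2 * orient (unit_beam a) (unit_beam b) (rotation (turn_index i j) * unit_beam c)"
    and "orient (Y i a) (Y i b) \<zeta> = (norm arm)\<^sup>2 * orient (unit_beam a) (unit_beam b) 0"
    and "orient \<zeta> (Y i a) (Y j b) =
      (norm arm)\<^sup>2 * orient 0 (unit_beam a) (rotation (turn_index i j) * unit_beam b)"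
proof -
  let ?w = "arm * rotation i"
  have i: "Y i d = \<zeta> + ?w * unit_beam d" if "d < 4" for d
    using cherry_eq_rotation[OF assms(1) that] by (simp add: mult_ac)
  have j: "Y j d = \<zeta> + ?w * (rotation (turn_index i j) * unit_beam d)" if "d < 4" for d
    using cherry_eq_rotation[OF assms(2) that] unfolding rotation_turn_index[OF assms(1,2)] by (simp only: mult_ac)
  have n: "norm ?w = norm arm" by (simp add: norm_mult)
  show "orient (Y i a) (Y i b) (Y j c) =
      (norm arm)\<^sup>2 * orient (unit_beam a) (unit_beam b) (rotation (turn_index i j) * unit_beam c)"
    unfolding i[OF assms(3)] i[OF assms(4)] j[OF assms(5)] orient_affine_image n ..
  show "orient (Y i a) (Y i b) \<zeta> = (norm arm)\<^sup>2 * orient (unit_beam a) (unit_beam b) 0"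
    unfolding i[OF assms(3)] i[OF assms(4)] using orient_affine_image[of \<zeta> ?w _ _ 0] n by simp
  show "orient \<zeta> (Y i a) (Y j b) =
      (norm arm)\<^sup>2 * orient 0 (unit_beam a) (rotation (turn_index i j) * unit_beam b)"
    unfolding i[OF assms(3)] j[OF assms(4)] using orient_affine_image[of \<zeta> ?w 0] n by simp
qed

lemma turn_index_0: "i < k \<Longrightarrow> turn_index i i = 0" by (simp add: turn_index_def)

lemma succ_beam_turn_index:
  "i < k \<Longrightarrow> j < k \<Longrightarrow> succ_beam h i j \<longleftrightarrow> 1 \<le> turn_index i j \<and> turn_index i j \<le> h"
  "i < k \<Longrightarrow> j < k \<Longrightarrow> succ_beam h j i \<longleftrightarrow> h < turn_index i j \<and> turn_index i j < k"
  unfolding succ_beam_def turn_index_def by (use k in auto)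

lemma norm_cherry: "i < k \<Longrightarrow> a < 4 \<Longrightarrow> dist \<zeta> (Y i a) = norm arm * norm (unit_beam a)"
  by (simp add: cherry_eq_rotation dist_norm norm_mult)

lemma norm_unit_beam_less:
  assumes "a \<in> {1,2,3}"
  shows "norm (unit_beam a) < 1"
proof -
  have "dist \<zeta> (Y 0 a) < dist \<zeta> (Y 0 0)" using sun_outermost[rule_format, of 0 a] assms k by simp
  moreover have "dist \<zeta> (Y 0 0) = norm arm" by (simp add: arm_def dist_norm norm_minus_commute)
  moreover have "dist \<zeta> (Y 0 a) = norm arm * norm (unit_beam a)"
    using norm_cherry[of 0 a] assms k by auto
  ultimately show ?thesis using arm_nonzero by simp
qed

lemma unit_beam_polygon:
  obtains s :: real where "s \<in> {1, -1}"
    and "\<And>a b c. a < b \<Longrightarrow> b < c \<Longrightarrow> c < 4 \<Longrightarrow> s * orient (unit_beam a) (unit_beam b) (unit_beam c) > 0"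
    and "\<And>a b. a < b \<Longrightarrow> b < 4 \<Longrightarrow> s * orient (unit_beam a) (unit_beam b) 0 > 0"
proof -
  let ?xs = "[Y 0 0, Y 0 1, Y 0 2, Y 0 3, \<zeta>]"
  have nth: "?xs ! a = Y 0 a" if "a < 4" for a
    using that by (auto simp: numeral_eq_Suc less_Suc_eq)
  have nth4: "?xs ! 4 = \<zeta>" by simp
  have "convex_polygon ?xs" using sun_polygon k by simp
  then obtain s :: real where s: "s \<in> {1, -1}" and
    all: "\<And>a b c. a < b \<Longrightarrow> b < c \<Longrightarrow> c < 5 \<Longrightarrow> s * orient (?xs ! a) (?xs ! b) (?xs ! c) > 0"
    unfolding convex_polygon_def
  proof (elim disjE, goal_cases)
    case 1
    then show ?case using 1(1)[of 1] by simp
  next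
    case 2
    then show ?case using 2(1)[of "-1"] by simp
  qed
  have pos: "(norm arm)\<^sup>2 > 0" using arm_nonzero by simp
  show ?thesis
  proof (rule that[OF s])
    fix a b c :: nat assume "a < b" "b < c" "c < 4"
    then have "s * orient (Y 0 a) (Y 0 b) (Y 0 c) > 0"
      using all[of a b c] nth[of a] nth[of b] nth[of c] by simp
    then have "(norm arm)\<^sup>2 * (s * orient (unit_beam a) (unit_beam b) (unit_beam c)) > 0"
      using orient_turn(1)[of 0 0 a b c] \<open>a < b\<close> \<open>b < c\<close> \<open>c < 4\<close> k turn_index_0[of 0]
      by (simp add: mult_ac)
    then show "s * orient (unit_beam a) (unit_beam b) (unit_beam c) > 0"
      using pos zero_less_mult_pos by blast
  next
    fix a b :: nat assume "a < b" "b < 4"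
    then have "s * orient (Y 0 a) (Y 0 b) \<zeta> > 0"
      using all[of a b 4] nth[of a] nth[of b] nth4 by simp
    then have "(norm arm)\<^sup>2 * (s * orient (unit_beam a) (unit_beam b) 0) > 0"
      using orient_turn(2)[of 0 0 a b 0] \<open>a < b\<close> \<open>b < 4\<close> k by (simp add: mult_ac)
    then show "s * orient (unit_beam a) (unit_beam b) 0 > 0"
      using pos zero_less_mult_pos by blast
  qed
qed

lemma card_one_side:
  assumes "a < 4" "b < 4" "a \<noteq> b"
  shows "card {j \<in> {1..<k}. \<forall>c<4. orient (unit_beam a) (unit_beam b) (rotation j * unit_beam c) > 0} = h"
proof -
  have pos: "(norm arm)\<^sup>2 > 0" using arm_nonzero by simp
  have "Y 0 a \<noteq> Y 0 b"
    using inj_onD[OF sun_inj, of "(0, a)" "(0, b)"] assms k by auto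
  moreover have "Y 0 a \<in> beam Y 0" "Y 0 b \<in> beam Y 0" using assms by (auto simp: beam_def)
  ultimately have "card {j. j < k \<and> j \<noteq> 0 \<and> beam Y j \<subseteq> left_side (Y 0 a) (Y 0 b)} = (k - 1) div 2"
    using sun_count[rule_format, of 0 "Y 0 a" "Y 0 b"] k by simp
  moreover have "{j. j < k \<and> j \<noteq> 0 \<and> beam Y j \<subseteq> left_side (Y 0 a) (Y 0 b)} =
    {j \<in> {1..<k}. \<forall>c<4. orient (unit_beam a) (unit_beam b) (rotation j * unit_beam c) > 0}"
    using orient_unit_beam(1)[OF assms(1,2)] pos
    by (auto simp: beam_def left_side_def image_subset_iff zero_less_mult_iff)
  ultimately show ?thesis using k by simp
qed

lemma card_other_side:
  assumes "a < 4" "b < 4" "a \<noteq> b"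
  shows "card {j \<in> {1..<k}. \<forall>c<4. orient (unit_beam a) (unit_beam b) (rotation j * unit_beam c) < 0} = h"
  using card_one_side[OF assms(2,1)] assms(3) by (simp add: orient_swap[of "unit_beam a"])

text \<open>Complex conjugation, which makes a clockwise beam anticlockwise, exchanges the positions
  \<open>j\<close> and \<open>k - j\<close>.\<close>

lemma rotation_opposite:
  assumes "1 \<le> j" "j < k"
  shows "rotation (k - j) = cnj (rotation j)"
proof -
  have "2 * pi * real (k - j) / real k = 2 * pi - 2 * pi * real j / real k"
    using assms by (simp add: of_nat_diff field_simps)
  then have "rotation (k - j) = cis (2 * pi + - (2 * pi * real j / real k))" by simp
  also have "\<dots> = cis (- (2 * pi * real j / real k))" by (simp only: cis_mult[symmetric]) simp
  finally show ?thesis by (simp add: cis_cnj)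
qed

lemma card_reflect:
  "card {j \<in> {1..<k}. P (k - j)} = card {j \<in> {1..<k}. P j}"
  by (rule bij_betw_same_card[of "\<lambda>j. k - j"], rule bij_betwI[of _ _ _ "\<lambda>j. k - j"]) auto

section \<open>The two senses of bending\<close>

lemma anticlockwise_oriented_sun:
  assumes "normalized_beam k h unit_beam"
  shows "oriented_sun k h (succ_beam h) \<zeta> Y 1"
proof -
  interpret normalized_beam k h unit_beam by fact
  have pos: "(norm arm)\<^sup>2 > 0" using arm_nonzero by simp
  show ?thesis
  proof
    fix i j a b c :: nat assume "i < k" "j < k" "succ_beam h i j" "a < b" "b < 4" "c < 4"
    then show "1 * orient (Y i a) (Y i b) (Y j c) < 0"
      using sides(1)[of a b "turn_index i j" c] orient_turn(1)[of i j a b c] pos succ_beam_turn_index[of i j]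
      by (simp add: mult_pos_neg)
  next
    fix i j a b c :: nat assume "i < k" "j < k" "succ_beam h j i" "a < b" "b < 4" "c < 4"
    then show "1 * orient (Y i a) (Y i b) (Y j c) > 0"
      using sides(2)[of a b "turn_index i j" c] orient_turn(1)[of i j a b c] pos succ_beam_turn_index[of i j]
      by (simp add: mult_pos_neg)
  next
    fix i a b c :: nat assume "i < k" "a < b" "b < c" "c < 4"
    then show "1 * orient (Y i a) (Y i b) (Y i c) > 0"
      using convex[of a b c] orient_turn(1)[of i i a b c] pos turn_index_0[of i] by simp
  next
    fix i a b :: nat assume "i < k" "a < b" "b < 4"
    then show "1 * orient (Y i a) (Y i b) \<zeta> > 0"
      using convex_centre[of a b] orient_turn(2)[of i i a b 0] pos by simp
  next
    fix i j a b :: nat assume "i < k" "j < k" "succ_beam h i j" "a < 4" "b < 4"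
    then show "1 * orient \<zeta> (Y i a) (Y j b) > 0"
      using cross_beams[of "turn_index i j" a b] orient_turn(3)[of i j a b 0] pos succ_beam_turn_index[of i j]
      by simp
  next
    fix i a b :: nat assume "i < k" "a < b" "b < 4"
    then show "dist \<zeta> (Y i b) < dist \<zeta> (Y i a)"
      using norm_decreasing[of a b] norm_cherry arm_nonzero by simp
  next
    fix i j :: nat assume "i < k" "j < k" "i \<noteq> j"
    then show "succ_beam h i j \<longleftrightarrow> \<not> succ_beam h j i"
      using succ_beam_tournament[of i h j] k by simp
  next
    fix i :: nat assume "i < k"
    then show "card {j. j < k \<and> succ_beam h i j} = h"
      using card_succ_beam(1)[of i h] k by simp
  next
    fix l :: nat and J :: "nat set" assume "l < k" "J \<subseteq> {..<k}" "J \<noteq> {}" "\<forall>j\<in>J. \<not> succ_beam h l j"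
    then show "(\<exists>l\<in>J. \<forall>j\<in>J. \<not> succ_beam h l j) \<and> (\<exists>r\<in>J. \<forall>j\<in>J. \<not> succ_beam h j r)"
      using succ_beam_half_turn[of l h J] k by blast
  qed (fact k h sun succ_beam_irrefl)+
qed

text \<open>The mirror image bends anticlockwise. Reflection reverses the cyclic order and the sign
  of every orientation, hence the converse of \<open>succ_beam\<close> and the sign -1.\<close>

lemma clockwise_oriented_sun:
  assumes "normalized_beam k h (\<lambda>a. cnj (unit_beam a))"
  shows "oriented_sun k h (\<lambda>i j. succ_beam h j i) \<zeta> Y (-1)"
proof -
  interpret normalized_beam k h "\<lambda>a. cnj (unit_beam a)" by fact
  have pos: "(norm arm)\<^sup>2 > 0" using arm_nonzero by simp
  have refl: "orient (unit_beam a) (unit_beam b) (rotation j * unit_beam c) =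
      - orient (cnj (unit_beam a)) (cnj (unit_beam b)) (rotation (k - j) * cnj (unit_beam c))"
    "orient 0 (unit_beam b) (rotation j * unit_beam c) =
      - orient 0 (cnj (unit_beam b)) (rotation (k - j) * cnj (unit_beam c))"
    if "1 \<le> j" "j < k" for a b c j
    using orient_cnj[of "unit_beam a" "unit_beam b" "rotation j * unit_beam c"]
      orient_cnj[of 0 "unit_beam b" "rotation j * unit_beam c"] rotation_opposite[OF that] by auto
  have refl0: "orient (unit_beam a) (unit_beam b) (unit_beam c) =
      - orient (cnj (unit_beam a)) (cnj (unit_beam b)) (cnj (unit_beam c))"
    "orient (unit_beam a) (unit_beam b) 0 = - orient (cnj (unit_beam a)) (cnj (unit_beam b)) 0" for a b c
    using orient_cnj[of "unit_beam a" "unit_beam b" "unit_beam c"]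
      orient_cnj[of "unit_beam a" "unit_beam b" 0] by auto
  show ?thesis
  proof
    fix i j a b c :: nat assume *: "i < k" "j < k" "succ_beam h j i" "a < b" "b < 4" "c < 4"
    let ?t = "turn_index i j"
    have t: "h < ?t" "?t < k" using succ_beam_turn_index[of i j] * by auto
    then show "- 1 * orient (Y i a) (Y i b) (Y j c) < 0"
      using sides(1)[of a b "k - ?t" c] orient_turn(1)[of i j a b c] pos * k refl(1)[of ?t a b c]
      by (simp add: mult_pos_neg)
  next
    fix i j a b c :: nat assume *: "i < k" "j < k" "succ_beam h i j" "a < b" "b < 4" "c < 4"
    let ?t = "turn_index i j"
    have t: "1 \<le> ?t" "?t \<le> h" using succ_beam_turn_index[of i j] * by auto
    then show "- 1 * orient (Y i a) (Y i b) (Y j c) > 0"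
      using sides(2)[of a b "k - ?t" c] orient_turn(1)[of i j a b c] pos * k refl(1)[of ?t a b c]
      by (simp add: mult_pos_neg)
  next
    fix i a b c :: nat assume "i < k" "a < b" "b < c" "c < 4"
    then show "- 1 * orient (Y i a) (Y i b) (Y i c) > 0"
      using convex[of a b c] orient_turn(1)[of i i a b c] pos turn_index_0[of i] refl0 by simp
  next
    fix i a b :: nat assume "i < k" "a < b" "b < 4"
    then show "- 1 * orient (Y i a) (Y i b) \<zeta> > 0"
      using convex_centre[of a b] orient_turn(2)[of i i a b 0] pos refl0 by simp
  next
    fix i j a b :: nat assume *: "i < k" "j < k" "succ_beam h j i" "a < 4" "b < 4"
    let ?t = "turn_index i j"
    have t: "h < ?t" "?t < k" using succ_beam_turn_index[of i j] * by auto
    then show "- 1 * orient \<zeta> (Y i a) (Y j b) > 0"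
      using cross_beams[of "k - ?t" a b] orient_turn(3)[of i j a b 0] pos * k refl(2)[of ?t a b]
      by simp
  next
    fix i a b :: nat assume "i < k" "a < b" "b < 4"
    then show "dist \<zeta> (Y i b) < dist \<zeta> (Y i a)"
      using norm_decreasing[of a b] norm_cherry arm_nonzero by simp
  next
    fix i j :: nat assume "i < k" "j < k" "i \<noteq> j"
    then show "succ_beam h j i \<longleftrightarrow> \<not> succ_beam h i j"
      using succ_beam_tournament[of i h j] k by simp
  next
    fix i :: nat assume "i < k"
    then show "card {j. j < k \<and> succ_beam h j i} = h"
      using card_succ_beam(2)[of i h] k by simp
  next
    fix l :: nat and J :: "nat set" assume "l < k" "J \<subseteq> {..<k}" "J \<noteq> {}" "\<forall>j\<in>J. \<not> succ_beam h j l"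
    then show "(\<exists>l\<in>J. \<forall>j\<in>J. \<not> succ_beam h j l) \<and> (\<exists>r\<in>J. \<forall>j\<in>J. \<not> succ_beam h r j)"
      using pred_beam_half_turn[of l h J] k by blast
  qed (fact k h sun succ_beam_irrefl)+
qed

lemma oriented_sun_exists: "\<exists>B \<sigma>. oriented_sun k h B \<zeta> Y \<sigma>"
proof -
  obtain s :: real where s: "s \<in> {1, -1}"
    and conv: "\<And>a b c. a < b \<Longrightarrow> b < c \<Longrightarrow> c < 4 \<Longrightarrow> s * orient (unit_beam a) (unit_beam b) (unit_beam c) > 0"
    and centre: "\<And>a b. a < b \<Longrightarrow> b < 4 \<Longrightarrow> s * orient (unit_beam a) (unit_beam b) 0 > 0"
    using unit_beam_polygon by blast
  have one: "unit_beam 0 = 1" using arm_nonzero by (simp add: unit_beam_def arm_def)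
  consider "s = 1" | "s = -1" using s by auto
  then show ?thesis
  proof cases
    case 1
    have "normalized_beam k h unit_beam"
    proof
      fix a b :: nat assume ab: "a < b" "b < 4"
      show "orient (unit_beam a) (unit_beam b) 0 > 0" using centre[OF ab] 1 by simp
      show "card {j \<in> {1..<k}. \<forall>c<4. orient (unit_beam a) (unit_beam b) (rotation j * unit_beam c) < 0} = h"
        by (rule card_other_side) (use ab in auto)
      show "card {j \<in> {1..<k}. \<forall>c<4. orient (unit_beam a) (unit_beam b) (rotation j * unit_beam c) > 0} = h"
        by (rule card_one_side) (use ab in auto)
    next
      fix a b c :: nat assume "a < b" "b < c" "c < 4"
      then show "orient (unit_beam a) (unit_beam b) (unit_beam c) > 0" using conv[of a b c] 1 by simp
    qed (use k h one norm_unit_beam_less in simp_all)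
    then show ?thesis using anticlockwise_oriented_sun by blast
  next
    case 2
    have "normalized_beam k h (\<lambda>a. cnj (unit_beam a))"
    proof
      fix a b :: nat assume ab: "a < b" "b < 4"
      have c: "orient (cnj (unit_beam a)) (cnj (unit_beam b)) (rotation j * cnj (unit_beam c)) =
          - orient (unit_beam a) (unit_beam b) (rotation (k - j) * unit_beam c)"
        if "1 \<le> j" "j < k" for j c
        using orient_cnj[of "unit_beam a" "unit_beam b" "rotation (k - j) * unit_beam c"]
          rotation_opposite[OF that] by simp
      have "card {j \<in> {1..<k}. \<forall>c<4. orient (cnj (unit_beam a)) (cnj (unit_beam b)) (rotation j * cnj (unit_beam c)) < 0}
        = card {j \<in> {1..<k}. \<forall>c<4. orient (unit_beam a) (unit_beam b) (rotation (k - j) * unit_beam c) > 0}"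
        using c by (intro arg_cong[of _ _ card]) auto
      also have "\<dots> = h"
        by (subst card_reflect, rule card_one_side) (use ab in auto)
      finally show "card {j \<in> {1..<k}. \<forall>c<4. orient (cnj (unit_beam a)) (cnj (unit_beam b)) (rotation j * cnj (unit_beam c)) < 0} = h" .
      have "card {j \<in> {1..<k}. \<forall>c<4. orient (cnj (unit_beam a)) (cnj (unit_beam b)) (rotation j * cnj (unit_beam c)) > 0}
        = card {j \<in> {1..<k}. \<forall>c<4. orient (unit_beam a) (unit_beam b) (rotation (k - j) * unit_beam c) < 0}"
        using c by (intro arg_cong[of _ _ card]) auto
      also have "\<dots> = h"
        by (subst card_reflect, rule card_other_side) (use ab in auto)
      finally show "card {j \<in> {1..<k}. \<forall>c<4. orient (cnj (unit_beam a)) (cnj (unit_beam b)) (rotation j * cnj (unit_beam c)) > 0} = h" .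
      show "orient (cnj (unit_beam a)) (cnj (unit_beam b)) 0 > 0"
        using centre[OF ab] 2 orient_cnj[of "unit_beam a" "unit_beam b" 0] by simp
    next
      fix a b c :: nat assume "a < b" "b < c" "c < 4"
      then show "orient (cnj (unit_beam a)) (cnj (unit_beam b)) (cnj (unit_beam c)) > 0"
        using conv[of a b c] 2 orient_cnj[of "unit_beam a" "unit_beam b" "unit_beam c"] by simp
    qed (use k h one norm_unit_beam_less in simp_all)
    then show ?thesis using clockwise_oriented_sun by blast
  qed
qed

end

theorem theorem1:
  fixes k :: nat and \<zeta> :: complex and Y :: "nat \<Rightarrow> nat \<Rightarrow> complex"
  assumes "odd k" and "k > 2" and "sun k \<zeta> Y"
  defines "S \<equiv> sun_cherries k \<zeta> Y" and "red \<equiv> sun_red k Y"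
  shows "(\<forall>xs. legal_play S xs \<and> bob_follows (careful_greedy k Y) S xs \<and>
            odd (length xs) \<and> S - set xs \<noteq> {} \<longrightarrow> careful_greedy k Y (S - set xs) \<noteq> {}) \<and>
         (\<forall>xs. legal_play S xs \<and> bob_follows (careful_greedy k Y) S xs \<and> set xs = S \<longrightarrow>
            real (bob_score red xs) \<ge> (3 * real k - 1) / 2) \<and>
         (3 * real k - 1) / 2 = 3 / 4 * real (num_red red S) - 1 / 2 \<and>
         real (minimax S red) \<ge> 3 / 4 * real (num_red red S) - 1 / 2"
proof -
  define h where "h = k div 2"
  have k: "k = 2 * h + 1" and h: "h \<ge> 1" using assms(1,2) by (auto simp: h_def elim: oddE)
  obtain B \<sigma> where os: "oriented_sun k h B \<zeta> Y \<sigma>"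
    using oriented_sun_exists[OF k h \<open>sun k \<zeta> Y\<close>] by blast
  have bound: "(3 * real k - 1) / 2 = real (k + h)" using k by simp
  have reds: "num_red red S = 2 * k"
    unfolding S_def red_def by (rule oriented_sun.num_red_S[OF os])
  have value_eq: "(3 * real k - 1) / 2 = 3 / 4 * real (num_red red S) - 1 / 2"
    unfolding reds by (simp add: field_simps)
  have "minimax S red \<ge> k + h"
    unfolding S_def red_def by (rule oriented_sun.minimax_bound[OF os])
  then have "real (minimax S red) \<ge> 3 / 4 * real (num_red red S) - 1 / 2"
    unfolding value_eq[symmetric] bound by linarith
  moreover have "real (bob_score red xs) \<ge> (3 * real k - 1) / 2"
    if "legal_play S xs" "bob_follows (careful_greedy k Y) S xs" "set xs = S" for xs
  proof -
    have "bob_score red xs \<ge> k + h"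
      using that unfolding S_def red_def by (intro oriented_sun.finished_score[OF os]) auto
    then show ?thesis unfolding bound by linarith
  qed
  moreover have "careful_greedy k Y (S - set xs) \<noteq> {}"
    if "legal_play S xs" "bob_follows (careful_greedy k Y) S xs" "odd (length xs)" "S - set xs \<noteq> {}" for xs
    using that unfolding S_def by (intro oriented_sun.greedy_never_fails[OF os])
  ultimately show ?thesis using value_eq by blast
qed

end
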